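(* Let $\Omega$ be a cohomological field theory on $(V,\eta)$ with a basis $\{e_\alpha\}_{\alpha\in A}$ of $V$ such that every class $\Omega_{0,n}(e_{\alpha_1},\ldots,e_{\alpha_n})$ has pure dimension $d_{n}(\alpha_1,\ldots,\alpha_n)$. Treat the genus-zero numerical CohFT invariants $\omega_{0,n}(e_{\alpha_1},\ldots,e_{\alpha_n})$ as unknowns $x_n(\alpha_1,\ldots,\alpha_n)$. Then the following two collections of equations impose equivalent constraints on the unknowns, i.e. an array $x$ satisfies all the equations in (1) if and only if it satisfies all the equations in (2): (1) the balancing equations for all tropical cycles $\Omega^{\mathrm{trop}}_{0,n}(e_{\alpha_1},\ldots,e_{\alpha_n})$: for all $n$ and $\alpha=(\alpha_1,\ldots,\alpha_n)$ with $d:=d_n(\alpha)\ge1$, and every $(d-1)$-dimensional cone $\tau$ of $M_{0,n}^{\mathrm{trop}}$, $$\sum_{\sigma\succ\tau}P_{\Gamma_\sigma}(x;\alpha)\,\mathbf{u}_{\tau/\sigma}=0\in Q_{[n]}/\langle\tau\rangle_{\mathbb{R}},$$ the sum being over $d$-dimensional cones $\sigma$ having $\tau$ as a face; (2) all WDVV relations: for all $n$ and $\alpha$ with $d:=d_n(\alpha)\ge1$, every stable tree $\Gamma$ with $n$ legs and $d-1$ edges, every vertex $v$ of $\Gamma$ and all distinct half-edges $a,b,c,f$ (legs included) at $v$, $$\sum_{\Gamma'\in \mathrm{Spl}(v;\,ab|cf)}P_{\Gamma'}(x;\alpha)-\sum_{\Gamma'\in \mathrm{Spl}(v;\,af|bc)}P_{\Gamma'}(x;\alpha)=0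 .$$
   Context: CohFT. $V$ is a finite-dimensional vector space with nondegenerate symmetric bilinear form $\eta$; a CohFT $\Omega$ is a collection of $S_n$-invariant multilinear maps $\Omega_{g,n}:V^{n}\to A^*(\overline{M}_{g,n})$ (coefficients extended to the ground field) compatible with gluing: the pullback of $\Omega_{g,n}(v_1,\ldots,v_n)$ along $\overline{M}_{g_1,|J|+1}\times\overline{M}_{g_2,|J^c|+1}\to\overline{M}_{g,n}$ is $\sum_{\alpha,\beta}\eta^{\alpha\beta}\,\Omega_{g_1,|J|+1}((v_i)_{i\in J},e_\alpha)\boxtimes\Omega_{g_2,|J^c|+1}(e_\beta,(v_i)_{i\in J^c})$, where $(\eta^{\alpha\beta})$ is the inverse matrix of $\eta$ in the basis $\{e_\alpha\}$, and the pullback along $\overline{M}_{g-1,n+2}\to\overline{M}_{g,n}$ is $\sum\eta^{\alpha\beta}\Omega_{g-1,n+2}(v_1,\ldots,v_n,e_\alpha,e_\beta)$. The numerical part is $\omega_{g,n}(v_1,\ldots,v_n)=\int_{\overline{M}_{g,n}}\Omega_{g,n}(v_1,\ldots,v_n)$. A class in $A^k(\overline{M}_{0,n})$ has dimension $n-3-k$. Unknowns. $x=(x_n(\alpha_1,\ldots,\alpha_n))_{n\ge3,\ \alpha_i\in A}$ is an array of scalars, symmetric in $\alpha_1,\dots,\alpha_n$, with $x_n(\alpha)=0$ unless $d_n(\alpha)=0$ (numerical invariants only involve zero-dimensional classes). Weights. A stable tree $\Gamma$ with $n$ legs is a tree with legs (half-edges attached to one vertex) labeled by $[n]=\{1,\ldots,n\}$,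 every vertex $v$ having valence $n_v\ge3$ (counting legs). Given $\alpha=(\alpha_1,\ldots,\alpha_n)$, set $$P_\Gamma(x;\alpha)=\sum_{\beta}\ \prod_{\text{edges }e=\{h,h'\}}\eta^{\beta_h\beta_{h'}}\ \prod_{v}x_{n_v}\bigl((\alpha_i)_{i\text{ leg at }v},(\beta_h)_{h\text{ half-edge of an edge at }v}\bigr),$$ the sum over all assignments $\beta$ of elements of $A$ to the half-edges of edges of $\Gamma$. By the gluing axioms, at $x=\omega$ this is $\int_{\overline{M}_{0,n}}\Delta_\Gamma\cdot\Omega_{0,n}(e_{\alpha_1},\ldots,e_{\alpha_n})$, with $\Delta_\Gamma$ the closed boundary stratum of $\Gamma$. Tropical objects. $M_{0,n}^{\mathrm{trop}}$ is the cone complex parameterizing stable metric trees with $n$ labeled legs; its cones correspond to stable trees $\Gamma$ (dimension = number of edges, coordinates = edge lengths), faces corresponding to edge contractions; $\Gamma_\sigma$ is the tree of $\sigma$. Fix $k\in[n]$. $Q_{[n]}$ is the real vector space generated by vectors $\mathbf{r}^k_{\{i,j\}}$ for pairs $\{i,j\}\subseteq[n]\setminus\{k\}$ subject to the single relation $\sum_{\{i,j\}}\mathbf{r}^k_{\{i,j\}}=0$. For $I\subseteq[n]\setminus\{k\}$ with $2\le|I|\le n-2$ set $\mathbf{v}_I=\sum_{\{i,j\}\subseteq I}\mathbf{r}^k_{\{i,j\}}$. $M_{0,n}^{\mathrm{trop}}$ embeds in $Q_{[n]}$ by sending a metric tree to $\sum_e \ell_e\mathbf{v}_{I_e}$, where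 $\ell_e$ is the length of edge $e$ and $I_e$ is the set of legs on the side of $e$ not containing $k$. $\Omega^{\mathrm{trop}}_{0,n}(e_{\alpha_1},\ldots,e_{\alpha_n})$ is the weighted cone complex giving each cone $\sigma$ the weight $\int_{\overline{M}_{0,n}}\Delta_{\Gamma_\sigma}\cdot\Omega_{0,n}(e_{\alpha_1},\ldots,e_{\alpha_n})$; only cones of dimension $d_n(\alpha)$ can have nonzero weight. For a codimension-one face $\tau$ of $\sigma$, $\mathbf{u}_{\tau/\sigma}$ is the primitive normal vector: the class of $\mathbf{v}_{I_e}$ in $Q_{[n]}/\langle\tau\rangle_{\mathbb{R}}$, where $e$ is the edge of $\Gamma_\sigma$ whose contraction gives $\Gamma_\tau$, and $\langle\tau\rangle_{\mathbb R}$ is the linear span of $\tau$. WDVV. The basic relations on $\overline{M}_{0,4}\cong\mathbb{P}^1$ equate any two of the three boundary points; WDVV relations are obtained from these by pulling back via forgetful morphisms and pushing forward via gluing morphisms, then intersecting with a CohFT class and integrating. Concretely, for a vertex $v$ of $\Gamma$ and distinct half-edges $a,b,c,f$ at $v$, $\mathrm{Spl}(v;ab|cf)$ is the set of stable trees obtained from $\Gamma$ by replacing $v$ with two vertices joined by a new edge and distributing the half-edges at $v$ among them, with $a,b$ on one vertex and $c,f$ on the other. When $\Gamma$ has a single vertex this is the usual WDVV relation for $a,b,c,f\in[n]$. *)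

theory Defs
  imports Complex_Main "HOL-Library.Function_Algebras" "HOL-Library.FuncSet"
    "HOL-Library.Multiset" "HOL-Combinatorics.Permutations"
begin

section \<open>Cohomological field theories\<close>

text \<open>
  The Chow groups of the moduli spaces of stable curves are not available in the library. They
  enter through a structure consisting of the operations that occur in the definition of a CohFT:
  graded vector spaces over the ground field, pullbacks along relabelling and gluing morphisms, and
  external products. All groups are subspaces of one vector space \<open>'c\<close>; for the actual Chow groups
  take \<open>'c\<close> to be the direct sum of all of them (tensored with the ground field), with the zero
  subspace for unstable indices.

  \<open>Mbar g n\<close> stands for the space of stable curves of genus \<open>g\<close> with \<open>n\<close> marked points, and
  \<open>MbarProd g1 n1 g2 n2\<close> for the product of \<open>Mbar g1 n1\<close> and \<open>Mbar g2 n2\<close>. Marked points correspond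
  to the positions \<open>0, ..., n - 1\<close> of an argument list of length \<open>n\<close>.
\<close>

datatype mspace = Mbar nat nat | MbarProd nat nat nat nat

fun mspace_dim :: "mspace \<Rightarrow> int" where
  "mspace_dim (Mbar g n) = 3 * int g - 3 + int n"
| "mspace_dim (MbarProd g1 n1 g2 n2) = (3 * int g1 - 3 + int n1) + (3 * int g2 - 3 + int n2)"

text \<open>
  \<^item> \<open>Relabel g n \<pi>\<close> sends \<open>(C, p\<^sub>0, ..., p\<^bsub>n-1\<^esub>)\<close> to \<open>(C, p\<^bsub>\<pi> 0\<^esub>, ..., p\<^bsub>\<pi> (n-1)\<^esub>)\<close>.
  \<^item> \<open>GlueSep g1 g2 n J\<close> glues the last marked point of the first curve to the first marked point of
    the second one; the remaining points of the first curve get the labels in \<open>J\<close>, those of the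
    second curve the labels not in \<open>J\<close>, in increasing order.
  \<^item> \<open>GlueLoop g n\<close> glues the last two marked points of a curve of genus \<open>g\<close> with \<open>n + 2\<close> points.
\<close>

datatype mmap =
    Relabel nat nat "nat \<Rightarrow> nat"
  | GlueSep nat nat nat "nat set"
  | GlueLoop nat nat

fun source :: "mmap \<Rightarrow> mspace" where
  "source (Relabel g n \<pi>) = Mbar g n"
| "source (GlueSep g1 g2 n J) = MbarProd g1 (card J + 1) g2 (n - card J + 1)"
| "source (GlueLoop g n) = Mbar g (n + 2)"

fun target :: "mmap \<Rightarrow> mspace" where
  "target (Relabel g n \<pi>) = Mbar g n"
| "target (GlueSep g1 g2 n J) = Mbar (g1 + g2) n"
| "target (GlueLoop g n) = Mbar (g + 1) n"

text \<open>\<open>Ch X j\<close> is the group of codimension-\<open>j\<close> classes; \<open>chow\<close> is the total Chow group.\<close>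

definition chow :: "('k::field \<Rightarrow> 'c::ab_group_add \<Rightarrow> 'c) \<Rightarrow> (mspace \<Rightarrow> nat \<Rightarrow> 'c set) \<Rightarrow> mspace \<Rightarrow> 'c set"
  where "chow scale Ch X = module.span scale (\<Union>j. Ch X j)"

locale chow_theory = vector_space scaleC
  for scaleC :: "'k::field_char_0 \<Rightarrow> 'c::ab_group_add \<Rightarrow> 'c" +
  fixes Ch :: "mspace \<Rightarrow> nat \<Rightarrow> 'c set"
    and pull :: "mmap \<Rightarrow> 'c \<Rightarrow> 'c"
    and box :: "nat \<Rightarrow> nat \<Rightarrow> nat \<Rightarrow> nat \<Rightarrow> 'c \<Rightarrow> 'c \<Rightarrow> 'c"
  assumes subspace_Ch: "subspace (Ch X j)"
    and graded: "\<And>X N c. (\<And>j. j \<le> N \<Longrightarrow> c j \<in> Ch X j) \<Longrightarrow> (\<Sum>j\<le>N. c j) = 0 \<Longrightarrow> \<forall>j\<le>N. c j = 0"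
    and above_dim: "int j > mspace_dim X \<Longrightarrow> Ch X j = {0}"
    and pull_codim: "c \<in> Ch (target f) j \<Longrightarrow> pull f c \<in> Ch (source f) j"
    and pull_add: "c \<in> chow scaleC Ch (target f) \<Longrightarrow> c' \<in> chow scaleC Ch (target f) \<Longrightarrow>
        pull f (c + c') = pull f c + pull f c'"
    and pull_scale: "c \<in> chow scaleC Ch (target f) \<Longrightarrow> pull f (scaleC r c) = scaleC r (pull f c)"
    and pull_relabel_id: "c \<in> chow scaleC Ch (Mbar g n) \<Longrightarrow> pull (Relabel g n id) c = c"
    and pull_relabel_comp: "c \<in> chow scaleC Ch (Mbar g n) \<Longrightarrow> \<pi> permutes {..<n} \<Longrightarrow> \<rho> permutes {..<n} \<Longrightarrow>
        pull (Relabel g n \<rho>) (pull (Relabel g n \<pi>) c) = pull (Relabel g n (\<rho> \<circ> \<pi>)) c"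
    and box_codim: "c \<in> Ch (Mbar g1 n1) i \<Longrightarrow> c' \<in> Ch (Mbar g2 n2) j \<Longrightarrow>
        box g1 n1 g2 n2 c c' \<in> Ch (MbarProd g1 n1 g2 n2) (i + j)"
    and box_add_left: "c \<in> chow scaleC Ch (Mbar g1 n1) \<Longrightarrow> c' \<in> chow scaleC Ch (Mbar g1 n1) \<Longrightarrow>
        b \<in> chow scaleC Ch (Mbar g2 n2) \<Longrightarrow>
        box g1 n1 g2 n2 (c + c') b = box g1 n1 g2 n2 c b + box g1 n1 g2 n2 c' b"
    and box_add_right: "c \<in> chow scaleC Ch (Mbar g1 n1) \<Longrightarrow> b \<in> chow scaleC Ch (Mbar g2 n2) \<Longrightarrow>
        b' \<in> chow scaleC Ch (Mbar g2 n2) \<Longrightarrow>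
        box g1 n1 g2 n2 c (b + b') = box g1 n1 g2 n2 c b + box g1 n1 g2 n2 c b'"
    and box_scale_left: "c \<in> chow scaleC Ch (Mbar g1 n1) \<Longrightarrow> b \<in> chow scaleC Ch (Mbar g2 n2) \<Longrightarrow>
        box g1 n1 g2 n2 (scaleC r c) b = scaleC r (box g1 n1 g2 n2 c b)"
    and box_scale_right: "c \<in> chow scaleC Ch (Mbar g1 n1) \<Longrightarrow> b \<in> chow scaleC Ch (Mbar g2 n2) \<Longrightarrow>
        box g1 n1 g2 n2 c (scaleC r b) = scaleC r (box g1 n1 g2 n2 c b)"

text \<open>
  \<open>V\<close> is the whole type \<open>'v\<close>, with basis \<open>(e \<alpha>)\<^bsub>\<alpha> \<in> A\<^esub>\<close>; \<open>etaI\<close> is the inverse of the Gram matrix of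
  \<open>eta\<close> in this basis.
\<close>

locale based_quadratic_space = vector_space scaleV
  for scaleV :: "'k::field_char_0 \<Rightarrow> 'v::ab_group_add \<Rightarrow> 'v" +
  fixes eta :: "'v \<Rightarrow> 'v \<Rightarrow> 'k"
    and A :: "'a set"
    and e :: "'a \<Rightarrow> 'v"
    and etaI :: "'a \<Rightarrow> 'a \<Rightarrow> 'k"
  assumes eta_linear: "Vector_Spaces.linear scaleV (*) (eta v)"
    and eta_sym: "eta v w = eta w v"
    and eta_nondegenerate: "(\<And>w. eta v w = 0) \<Longrightarrow> v = 0"
    and finite_A: "finite A"
    and basis_inj: "inj_on e A"
    and basis_independent: "independent (e ` A)"
    and basis_span: "span (e ` A) = UNIV"
    and etaI_right: "\<alpha> \<in> A \<Longrightarrow> \<beta> \<in> A \<Longrightarrow>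
        (\<Sum>\<gamma>\<in>A. eta (e \<alpha>) (e \<gamma>) * etaI \<gamma> \<beta>) = (if \<alpha> = \<beta> then 1 else 0)"
    and etaI_left: "\<alpha> \<in> A \<Longrightarrow> \<beta> \<in> A \<Longrightarrow>
        (\<Sum>\<gamma>\<in>A. etaI \<alpha> \<gamma> * eta (e \<gamma>) (e \<beta>)) = (if \<alpha> = \<beta> then 1 else 0)"

text \<open>
  \<open>\<Omega> g vs\<close> is \<open>\<Omega>\<^sub>g\<^sub>,\<^sub>n(v\<^sub>1, ..., v\<^sub>n)\<close> with \<open>vs = [v\<^sub>1, ..., v\<^sub>n]\<close>. Only the stable range
  \<open>2 g - 2 + n > 0\<close> is constrained.
\<close>

locale cohft =
  V: based_quadratic_space scaleV eta A e etaI + C: chow_theory scaleC Ch pull box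
  for scaleV :: "'k::field_char_0 \<Rightarrow> 'v::ab_group_add \<Rightarrow> 'v"
    and eta :: "'v \<Rightarrow> 'v \<Rightarrow> 'k"
    and A :: "'a set"
    and e :: "'a \<Rightarrow> 'v"
    and etaI :: "'a \<Rightarrow> 'a \<Rightarrow> 'k"
    and scaleC :: "'k \<Rightarrow> 'c::ab_group_add \<Rightarrow> 'c"
    and Ch :: "mspace \<Rightarrow> nat \<Rightarrow> 'c set"
    and pull :: "mmap \<Rightarrow> 'c \<Rightarrow> 'c"
    and box :: "nat \<Rightarrow> nat \<Rightarrow> nat \<Rightarrow> nat \<Rightarrow> 'c \<Rightarrow> 'c \<Rightarrow> 'c" +
  fixes \<Omega> :: "nat \<Rightarrow> 'v list \<Rightarrow> 'c"
  assumes Omega_in: "2 * g + length vs > 2 \<Longrightarrow> \<Omega> g vs \<in> chow scaleC Ch (Mbar g (length vs))"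
    and multilinear: "2 * g + length (us @ ws) + 1 > 2 \<Longrightarrow>
        Vector_Spaces.linear scaleV scaleC (\<lambda>v. \<Omega> g (us @ v # ws))"
    and symmetric: "2 * g + length vs > 2 \<Longrightarrow> \<pi> permutes {..<length vs} \<Longrightarrow>
        pull (Relabel g (length vs) \<pi>) (\<Omega> g (permute_list \<pi> vs)) = \<Omega> g vs"
    and glue_separating: "J \<subseteq> {..<length vs} \<Longrightarrow> 2 * g1 + (card J + 1) > 2 \<Longrightarrow>
        2 * g2 + (length vs - card J + 1) > 2 \<Longrightarrow>
        pull (GlueSep g1 g2 (length vs) J) (\<Omega> (g1 + g2) vs) =
        (\<Sum>\<alpha>\<in>A. \<Sum>\<beta>\<in>A. scaleC (etaI \<alpha> \<beta>)
           (box g1 (card J + 1) g2 (length vs - card J + 1)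
              (\<Omega> g1 (nths vs J @ [e \<alpha>])) (\<Omega> g2 (e \<beta> # nths vs (- J)))))"
    and glue_loop: "2 * g + (length vs + 2) > 2 \<Longrightarrow>
        pull (GlueLoop g (length vs)) (\<Omega> (g + 1) vs) =
        (\<Sum>\<alpha>\<in>A. \<Sum>\<beta>\<in>A. scaleC (etaI \<alpha> \<beta>) (\<Omega> g (vs @ [e \<alpha>, e \<beta>])))"

text \<open>
  Classes of pure dimension \<open>d\<close> on \<open>Mbar 0 n\<close>, i.e. of codimension \<open>n - 3 - d\<close>. The zero class has
  every dimension.
\<close>

definition chow_of_dim :: "(mspace \<Rightarrow> nat \<Rightarrow> 'c::zero set) \<Rightarrow> nat \<Rightarrow> int \<Rightarrow> 'c set" where
  "chow_of_dim Ch n d =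
     (if d \<le> int n - 3 then Ch (Mbar 0 n) (nat (int n - 3 - d)) else {0})"


section \<open>Stable trees\<close>

text \<open>
  A tree has no loops or multiple edges, so an edge is its set of endpoints. Vertices are natural
  numbers, which loses nothing up to isomorphism. \<open>leg \<Gamma> i\<close> is the vertex carrying the leg \<open>i\<close>; its
  values outside \<open>{1..n}\<close> are irrelevant.
\<close>

record stree =
  verts :: "nat set"
  edges :: "nat set set"
  leg :: "nat \<Rightarrow> nat"

definition adj :: "nat set set \<Rightarrow> (nat \<times> nat) set" where
  "adj E = {(u, w). {u, w} \<in> E}"

definition is_cycle :: "nat set set \<Rightarrow> nat list \<Rightarrow> bool" where
  "is_cycle E p \<longleftrightarrow> 3 \<le> length p \<and> distinct p \<and>
     (\<forall>i<length p. {p ! i, p ! (Suc i mod length p)} \<in> E)"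

definition is_tree :: "nat set \<Rightarrow> nat set set \<Rightarrow> bool" where
  "is_tree V E \<longleftrightarrow> finite V \<and> V \<noteq> {} \<and> (\<forall>a\<in>E. a \<subseteq> V \<and> card a = 2) \<and>
     (\<forall>u\<in>V. \<forall>w\<in>V. (u, w) \<in> (adj E)\<^sup>*) \<and> (\<nexists>p. is_cycle E p)"

text \<open>\<open>Half v w\<close> is the half of the edge \<open>{v, w}\<close> attached to \<open>v\<close>.\<close>

datatype half_edge = Leg nat | Half nat nat

definition half_edges :: "nat \<Rightarrow> stree \<Rightarrow> nat \<Rightarrow> half_edge set" where
  "half_edges n \<Gamma> v = Leg ` {i \<in> {1..n}. leg \<Gamma> i = v} \<union> Half v ` {w. {v, w} \<in> edges \<Gamma>}"

definition stable_tree :: "nat \<Rightarrow> stree \<Rightarrow> bool" where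
  "stable_tree n \<Gamma> \<longleftrightarrow> is_tree (verts \<Gamma>) (edges \<Gamma>) \<and> leg \<Gamma> ` {1..n} \<subseteq> verts \<Gamma> \<and>
     (\<forall>v\<in>verts \<Gamma>. card (half_edges n \<Gamma> v) \<ge> 3)"

definition tree_iso :: "nat \<Rightarrow> stree \<Rightarrow> stree \<Rightarrow> bool" where
  "tree_iso n \<Gamma> \<Gamma>' \<longleftrightarrow> (\<exists>\<phi>. bij_betw \<phi> (verts \<Gamma>) (verts \<Gamma>') \<and>
     edges \<Gamma>' = (\<lambda>a. \<phi> ` a) ` edges \<Gamma> \<and> (\<forall>i\<in>{1..n}. leg \<Gamma>' i = \<phi> (leg \<Gamma> i)))"

text \<open>Contraction of the edge \<open>a\<close>; the merged vertex is named after the smaller endpoint.\<close>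

definition contract :: "nat set \<Rightarrow> stree \<Rightarrow> stree" where
  "contract a \<Gamma> = (let f = (\<lambda>w. if w \<in> a then Min a else w) in
     \<lparr>verts = f ` verts \<Gamma>, edges = (\<lambda>b. f ` b) ` (edges \<Gamma> - {a}), leg = f \<circ> leg \<Gamma>\<rparr>)"

text \<open>
  Splitting the vertex \<open>v\<close>: the half-edges in \<open>S\<close> are moved to a new vertex \<open>u\<close>, which is joined to
  \<open>v\<close> by a new edge; the other half-edges stay at \<open>v\<close>.
\<close>

definition split_vertex :: "stree \<Rightarrow> nat \<Rightarrow> half_edge set \<Rightarrow> stree" where
  "split_vertex \<Gamma> v S = (let u = Suc (Max (verts \<Gamma>)) in
     \<lparr>verts = insert u (verts \<Gamma>),
      edges = insert {v, u} ((edges \<Gamma> - {{v, w} | w. Half v w \<in> S}) \<union> {{u, w} | w. Half v w \<in> S}),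
      leg = (\<lambda>i. if Leg i \<in> S then u else leg \<Gamma> i)\<rparr>)"

text \<open>
  Distinct sets \<open>S\<close> give distinct, and by their legs even non-isomorphic, trees, since \<open>c, f\<close> are
  always on the old vertex. So each isomorphism class of splittings is listed exactly once.
\<close>

definition Spl :: "nat \<Rightarrow> stree \<Rightarrow> nat \<Rightarrow> half_edge \<Rightarrow> half_edge \<Rightarrow> half_edge \<Rightarrow> half_edge \<Rightarrow> stree set"
  where "Spl n \<Gamma> v a b c f =
    split_vertex \<Gamma> v ` {S. S \<subseteq> half_edges n \<Gamma> v \<and> a \<in> S \<and> b \<in> S \<and> c \<notin> S \<and> f \<notin> S}"


section \<open>Unknowns and weights\<close>

text \<open>
  The value \<open>x\<^sub>n(\<alpha>\<^sub>1, ..., \<alpha>\<^sub>n)\<close> is \<open>x [\<alpha>\<^sub>1, ..., \<alpha>\<^sub>n]\<close>.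
\<close>

definition admissible_array :: "'a set \<Rightarrow> ('a list \<Rightarrow> int) \<Rightarrow> ('a list \<Rightarrow> 'k::zero) \<Rightarrow> bool" where
  "admissible_array A d x \<longleftrightarrow>
     (\<forall>\<alpha>\<in>lists A. \<forall>\<beta>\<in>lists A. 3 \<le> length \<alpha> \<longrightarrow> mset \<alpha> = mset \<beta> \<longrightarrow> x \<alpha> = x \<beta>) \<and>
     (\<forall>\<alpha>\<in>lists A. 3 \<le> length \<alpha> \<longrightarrow> d \<alpha> \<noteq> 0 \<longrightarrow> x \<alpha> = 0)"

definition half_edge_list :: "nat \<Rightarrow> stree \<Rightarrow> nat \<Rightarrow> half_edge list" where
  "half_edge_list n \<Gamma> v =
     map Leg (filter (\<lambda>i. leg \<Gamma> i = v) [1..<Suc n]) @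
     map (Half v) (sorted_list_of_set {w. {v, w} \<in> edges \<Gamma>})"

fun colour :: "'a list \<Rightarrow> (nat \<times> nat \<Rightarrow> 'a) \<Rightarrow> half_edge \<Rightarrow> 'a" where
  "colour \<alpha> \<beta> (Leg i) = \<alpha> ! (i - 1)"
| "colour \<alpha> \<beta> (Half v w) = \<beta> (v, w)"

text \<open>
  \<open>P\<^sub>\<Gamma>(x; \<alpha>)\<close>. The pair \<open>(v, w)\<close> indexes the half-edge \<open>Half v w\<close>, and the two halves of an edge \<open>a\<close>
  are \<open>(Min a, Max a)\<close> and \<open>(Max a, Min a)\<close>; their order is immaterial as \<open>etaI\<close> is symmetric.
\<close>

definition weight ::
  "'a set \<Rightarrow> ('a \<Rightarrow> 'a \<Rightarrow> 'k::comm_semiring_1) \<Rightarrow> ('a list \<Rightarrow> 'k) \<Rightarrow> 'a list \<Rightarrow> stree \<Rightarrow> 'k" where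
  "weight A etaI x \<alpha> \<Gamma> =
     (\<Sum>\<beta> \<in> {(v, w). {v, w} \<in> edges \<Gamma>} \<rightarrow>\<^sub>E A.
        (\<Prod>a\<in>edges \<Gamma>. etaI (\<beta> (Min a, Max a)) (\<beta> (Max a, Min a))) *
        (\<Prod>v\<in>verts \<Gamma>. x (map (colour \<alpha> \<beta>) (half_edge_list (length \<alpha>) \<Gamma> v))))"


section \<open>The tropical moduli space\<close>

text \<open>Cones are identified with isomorphism classes of stable trees.\<close>

definition cone_of :: "nat \<Rightarrow> stree \<Rightarrow> stree set" where
  "cone_of n \<Gamma> = {\<Gamma>'. stable_tree n \<Gamma>' \<and> tree_iso n \<Gamma> \<Gamma>'}"

definition Mtrop :: "nat \<Rightarrow> stree set set" where
  "Mtrop n = cone_of n ` {\<Gamma>. stable_tree n \<Gamma>}"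

definition cone_tree :: "stree set \<Rightarrow> stree" where
  "cone_tree \<sigma> = (SOME \<Gamma>. \<Gamma> \<in> \<sigma>)"

definition cone_dim :: "stree set \<Rightarrow> nat" where
  "cone_dim \<sigma> = card (edges (cone_tree \<sigma>))"

text \<open>\<open>\<tau>\<close> is a codimension-one face of \<open>\<sigma>\<close>, and the edge whose contraction gives it.\<close>

definition facet_of :: "stree set \<Rightarrow> stree set \<Rightarrow> bool" where
  "facet_of \<tau> \<sigma> \<longleftrightarrow> (\<exists>a\<in>edges (cone_tree \<sigma>). contract a (cone_tree \<sigma>) \<in> \<tau>)"

definition facet_edge :: "stree set \<Rightarrow> stree set \<Rightarrow> nat set" where
  "facet_edge \<tau> \<sigma> = (THE a. a \<in> edges (cone_tree \<sigma>) \<and> contract a (cone_tree \<sigma>) \<in> \<tau>)"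

text \<open>The legs on the side of the edge \<open>a\<close> not containing the leg \<open>k\<close>.\<close>

definition far_side :: "nat \<Rightarrow> nat \<Rightarrow> stree \<Rightarrow> nat set \<Rightarrow> nat set" where
  "far_side n k \<Gamma> a = {i \<in> {1..n}. (leg \<Gamma> k, leg \<Gamma> i) \<notin> (adj (edges \<Gamma> - {a}))\<^sup>*}"

text \<open>
  The free vector space on the pairs \<open>{i, j}\<close> is realised inside the functions \<open>nat set \<Rightarrow> 'k\<close>, and
  \<open>Q\<^sub>[\<^sub>n\<^sub>]\<close> is its quotient by the line spanned by the sum of all \<open>r p\<close> over pairs in \<open>{1..n} - {k}\<close>.
  The ground field \<open>'k\<close> replaces the reals here (all vectors involved have integer coordinates), so
  that the \<open>'k\<close>-valued weights can be scalars; for \<open>'k = real\<close> this is the usual space.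
\<close>

definition r_vec :: "nat set \<Rightarrow> nat set \<Rightarrow> 'k::field" where
  "r_vec p = (\<lambda>q. if q = p then 1 else 0)"

definition v_vec :: "nat set \<Rightarrow> nat set \<Rightarrow> 'k::field" where
  "v_vec I = (\<Sum>p \<in> {p. p \<subseteq> I \<and> card p = 2}. r_vec p)"

definition scaleQ :: "'k::field \<Rightarrow> (nat set \<Rightarrow> 'k) \<Rightarrow> nat set \<Rightarrow> 'k" where
  "scaleQ r w = (\<lambda>q. r * w q)"

lemma vector_space_scaleQ: "vector_space scaleQ"
  by unfold_locales (auto simp: scaleQ_def algebra_simps fun_eq_iff)

text \<open>
  A vector \<open>w\<close> of the free space is zero in \<open>Q\<^sub>[\<^sub>n\<^sub>]/\<langle>\<tau>\<rangle>\<close> iff it lies in the subspace spanned by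
  the defining relation \<open>v_vec ({1..n} - {k})\<close> of \<open>Q\<^sub>[\<^sub>n\<^sub>]\<close> and the generators of the linear span of \<open>\<tau>\<close>.
\<close>

definition zero_mod_cone :: "nat \<Rightarrow> nat \<Rightarrow> stree set \<Rightarrow> (nat set \<Rightarrow> 'k::field) \<Rightarrow> bool" where
  "zero_mod_cone n k \<tau> w \<longleftrightarrow>
     w \<in> module.span scaleQ
        (insert (v_vec ({1..n} - {k}))
           ((\<lambda>a. v_vec (far_side n k (cone_tree \<tau>) a)) ` edges (cone_tree \<tau>)))"

text \<open>A representative of the primitive normal vector \<open>u\<^bsub>\<tau>/\<sigma>\<^esub>\<close>.\<close>

definition normal_vec :: "nat \<Rightarrow> nat \<Rightarrow> stree set \<Rightarrow> stree set \<Rightarrow> nat set \<Rightarrow> 'k::field" where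
  "normal_vec n k \<tau> \<sigma> = v_vec (far_side n k (cone_tree \<sigma>) (facet_edge \<tau> \<sigma>))"

definition balanced_at ::
  "'a set \<Rightarrow> ('a \<Rightarrow> 'a \<Rightarrow> 'k::field) \<Rightarrow> nat \<Rightarrow> ('a list \<Rightarrow> 'k) \<Rightarrow> 'a list \<Rightarrow> int \<Rightarrow> stree set \<Rightarrow> bool" where
  "balanced_at A etaI k x \<alpha> d \<tau> \<longleftrightarrow>
     (let n = length \<alpha> in
      zero_mod_cone n k \<tau>
        (\<Sum>\<sigma> \<in> {\<sigma> \<in> Mtrop n. int (cone_dim \<sigma>) = d \<and> facet_of \<tau> \<sigma>}.
           scaleQ (weight A etaI x \<alpha> (cone_tree \<sigma>)) (normal_vec n k \<tau> \<sigma>)))"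

definition WDVV ::
  "'a set \<Rightarrow> ('a \<Rightarrow> 'a \<Rightarrow> 'k::comm_ring_1) \<Rightarrow> ('a list \<Rightarrow> 'k) \<Rightarrow> 'a list \<Rightarrow> stree \<Rightarrow> nat \<Rightarrow>
     half_edge \<Rightarrow> half_edge \<Rightarrow> half_edge \<Rightarrow> half_edge \<Rightarrow> bool" where
  "WDVV A etaI x \<alpha> \<Gamma> v a b c f \<longleftrightarrow>
     (\<Sum>\<Gamma>' \<in> Spl (length \<alpha>) \<Gamma> v a b c f. weight A etaI x \<alpha> \<Gamma>') -
     (\<Sum>\<Gamma>' \<in> Spl (length \<alpha>) \<Gamma> v a f b c. weight A etaI x \<alpha> \<Gamma>') = 0"

end

theory Submission
  imports Defs
begin

text \<open>
  The equivalence holds tree by tree: for a stable tree \<open>\<Gamma>\<close> with cone \<open>\<tau>\<close>, the balancing equation at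
  \<open>\<tau>\<close> is equivalent to all WDVV relations at the vertices of \<open>\<Gamma>\<close> (\<open>balanced_iff_WDVV\<close>).

  Root \<open>\<Gamma>\<close> at the leg \<open>k\<close>, and let \<open>C v\<close> be the set of half-edges at a vertex \<open>v\<close> that lead away from
  the root. For a half-edge \<open>h\<close> let \<open>L h\<close> be the set of legs beyond it, and let \<open>D v\<close> be the union of
  the \<open>L h\<close> over \<open>h\<close> in \<open>C v\<close>. The cones having \<open>\<tau>\<close> as a facet correspond to the splittings of \<open>\<Gamma>\<close>
  at a vertex \<open>v\<close> that move a set \<open>S \<subseteq> C v\<close> of half-edges to a new vertex (\<open>star_eq\<close>,
  \<open>inj_on_splitting_cone\<close>), and the normal vector is \<open>v_vec\<close> of the union of the \<open>L h\<close>, \<open>h \<in> S\<close>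
  (\<open>normal_vec_splitting\<close>). The relation of \<open>Q\<^bsub>[n]\<^esub>\<close> and the generators of the span of \<open>\<tau>\<close> are together
  the vectors \<open>v_vec (D v)\<close> (\<open>desc_family\<close>).

  Each pair of legs \<open>i, j\<close> other than \<open>k\<close> has a median: a unique vertex \<open>v\<close> at which \<open>i\<close>, \<open>j\<close> and \<open>k\<close> lie
  beyond three different half-edges (\<open>median_ex\<close>, \<open>median_unique\<close>). The span in question consists of
  the vectors that are supported on such pairs and whose coordinate at a pair depends only on its
  median. Modulo this span, a splitting at \<open>v\<close> contributes only to the pairs with median \<open>v\<close>. So
  balancing says that for each \<open>v\<close> the sum \<open>F a b\<close> of the weights of the splittings with
  \<open>a, b \<in> S \<subseteq> C v\<close> is the same for all distinct \<open>a, b\<close> in \<open>C v\<close> (\<open>combination_in_span_iff\<close>).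

  Since a splitting is isomorphic to the one by the complementary set, the WDVV sum for \<open>ab|cf\<close> equals
  \<open>F a b + F c f\<close> plus a term symmetric in \<open>a, b, c, f\<close>, with \<open>F a b\<close> read as zero if \<open>a\<close> or \<open>b\<close> is the
  half-edge leading to the root. So constancy of \<open>F\<close> gives WDVV, and WDVV for the quadruples
  containing that half-edge gives constancy of \<open>F\<close> (\<open>wdvv_iff_constant_pairs\<close>).
\<close>

section \<open>Connectivity and branches in trees\<close>

text \<open>\<open>x\<close> and \<open>y\<close> are joined by a path in the graph with edge set \<open>E\<close>.\<close>

definition conn :: "nat set set \<Rightarrow> nat \<Rightarrow> nat \<Rightarrow> bool" where
  "conn E x y \<longleftrightarrow> (x, y) \<in> (adj E)\<^sup>*"

lemma conn_refl [simp, intro]: "conn E x x"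
  by (simp add: conn_def)

lemma conn_trans [trans]: "conn E x y \<Longrightarrow> conn E y z \<Longrightarrow> conn E x z"
  by (simp add: conn_def)

lemma conn_edge: "{x, y} \<in> E \<Longrightarrow> conn E x y"
  by (auto simp: conn_def adj_def)

lemma conn_sym: "conn E x y \<Longrightarrow> conn E y x"
proof -
  have "sym (adj E)"
    by (auto simp: sym_def adj_def insert_commute)
  then show "conn E x y \<Longrightarrow> conn E y x"
    unfolding conn_def by (metis sym_rtrancl symD)
qed

lemma conn_step: "conn E x y \<Longrightarrow> {y, z} \<in> E \<Longrightarrow> conn E x z"
  using conn_edge conn_trans by blast

lemma conn_induct [consumes 1, case_names refl step]:
  assumes "conn E x y" and "P x"
    and "\<And>y z. conn E x y \<Longrightarrow> {y, z} \<in> E \<Longrightarrow> P y \<Longrightarrow> P z"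
  shows "P y"
  using assms(1) unfolding conn_def
proof (induction rule: rtrancl_induct)
  case base
  then show ?case using assms(2) by simp
next
  case (step y z)
  then show ?case using assms(3)[of y z] by (auto simp: conn_def adj_def)
qed

lemma conn_closed:
  assumes "conn E x y" and "x \<in> X"
    and "\<And>y z. {y, z} \<in> E \<Longrightarrow> y \<in> X \<Longrightarrow> z \<in> X"
  shows "y \<in> X"
  using assms by (induction rule: conn_induct) auto

lemma conn_map:
  assumes "conn E x y" and "\<And>y z. {y, z} \<in> E \<Longrightarrow> conn F (g y) (g z)"
  shows "conn F (g x) (g y)"
  using assms(1) by (induction rule: conn_induct) (use assms(2) conn_trans in blast)+

lemma conn_path:
  assumes "conn F x y"
  obtains p where "p \<noteq> []" "hd p = x" "last p = y" "distinct p"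
    "\<And>i. Suc i < length p \<Longrightarrow> {p ! i, p ! Suc i} \<in> F"
proof -
  have "\<exists>p. p \<noteq> [] \<and> hd p = x \<and> last p = y \<and> distinct p \<and>
      (\<forall>i. Suc i < length p \<longrightarrow> {p ! i, p ! Suc i} \<in> F)"
    using assms
  proof (induction rule: conn_induct)
    case refl
    show ?case by (rule exI[of _ "[x]"]) simp
  next
    case (step y z)
    then obtain p where p: "p \<noteq> []" "hd p = x" "last p = y" "distinct p"
      and e: "\<And>i. Suc i < length p \<Longrightarrow> {p ! i, p ! Suc i} \<in> F" by blast
    show ?case
    proof (cases "z \<in> set p")
      case True
      then obtain as bs where q: "p = as @ z # bs" by (auto simp: in_set_conv_decomp)
      have "{(as @ [z]) ! i, (as @ [z]) ! Suc i} \<in> F" if "Suc i < length (as @ [z])" for i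
        using e[of i] that by (auto simp: q nth_append split: if_splits)
      moreover have "hd (as @ [z]) = x"
        using p(2) by (cases as) (auto simp: q)
      ultimately show ?thesis
        using p(4) by (intro exI[of _ "as @ [z]"]) (auto simp: q)
    next
      case False
      have "{(p @ [z]) ! i, (p @ [z]) ! Suc i} \<in> F" if "Suc i < length (p @ [z])" for i
      proof (cases "Suc i < length p")
        case True
        then show ?thesis using e[of i] by (simp add: nth_append)
      next
        case False
        then have i: "i = length p - 1" "i < length p" using that p(1) by (auto simp: not_less)
        then have "p ! i = y" using p(1,3) by (simp add: last_conv_nth)
        moreover have "(p @ [z]) ! i = p ! i" "(p @ [z]) ! Suc i = z"
          using i p(1) by (simp_all add: nth_append)
        ultimately show ?thesis using step(2) by simp
      qed
      then show ?thesis
        using p False by (intro exI[of _ "p @ [z]"]) auto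
    qed
  qed
  then show thesis using that by blast
qed

lemma no_cycle_iff_bridges:
  assumes "\<And>a. a \<in> E \<Longrightarrow> card a = 2"
  shows "(\<nexists>p. is_cycle E p) \<longleftrightarrow> (\<forall>v w. {v, w} \<in> E \<longrightarrow> \<not> conn (E - {{v, w}}) v w)"
proof (intro iffI allI impI notI)
  fix v w
  assume nc: "\<nexists>p. is_cycle E p" and vw: "{v, w} \<in> E" and vw': "conn (E - {{v, w}}) v w"
  obtain p where p: "p \<noteq> []" "hd p = v" "last p = w" "distinct p"
    and e: "\<And>i. Suc i < length p \<Longrightarrow> {p ! i, p ! Suc i} \<in> E - {{v, w}}"
    using conn_path[OF vw'] by blast
  have "v \<noteq> w" using assms[OF vw] by auto
  have 0: "p ! 0 = v" and l: "p ! (length p - 1) = w"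
    using p by (auto simp: hd_conv_nth last_conv_nth)
  have "length p \<noteq> 1" using 0 l \<open>v \<noteq> w\<close> by auto
  moreover have "length p \<noteq> 2" using 0 l e[of 0] by auto
  ultimately have "3 \<le> length p" using p(1) by (cases p; cases "tl p"; cases "tl (tl p)") auto
  moreover have "{p ! i, p ! (Suc i mod length p)} \<in> E" if "i < length p" for i
  proof (cases "Suc i < length p")
    case True
    then show ?thesis using e[of i] by auto
  next
    case False
    then have "i = length p - 1" "Suc i = length p" using that by auto
    then show ?thesis using 0 l vw by (simp add: insert_commute)
  qed
  ultimately have "is_cycle E p" using p(4) by (simp add: is_cycle_def)
  then show False using nc by blast
next
  assume br: "\<forall>v w. {v, w} \<in> E \<longrightarrow> \<not> conn (E - {{v, w}}) v w" and "\<exists>p. is_cycle E p"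
  then obtain p where p: "3 \<le> length p" "distinct p"
    and e: "\<And>i. i < length p \<Longrightarrow> {p ! i, p ! (Suc i mod length p)} \<in> E"
    by (auto simp: is_cycle_def)
  let ?m = "length p - 1"
  have last: "{p ! 0, p ! ?m} \<in> E" using e[of ?m] p(1)
    by (cases p) (auto simp: insert_commute)
  have "j < length p \<longrightarrow> conn (E - {{p ! 0, p ! ?m}}) (p ! 0) (p ! j)" for j
  proof (induction j)
    case (Suc j)
    show ?case
    proof
      assume j: "Suc j < length p"
      then have "{p ! j, p ! Suc j} \<in> E" using e[of j] by simp
      moreover have "{p ! j, p ! Suc j} \<noteq> {p ! 0, p ! ?m}"
      proof
        assume "{p ! j, p ! Suc j} = {p ! 0, p ! ?m}"
        moreover have "0 < length p" "j < length p" "?m < length p" using j by auto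
        ultimately have "j = 0 \<and> Suc j = ?m \<or> j = ?m \<and> Suc j = 0"
          using j by (simp only: doubleton_eq_iff nth_eq_iff_index_eq[OF p(2)])
        then show False using j p(1) by auto
      qed
      ultimately show "conn (E - {{p ! 0, p ! ?m}}) (p ! 0) (p ! Suc j)"
        using Suc j conn_step[of _ "p ! 0" "p ! j"] by simp
    qed
  qed simp
  then have "conn (E - {{p ! 0, p ! ?m}}) (p ! 0) (p ! ?m)" using p(1) by auto
  then show False using br last by blast
qed

lemma is_tree_iff_bridges:
  "is_tree V E \<longleftrightarrow> finite V \<and> V \<noteq> {} \<and> (\<forall>a\<in>E. a \<subseteq> V \<and> card a = 2) \<and>
     (\<forall>u\<in>V. \<forall>w\<in>V. conn E u w) \<and> (\<forall>v w. {v, w} \<in> E \<longrightarrow> \<not> conn (E - {{v, w}}) v w)"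
  using no_cycle_iff_bridges[of E] unfolding is_tree_def conn_def by blast

text \<open>The vertices on the far side of the edge \<open>{v, w}\<close>, seen from \<open>v\<close>.\<close>

definition branch :: "nat set set \<Rightarrow> nat \<Rightarrow> nat \<Rightarrow> nat set" where
  "branch E v w = {y. conn (E - {{v, w}}) w y}"

lemma in_branch_self [simp, intro]: "w \<in> branch E v w"
  by (simp add: branch_def)

lemma branch_step:
  "y \<in> branch E v w \<Longrightarrow> {y, z} \<in> E \<Longrightarrow> {y, z} \<noteq> {v, w} \<Longrightarrow> z \<in> branch E v w"
  by (auto simp: branch_def intro: conn_step)

locale tree =
  fixes V :: "nat set" and E :: "nat set set"
  assumes is_tree: "is_tree V E"
begin

lemma finite_V: "finite V" and V_nonempty: "V \<noteq> {}"
  and edge_subset: "a \<in> E \<Longrightarrow> a \<subseteq> V" and edge_card: "a \<in> E \<Longrightarrow> card a = 2"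
  and connected: "u \<in> V \<Longrightarrow> w \<in> V \<Longrightarrow> conn E u w"
  and bridge: "{v, w} \<in> E \<Longrightarrow> \<not> conn (E - {{v, w}}) v w"
  using is_tree unfolding is_tree_iff_bridges by blast+

lemma finite_E: "finite E"
  using finite_V edge_subset by (meson Pow_iff finite_Pow_iff finite_subset subsetI)

lemma edge_distinct: "{v, w} \<in> E \<Longrightarrow> v \<noteq> w"
  using edge_card by fastforce

lemma edge_verts: "{v, w} \<in> E \<Longrightarrow> v \<in> V" "{v, w} \<in> E \<Longrightarrow> w \<in> V"
  using edge_subset by blast+

lemma edge_obtain:
  assumes "a \<in> E" obtains v w where "a = {v, w}"
  using edge_card[OF assms] by (metis card_2_iff)

lemma not_in_branch: "{v, w} \<in> E \<Longrightarrow> v \<notin> branch E v w"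
  using bridge[of v w] by (auto simp: branch_def dest: conn_sym)

lemma branch_subset:
  assumes "{v, w} \<in> E" shows "branch E v w \<subseteq> V"
proof
  fix y assume "y \<in> branch E v w"
  then have "conn (E - {{v, w}}) w y" by (simp add: branch_def)
  then show "y \<in> V"
    by (rule conn_closed) (use assms edge_verts in auto)
qed

lemma branch_cover:
  assumes "y \<in> V" "{v, w} \<in> E"
  shows "y \<in> branch E v w \<or> y \<in> branch E w v"
proof -
  have "conn E w y" using assms edge_verts connected by blast
  then show ?thesis
  proof (induction rule: conn_induct)
    case (step y z)
    then show ?case
      using branch_step[of y E v w z] branch_step[of y E w v z]
      by (auto simp: doubleton_eq_iff)
  qed simp
qed

lemma branch_disjoint:
  assumes "{v, w} \<in> E" shows "branch E v w \<inter> branch E w v = {}"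
proof (rule ccontr)
  assume "\<not> ?thesis"
  then obtain y where "conn (E - {{v, w}}) w y" "conn (E - {{v, w}}) v y"
    by (auto simp: branch_def insert_commute)
  then show False using bridge[OF assms] conn_sym conn_trans by blast
qed

lemma branch_opposite: "{v, w} \<in> E \<Longrightarrow> branch E w v = V - branch E v w"
  using branch_cover branch_disjoint branch_subset[of w v]
  by (fastforce simp: insert_commute)

lemma branch_ex:
  assumes "v \<in> V" "y \<in> V" "y \<noteq> v"
  shows "\<exists>w. {v, w} \<in> E \<and> y \<in> branch E v w"
proof -
  have "conn E v y" using assms connected by blast
  then have "y = v \<or> (\<exists>w. {v, w} \<in> E \<and> y \<in> branch E v w)"
  proof (induction rule: conn_induct)
    case (step y z)
    then show ?case
      by (metis branch_step doubleton_eq_iff in_branch_self)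
  qed simp
  then show ?thesis using assms by simp
qed

text \<open>
  A branch that misses the vertex \<open>v\<close> is connected without passing through \<open>v\<close>, hence lies in one
  branch at \<open>v\<close>.
\<close>

lemma branch_in_branch:
  assumes pq: "{p, q} \<in> E" and v: "v \<in> V" "v \<notin> branch E p q" and w: "q \<in> branch E v w"
  shows "branch E p q \<subseteq> branch E v w"
proof
  fix y assume "y \<in> branch E p q"
  then have "conn (E - {{p, q}}) q y" by (simp add: branch_def)
  then show "y \<in> branch E v w"
  proof (induction rule: conn_induct)
    case (step y z)
    have "y \<in> branch E p q" using step(1) by (simp add: branch_def)
    moreover have "z \<in> branch E p q" using calculation step(2) by (auto intro: branch_step)
    ultimately have "{y, z} \<noteq> {v, w}" using v by (auto simp: doubleton_eq_iff)
    then show ?case using step branch_step by blast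
  qed (rule w)
qed

lemma branch_unique:
  assumes "{v, w} \<in> E" "{v, w'} \<in> E" "y \<in> branch E v w" "y \<in> branch E v w'"
  shows "w = w'"
proof (rule ccontr)
  assume ne: "w \<noteq> w'"
  have "{v, w'} \<noteq> {w, v}" "{v, w'} \<noteq> {v, w}" using ne by (auto simp: doubleton_eq_iff)
  then have "w' \<in> branch E w v"
    using branch_step[of v E w v w'] assms by (simp add: insert_commute)
  moreover have "w \<notin> branch E v w'"
  proof
    assume "w \<in> branch E v w'"
    then have "v \<in> branch E v w'"
      using branch_step[of w E v w' v] assms ne by (auto simp: insert_commute doubleton_eq_iff)
    then show False using not_in_branch assms by blast
  qed
  ultimately have "branch E v w' \<subseteq> branch E w v"
    using branch_in_branch[of v w' w v] assms edge_verts[OF assms(1)] by (simp add: insert_commute)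
  then show False using assms branch_disjoint[of v w] by blast
qed

lemma branch_child:
  assumes "{v, w} \<in> E" "{w, w'} \<in> E" "w' \<noteq> v"
  shows "branch E w w' \<subset> branch E v w"
proof -
  have "v \<notin> branch E w w'"
    using branch_unique[of w w' v v] assms by (auto simp: insert_commute)
  moreover have "w' \<in> branch E v w"
    using branch_step[of w E v w w'] assms by (auto simp: doubleton_eq_iff)
  ultimately have "branch E w w' \<subseteq> branch E v w"
    using branch_in_branch[of w w' v w] assms edge_verts by simp
  then show ?thesis using not_in_branch[of w w'] assms by auto
qed

lemma branch_complement_in_branch:
  assumes "{v, w} \<in> E" "{v', w'} \<in> E" "v' \<in> branch E v w" "v \<in> branch E v' w'"
  shows "V - branch E v w \<subseteq> branch E v' w'"
  using branch_in_branch[of w v v' w'] assms branch_opposite[of v w] edge_verts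
  by (auto simp: insert_commute)

end

section \<open>Leg sets of half-edges in stable trees\<close>

text \<open>The legs that are reached by leaving a vertex through the given half-edge.\<close>

fun beyond :: "nat \<Rightarrow> stree \<Rightarrow> half_edge \<Rightarrow> nat set" where
  "beyond n \<Gamma> (Leg i) = {i}"
| "beyond n \<Gamma> (Half v w) = {i \<in> {1..n}. leg \<Gamma> i \<in> branch (edges \<Gamma>) v w}"

text \<open>The half-edges at \<open>v\<close> that lead away from the leg \<open>k\<close>, and the legs that lie beyond them.\<close>

definition children :: "nat \<Rightarrow> nat \<Rightarrow> stree \<Rightarrow> nat \<Rightarrow> half_edge set" where
  "children n k \<Gamma> v = {h \<in> half_edges n \<Gamma> v. k \<notin> beyond n \<Gamma> h}"

definition desc :: "nat \<Rightarrow> nat \<Rightarrow> stree \<Rightarrow> nat \<Rightarrow> nat set" where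
  "desc n k \<Gamma> v = \<Union> (beyond n \<Gamma> ` children n k \<Gamma> v)"

lemma Leg_in_half_edges [simp]: "Leg i \<in> half_edges n \<Gamma> v \<longleftrightarrow> i \<in> {1..n} \<and> leg \<Gamma> i = v"
  and Half_in_half_edges [simp]: "Half v' w \<in> half_edges n \<Gamma> v \<longleftrightarrow> v' = v \<and> {v, w} \<in> edges \<Gamma>"
  by (auto simp: half_edges_def)

text \<open>\<open>\<Gamma>\<close> is a stable tree with \<open>n\<close> legs.\<close>

locale stable =
  fixes n :: nat and \<Gamma> :: stree
  assumes stable: "stable_tree n \<Gamma>"

sublocale stable \<subseteq> tree "verts \<Gamma>" "edges \<Gamma>"
  using stable by unfold_locales (simp add: stable_tree_def)

context stable
begin

abbreviation "H \<equiv> half_edges n \<Gamma>"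
abbreviation "L \<equiv> beyond n \<Gamma>"

lemma leg_vert: "i \<in> {1..n} \<Longrightarrow> leg \<Gamma> i \<in> verts \<Gamma>"
  using stable by (auto simp: stable_tree_def)

lemma card_half_edges: "v \<in> verts \<Gamma> \<Longrightarrow> 3 \<le> card (H v)"
  using stable by (auto simp: stable_tree_def)

lemma finite_half_edges: "finite (H v)"
proof -
  have "{w. {v, w} \<in> edges \<Gamma>} \<subseteq> verts \<Gamma>" using edge_verts by blast
  then show ?thesis using finite_V by (auto simp: half_edges_def intro: finite_subset)
qed

lemma beyond_subset: "h \<in> H v \<Longrightarrow> L h \<subseteq> {1..n}"
  by (cases h) auto

lemma beyond_ex:
  assumes "v \<in> verts \<Gamma>" "i \<in> {1..n}" obtains h where "h \<in> H v" "i \<in> L h"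
proof (cases "leg \<Gamma> i = v")
  case True
  then show ?thesis using that[of "Leg i"] assms by auto
next
  case False
  then obtain w where "{v, w} \<in> edges \<Gamma>" "leg \<Gamma> i \<in> branch (edges \<Gamma>) v w"
    using branch_ex[of v "leg \<Gamma> i"] assms leg_vert by blast
  then show ?thesis using that[of "Half v w"] assms by auto
qed

lemma beyond_unique:
  assumes "h \<in> H v" "h' \<in> H v" "i \<in> L h" "i \<in> L h'"
  shows "h = h'"
  using assms by (cases h; cases h') (auto simp: not_in_branch dest: branch_unique)

lemma beyond_nonempty:
  assumes "h \<in> H v"
  shows "L h \<noteq> {}"
proof (cases h)
  case (Half v' w)
  have "{v, w} \<in> edges \<Gamma> \<Longrightarrow> L (Half v w) \<noteq> {}" for v w
  proof (induction "card (branch (edges \<Gamma>) v w)" arbitrary: v w rule: less_induct)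
    case less
    have "w \<in> verts \<Gamma>" using less(2) edge_verts by blast
    then have "\<not> H w \<subseteq> {Half w v}"
      using card_half_edges[of w] card_mono[of "{Half w v}" "H w"] by auto
    then obtain g where g: "g \<in> H w" "g \<noteq> Half w v" by blast
    show ?case
    proof (cases g)
      case (Leg i)
      then have "i \<in> L (Half v w)" using g by auto
      then show ?thesis by blast
    next
      case (Half z w')
      then have w': "{w, w'} \<in> edges \<Gamma>" "w' \<noteq> v" using g by auto
      have sub: "branch (edges \<Gamma>) w w' \<subset> branch (edges \<Gamma>) v w"
        using branch_child less(2) w' by blast
      moreover have "finite (branch (edges \<Gamma>) v w)"
        using branch_subset less(2) finite_V finite_subset by blast
      ultimately have "L (Half w w') \<noteq> {}"
        using less(1) w' psubset_card_mono by blast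
      then show ?thesis using sub by auto
    qed
  qed
  then show ?thesis using assms Half by auto
qed auto

lemma beyond_opposite:
  assumes "{v, w} \<in> edges \<Gamma>"
  shows "L (Half w v) = {1..n} - L (Half v w)"
  using branch_opposite[OF assms] leg_vert by auto

lemma beyond_in_beyond:
  assumes "{p, q} \<in> edges \<Gamma>" "v \<in> verts \<Gamma>" "v \<notin> branch (edges \<Gamma>) p q"
  obtains w where "{v, w} \<in> edges \<Gamma>" "q \<in> branch (edges \<Gamma>) v w" "L (Half p q) \<subseteq> L (Half v w)"
proof -
  obtain w where w: "{v, w} \<in> edges \<Gamma>" "q \<in> branch (edges \<Gamma>) v w"
    using branch_ex[of v q] assms edge_verts by auto
  then show ?thesis using that[of w] branch_in_branch[OF assms, of w] by auto
qed

end

text \<open>The tree is rooted at the leg \<open>k\<close>.\<close>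

locale rooted_stable = stable +
  fixes k :: nat
  assumes k: "k \<in> {1..n}"
begin

abbreviation "C \<equiv> children n k \<Gamma>"
abbreviation "D \<equiv> desc n k \<Gamma>"

lemma children_half_edge: "h \<in> C v \<Longrightarrow> h \<in> H v"
  by (simp add: children_def)

lemma finite_children: "finite (C v)"
  using finite_half_edges finite_subset[of "C v" "H v"] by (auto simp: children_def)

lemma children_root:
  assumes "r \<in> H v" "k \<in> L r"
  shows "C v = H v - {r}"
  using assms beyond_unique unfolding children_def by blast

lemma desc_root:
  assumes "v \<in> verts \<Gamma>" "r \<in> H v" "k \<in> L r"
  shows "D v = {1..n} - L r"
proof
  show "D v \<subseteq> {1..n} - L r"
    unfolding desc_def children_root[OF assms(2,3)]
    using beyond_subset beyond_unique[of _ v r] assms by blast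
  show "{1..n} - L r \<subseteq> D v"
  proof
    fix i assume i: "i \<in> {1..n} - L r"
    then obtain h where "h \<in> H v" "i \<in> L h" using beyond_ex[of v i] assms by blast
    then show "i \<in> D v"
      using i unfolding desc_def children_root[OF assms(2,3)] by auto
  qed
qed

lemma card_children: "v \<in> verts \<Gamma> \<Longrightarrow> 2 \<le> card (C v)"
proof -
  assume v: "v \<in> verts \<Gamma>"
  then obtain r where "r \<in> H v" "k \<in> L r" using beyond_ex k by blast
  then show ?thesis
    using children_root[of r v] card_half_edges[OF v] by simp
qed

lemma desc_subset: "v \<in> verts \<Gamma> \<Longrightarrow> D v \<subseteq> {1..n} - {k}"
  unfolding desc_def children_def using beyond_subset by blast

lemma desc_child:
  assumes "{v, w} \<in> edges \<Gamma>" "k \<notin> L (Half v w)"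
  shows "D w = L (Half v w)"
proof -
  have "k \<in> L (Half w v)" using assms beyond_opposite k by blast
  then have "D w = {1..n} - L (Half w v)"
    using assms edge_verts(2) by (intro desc_root) (auto simp: insert_commute)
  then show ?thesis using beyond_opposite[OF assms(1)] beyond_subset[of "Half v w" v] assms(1) by auto
qed

lemma far_side_eq:
  assumes "{v, w} \<in> edges \<Gamma>" "k \<notin> L (Half v w)"
  shows "far_side n k \<Gamma> {v, w} = L (Half v w)"
proof -
  let ?E = "edges \<Gamma> - {{v, w}}"
  have kv: "leg \<Gamma> k \<in> branch (edges \<Gamma>) w v" and "leg \<Gamma> k \<in> verts \<Gamma>"
    using assms k branch_opposite leg_vert by auto
  then have "conn ?E v (leg \<Gamma> k)"
    by (simp add: branch_def insert_commute)
  then have "conn ?E (leg \<Gamma> k) y \<longleftrightarrow> conn ?E v y" for y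
    using conn_sym conn_trans by blast
  then have "conn ?E (leg \<Gamma> k) y \<longleftrightarrow> y \<in> branch (edges \<Gamma>) w v" for y
    by (simp add: branch_def insert_commute)
  then have "far_side n k \<Gamma> {v, w} = {i \<in> {1..n}. leg \<Gamma> i \<notin> branch (edges \<Gamma>) w v}"
    by (simp add: far_side_def conn_def)
  then show ?thesis using branch_opposite[OF assms(1)] leg_vert by auto
qed

lemma edge_child:
  assumes "a \<in> edges \<Gamma>"
  obtains v w where "a = {v, w}" "k \<notin> L (Half v w)"
proof -
  obtain v w where a: "a = {v, w}" using assms by (rule edge_obtain)
  show ?thesis
  proof (cases "k \<in> L (Half v w)")
    case True
    then have "k \<notin> L (Half w v)" using beyond_opposite assms a by blast
    then show ?thesis using that[of w v] a by (simp add: insert_commute)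
  qed (use that a in blast)
qed

text \<open>
  Up to the set of all legs other than \<open>k\<close>, which belongs to the root vertex, the leg sets of the
  edges are the sets of legs below the vertices.
\<close>

lemma desc_family: "D ` verts \<Gamma> = insert ({1..n} - {k}) (far_side n k \<Gamma> ` edges \<Gamma>)"
proof (intro equalityI subsetI)
  fix X assume "X \<in> D ` verts \<Gamma>"
  then obtain v where v: "v \<in> verts \<Gamma>" "X = D v" by blast
  obtain r where r: "r \<in> H v" "k \<in> L r" using beyond_ex v k by blast
  show "X \<in> insert ({1..n} - {k}) (far_side n k \<Gamma> ` edges \<Gamma>)"
  proof (cases r)
    case (Leg i)
    then show ?thesis using desc_root[OF v(1) r] r v by auto
  next
    case (Half z w)
    then have vw: "{w, v} \<in> edges \<Gamma>" "{v, w} \<in> edges \<Gamma>" "k \<in> L (Half v w)"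
      using r by (auto simp: insert_commute)
    then have "k \<notin> L (Half w v)" using beyond_opposite[of v w] by blast
    then have "D v = far_side n k \<Gamma> {w, v}"
      using far_side_eq desc_child vw by metis
    then show ?thesis using v vw by blast
  qed
next
  fix X assume "X \<in> insert ({1..n} - {k}) (far_side n k \<Gamma> ` edges \<Gamma>)"
  then consider "X = {1..n} - {k}" | a where "a \<in> edges \<Gamma>" "X = far_side n k \<Gamma> a" by blast
  then show "X \<in> D ` verts \<Gamma>"
  proof cases
    case 1
    then have "X = D (leg \<Gamma> k)" using desc_root[of "leg \<Gamma> k" "Leg k"] leg_vert k by auto
    then show ?thesis using leg_vert k by blast
  next
    case 2
    obtain v w where "a = {v, w}" "k \<notin> L (Half v w)" using edge_child[OF 2(1)] .
    then have "X = D w" "w \<in> verts \<Gamma>" using far_side_eq desc_child edge_verts 2 by auto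
    then show ?thesis by blast
  qed
qed

lemma beyond_child:
  assumes "h \<in> C v"
  shows "is_singleton (L h) \<or> L h \<in> D ` verts \<Gamma>"
proof (cases h)
  case (Half z w)
  then have "{v, w} \<in> edges \<Gamma>" "k \<notin> L (Half v w)" "z = v" using assms by (auto simp: children_def)
  then have "L h = D w" "w \<in> verts \<Gamma>" using desc_child edge_verts Half by auto
  then show ?thesis by blast
qed auto

text \<open>
  Distinct vertices have distinct sets of legs below them: as each vertex carries at least three
  half-edges, passing to another vertex gains or loses a leg.
\<close>

lemma inj_on_desc: "inj_on D (verts \<Gamma>)"
proof (rule inj_onI, rule ccontr)
  fix v v' assume v: "v \<in> verts \<Gamma>" "v' \<in> verts \<Gamma>" and eq: "D v = D v'" and ne: "v \<noteq> v'"
  let ?E = "edges \<Gamma>"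
  obtain w where w: "{v, w} \<in> ?E" "v' \<in> branch ?E v w" using branch_ex[of v v'] v ne by auto
  obtain w' where w': "{v', w'} \<in> ?E" "v \<in> branch ?E v' w'" using branch_ex[of v' v] v ne by auto
  obtain r where r: "r \<in> H v" "k \<in> L r" using beyond_ex[of v k] v k by blast
  obtain r' where r': "r' \<in> H v'" "k \<in> L r'" using beyond_ex[of v' k] v k by blast
  have LL: "L r = L r'"
    using eq desc_root[of v r] desc_root[of v' r'] v r r' beyond_subset[of r v] beyond_subset[of r' v']
    by blast
  have cover: "{1..n} - L (Half v w) \<subseteq> L (Half v' w')"
    using branch_complement_in_branch[of v w v' w'] w w' leg_vert by auto
  have aux: False
    if a: "v \<in> verts \<Gamma>" "{v, w} \<in> ?E" "{v', w'} \<in> ?E" "{1..n} - L (Half v w) \<subseteq> L (Half v' w')"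
      "r \<in> H v" "k \<in> L r" "r' \<in> H v'" "k \<in> L r'" "L r = L r'" "r \<noteq> Half v w"
    for v w v' w' r r'
  proof -
    have hw: "Half v w \<in> H v" "Half v' w' \<in> H v'" using a by auto
    then have disj: "L h \<inter> L (Half v w) = {}" if "h \<in> H v" "h \<noteq> Half v w" for h
      using beyond_unique[of h v "Half v w"] that by blast
    then have "L r \<subseteq> L (Half v' w')" using a beyond_subset[of r v] by blast
    then have "r' = Half v' w'" using beyond_unique[of r' v' "Half v' w'"] a hw by blast
    have "\<not> H v \<subseteq> {r, Half v w}"
      using card_half_edges[of v] card_mono[of "{r, Half v w}" "H v"] a
      by (auto simp: card_insert_if split: if_splits)
    then obtain h where h: "h \<in> H v" "h \<noteq> r" "h \<noteq> Half v w" by blast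
    then have "L h \<subseteq> L r"
      using disj[of h] beyond_subset[of h v] a \<open>r' = _\<close> by blast
    then show False using beyond_nonempty[of h v] beyond_unique[of h v r] h a by blast
  qed
  have "r = Half v w"
    using aux[of v w v' w' r r'] v w w' cover r r' LL by blast
  moreover have "r' = Half v' w'"
    using aux[of v' w' v w r' r] v w w' cover r r' LL beyond_subset[of "Half v w" v] by blast
  ultimately have "L (Half v w) = {1..n}"
    using cover LL beyond_subset[of r v] r by blast
  then have "L (Half w v) = {}" using beyond_opposite[OF w(1)] by blast
  then show False using beyond_nonempty[of "Half w v" w] w by (auto simp: insert_commute)
qed

lemma inj_on_far_side: "inj_on (far_side n k \<Gamma>) (edges \<Gamma>)"
proof (rule inj_onI)
  fix a a' assume a: "a \<in> edges \<Gamma>" "a' \<in> edges \<Gamma>" and eq: "far_side n k \<Gamma> a = far_side n k \<Gamma> a'"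
  obtain v w where vw: "a = {v, w}" "k \<notin> L (Half v w)" using edge_child[OF a(1)] .
  obtain v' w' where vw': "a' = {v', w'}" "k \<notin> L (Half v' w')" using edge_child[OF a(2)] .
  have "D w = D w'" using eq far_side_eq desc_child vw vw' a by simp
  then have w: "w = w'" using inj_on_desc edge_verts a vw vw' by (auto dest: inj_onD)
  have "k \<in> L (Half w v)" "k \<in> L (Half w v')"
    using beyond_opposite[of v w] beyond_opposite[of v' w'] a vw vw' w k by blast+
  then have "Half w v = Half w v'"
    using a vw vw' w by (intro beyond_unique) (auto simp: insert_commute)
  then show "a = a'" using vw vw' w by simp
qed

text \<open>
  \<open>is_median v h h' i j\<close>: the vertex \<open>v\<close> is the median of the legs \<open>i\<close>, \<open>j\<close>, \<open>k\<close>, and \<open>h\<close>, \<open>h'\<close> are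
  the half-edges at \<open>v\<close> that lead to \<open>i\<close> and \<open>j\<close>.
\<close>

definition is_median :: "nat \<Rightarrow> half_edge \<Rightarrow> half_edge \<Rightarrow> nat \<Rightarrow> nat \<Rightarrow> bool" where
  "is_median v h h' i j \<longleftrightarrow>
     v \<in> verts \<Gamma> \<and> h \<in> C v \<and> h' \<in> C v \<and> h \<noteq> h' \<and> i \<in> L h \<and> j \<in> L h'"

text \<open>The median is the lowest vertex that has both \<open>i\<close> and \<open>j\<close> below it.\<close>

lemma median_ex:
  assumes "i \<in> {1..n} - {k}" "j \<in> {1..n} - {k}" "i \<noteq> j"
  obtains v h h' where "is_median v h h' i j"
proof -
  let ?P = "\<lambda>v. v \<in> verts \<Gamma> \<and> i \<in> D v \<and> j \<in> D v"
  have "?P (leg \<Gamma> k)"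
    using desc_root[of "leg \<Gamma> k" "Leg k"] leg_vert k assms by auto
  then obtain v where v: "?P v" and least: "\<And>v'. ?P v' \<Longrightarrow> card (D v) \<le> card (D v')"
    using ex_has_least_nat[of ?P _ "\<lambda>v. card (D v)"] by blast
  then obtain h h' where h: "h \<in> C v" "i \<in> L h" "h' \<in> C v" "j \<in> L h'"
    by (auto simp: desc_def)
  have "h \<noteq> h'"
  proof
    assume "h = h'"
    then obtain w where w: "h = Half v w" "{v, w} \<in> edges \<Gamma>" "k \<notin> L h"
      using h assms(3) by (cases h) (auto simp: children_def)
    then have Dw: "D w = L h" using desc_child by simp
    then have "?P w" using h \<open>h = h'\<close> w edge_verts by auto
    have "\<not> C v \<subseteq> {h}"
      using card_children[of v] card_mono[of "{h}" "C v"] v by auto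
    then obtain g where g: "g \<in> C v" "g \<noteq> h" by blast
    then have gh: "g \<in> H v" "h \<in> H v" "g \<noteq> h" using h children_half_edge by blast+
    then have "L g \<inter> L h = {}" using beyond_unique[OF gh(1,2)] by blast
    moreover have "L g \<noteq> {}" by (rule beyond_nonempty[OF gh(1)])
    moreover have "L g \<subseteq> D v" "L h \<subseteq> D v" using g h by (auto simp: desc_def)
    ultimately have "D w \<subset> D v" using Dw by blast
    moreover have "finite (D v)" using desc_subset v finite_subset by blast
    ultimately have "card (D w) < card (D v)" by (rule psubset_card_mono[rotated])
    then show False using least[OF \<open>?P w\<close>] by simp
  qed
  then show thesis using that h v by (auto simp: is_median_def)
qed

text \<open>
  The legs below \<open>v'\<close> are the far side of an edge that separates \<open>i, j\<close> from \<open>k\<close>; such an edge cannot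
  lie between the median and \<open>i\<close> or \<open>j\<close>, so it has the whole of \<open>D v\<close> on its far side.
\<close>

lemma median_least:
  assumes "is_median v h h' i j" and v': "v' \<in> verts \<Gamma>" "i \<in> D v'" "j \<in> D v'"
  shows "D v \<subseteq> D v'"
proof -
  let ?B = "branch (edges \<Gamma>)"
  have v: "v \<in> verts \<Gamma>" "h \<in> H v" "h' \<in> H v" "h \<noteq> h'" "i \<in> L h" "j \<in> L h'"
    using assms(1) by (auto simp: is_median_def children_def)
  obtain r where r: "r \<in> H v'" "k \<in> L r" using beyond_ex[of v' k] v' k by blast
  show ?thesis
  proof (cases r)
    case (Leg i)
    then show ?thesis using desc_root[OF v'(1) r] desc_subset[OF v(1)] r by auto
  next
    case (Half z w')
    then have w': "{v', w'} \<in> edges \<Gamma>" "{w', v'} \<in> edges \<Gamma>" "k \<in> L (Half v' w')"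
      using r by (auto simp: insert_commute)
    have Dv': "D v' = {1..n} - L (Half v' w')" using desc_root[OF v'(1) r] Half r by auto
    have "v \<in> ?B w' v'"
    proof (rule ccontr)
      assume "v \<notin> ?B w' v'"
      then obtain w where w: "{v, w} \<in> edges \<Gamma>" "L (Half w' v') \<subseteq> L (Half v w)"
        using beyond_in_beyond[OF w'(2) v(1)] by blast
      then have "i \<in> L (Half v w)" "j \<in> L (Half v w)"
        using v' Dv' beyond_opposite[OF w'(1)] by blast+
      moreover have "Half v w \<in> H v" using w by simp
      ultimately show False using v beyond_unique by metis
    qed
    then have "v \<notin> ?B v' w'" using branch_opposite[OF w'(1)] by blast
    then obtain w where w: "{v, w} \<in> edges \<Gamma>" "L (Half v' w') \<subseteq> L (Half v w)"
      using beyond_in_beyond[OF w'(1) v(1)] by blast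
    then have "D v = {1..n} - L (Half v w)"
      using desc_root[OF v(1), of "Half v w"] w' by auto
    then show ?thesis using w Dv' by blast
  qed
qed

lemma median_in_desc: "is_median v h h' i j \<Longrightarrow> i \<in> D v" "is_median v h h' i j \<Longrightarrow> j \<in> D v"
  by (auto simp: is_median_def desc_def)

lemma median_unique:
  assumes "is_median v g g' i j" "is_median v' h h' i j"
  shows "v = v'" "g = h" "g' = h'"
proof -
  have V: "v \<in> verts \<Gamma>" "v' \<in> verts \<Gamma>" using assms by (auto simp: is_median_def)
  have "D v = D v'"
    using median_least[OF assms(1) V(2)] median_least[OF assms(2) V(1)]
      median_in_desc[OF assms(1)] median_in_desc[OF assms(2)] by blast
  then show *: "v = v'" using inj_on_desc V by (auto dest: inj_onD)
  show "g = h" "g' = h'"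
    using assms beyond_unique[of _ v] unfolding is_median_def children_def * by blast+
qed

end

section \<open>Isomorphisms of trees\<close>

text \<open>The map \<open>\<phi>\<close> on vertices is an isomorphism of trees with \<open>n\<close> legs.\<close>

definition iso_by :: "nat \<Rightarrow> (nat \<Rightarrow> nat) \<Rightarrow> stree \<Rightarrow> stree \<Rightarrow> bool" where
  "iso_by n \<phi> \<Gamma> \<Gamma>' \<longleftrightarrow> bij_betw \<phi> (verts \<Gamma>) (verts \<Gamma>') \<and>
     edges \<Gamma>' = (`) \<phi> ` edges \<Gamma> \<and> (\<forall>i\<in>{1..n}. leg \<Gamma>' i = \<phi> (leg \<Gamma> i))"

lemma tree_iso_iff: "tree_iso n \<Gamma> \<Gamma>' \<longleftrightarrow> (\<exists>\<phi>. iso_by n \<phi> \<Gamma> \<Gamma>')"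
  by (simp add: tree_iso_def iso_by_def)

lemma tree_iso_refl: "tree_iso n \<Gamma> \<Gamma>"
  unfolding tree_iso_iff iso_by_def by (rule exI[of _ "\<lambda>x. x"]) (auto simp: bij_betw_def)

lemma tree_iso_trans:
  assumes "tree_iso n \<Gamma> \<Gamma>'" "tree_iso n \<Gamma>' \<Gamma>''"
  shows "tree_iso n \<Gamma> \<Gamma>''"
proof -
  obtain \<phi> \<psi> where "iso_by n \<phi> \<Gamma> \<Gamma>'" "iso_by n \<psi> \<Gamma>' \<Gamma>''"
    using assms by (auto simp: tree_iso_iff)
  then have "iso_by n (\<psi> \<circ> \<phi>) \<Gamma> \<Gamma>''"
    unfolding iso_by_def using bij_betw_trans by (fastforce simp: image_comp image_image)
  then show ?thesis unfolding tree_iso_iff by blast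
qed

lemma (in stable) tree_iso_sym:
  assumes "tree_iso n \<Gamma> \<Gamma>'"
  shows "tree_iso n \<Gamma>' \<Gamma>"
proof -
  obtain \<phi> where \<phi>: "iso_by n \<phi> \<Gamma> \<Gamma>'" using assms by (auto simp: tree_iso_iff)
  let ?\<psi> = "inv_into (verts \<Gamma>) \<phi>"
  have inj: "inj_on \<phi> (verts \<Gamma>)" and E: "edges \<Gamma>' = (`) \<phi> ` edges \<Gamma>"
    using \<phi> by (auto simp: iso_by_def bij_betw_def)
  have "?\<psi> ` \<phi> ` a = a" if "a \<in> edges \<Gamma>" for a
    using inj edge_subset[OF that] by (rule inv_into_image_cancel)
  then have "(`) ?\<psi> ` edges \<Gamma>' = edges \<Gamma>"
    unfolding E image_image by simp
  moreover have "?\<psi> (\<phi> (leg \<Gamma> i)) = leg \<Gamma> i" if "i \<in> {1..n}" for i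
    using inj leg_vert[OF that] by simp
  ultimately have "iso_by n ?\<psi> \<Gamma>' \<Gamma>"
    using \<phi> bij_betw_inv_into by (auto simp: iso_by_def)
  then show ?thesis unfolding tree_iso_iff by blast
qed

lemma conn_image:
  assumes "inj_on \<phi> V" "\<And>a. a \<in> F \<Longrightarrow> a \<subseteq> V" "x \<in> V" "y \<in> V"
  shows "conn ((`) \<phi> ` F) (\<phi> x) (\<phi> y) \<longleftrightarrow> conn F x y"
proof
  assume c: "conn ((`) \<phi> ` F) (\<phi> x) (\<phi> y)"
  let ?g = "inv_into V \<phi>"
  have "conn F (?g (\<phi> x)) (?g (\<phi> y))"
  proof (rule conn_map[OF c])
    fix y z assume "{y, z} \<in> (`) \<phi> ` F"
    then obtain a where a: "a \<in> F" "{y, z} = \<phi> ` a" by blast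
    have "?g ` {y, z} = a" unfolding a(2) using assms(1,2) a(1) by (simp add: inv_into_image_cancel)
    then have "{?g y, ?g z} = a" by simp
    then show "conn F (?g y) (?g z)" using a(1) conn_edge by blast
  qed
  then show "conn F x y" using assms by simp
next
  assume "conn F x y"
  then show "conn ((`) \<phi> ` F) (\<phi> x) (\<phi> y)"
  proof (rule conn_map)
    fix y z assume "{y, z} \<in> F"
    then have "\<phi> ` {y, z} \<in> (`) \<phi> ` F" by (rule imageI)
    then show "conn ((`) \<phi> ` F) (\<phi> y) (\<phi> z)" by (simp add: conn_edge)
  qed
qed

text \<open>The map on half-edges induced by a map on vertices.\<close>

fun map_half :: "(nat \<Rightarrow> nat) \<Rightarrow> half_edge \<Rightarrow> half_edge" where
  "map_half \<phi> (Leg i) = Leg i"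
| "map_half \<phi> (Half v w) = Half (\<phi> v) (\<phi> w)"

locale stable_iso = stable +
  fixes \<phi> :: "nat \<Rightarrow> nat" and \<Gamma>' :: stree
  assumes iso: "iso_by n \<phi> \<Gamma> \<Gamma>'"
begin

lemma inj: "inj_on \<phi> (verts \<Gamma>)" and verts_iso: "verts \<Gamma>' = \<phi> ` verts \<Gamma>"
  and edges_iso: "edges \<Gamma>' = (`) \<phi> ` edges \<Gamma>"
  and leg_iso: "i \<in> {1..n} \<Longrightarrow> leg \<Gamma>' i = \<phi> (leg \<Gamma> i)"
  using iso by (auto simp: iso_by_def bij_betw_def)

lemma inj_edges: "inj_on ((`) \<phi>) (edges \<Gamma>)"
  using inj edge_subset by (meson inj_on_image_eq_iff inj_onI)

lemma card_edges_iso: "card (edges \<Gamma>') = card (edges \<Gamma>)"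
  by (simp add: edges_iso card_image inj_edges)

lemma edge_iso_iff: "x \<in> verts \<Gamma> \<Longrightarrow> y \<in> verts \<Gamma> \<Longrightarrow> {\<phi> x, \<phi> y} \<in> edges \<Gamma>' \<longleftrightarrow> {x, y} \<in> edges \<Gamma>"
proof
  assume xy: "x \<in> verts \<Gamma>" "y \<in> verts \<Gamma>" "{\<phi> x, \<phi> y} \<in> edges \<Gamma>'"
  then obtain a where a: "a \<in> edges \<Gamma>" "\<phi> ` {x, y} = \<phi> ` a" by (auto simp: edges_iso)
  then have "{x, y} = a" using inj_on_image_eq_iff[OF inj, of "{x, y}" a] edge_subset xy by blast
  then show "{x, y} \<in> edges \<Gamma>" using a by simp
next
  assume "{x, y} \<in> edges \<Gamma>"
  then have "\<phi> ` {x, y} \<in> edges \<Gamma>'" unfolding edges_iso by (rule imageI)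
  then show "{\<phi> x, \<phi> y} \<in> edges \<Gamma>'" by simp
qed

lemma edge_iso_obtain:
  assumes "{x', y'} \<in> edges \<Gamma>'"
  obtains x y where "{x, y} \<in> edges \<Gamma>" "x' = \<phi> x" "y' = \<phi> y"
proof -
  obtain a where a: "a \<in> edges \<Gamma>" "{x', y'} = \<phi> ` a" using assms edges_iso by blast
  obtain p q where pq: "a = {p, q}" using a(1) by (rule edge_obtain)
  then consider "x' = \<phi> p" "y' = \<phi> q" | "x' = \<phi> q" "y' = \<phi> p"
    using a by (auto simp: doubleton_eq_iff)
  then show ?thesis using that[of p q] that[of q p] a pq by cases (auto simp: insert_commute)
qed

lemma edges_diff_iso: "a \<in> edges \<Gamma> \<Longrightarrow> edges \<Gamma>' - {\<phi> ` a} = (`) \<phi> ` (edges \<Gamma> - {a})"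
  unfolding edges_iso using inj_on_image_set_diff[OF inj_edges, of "edges \<Gamma>" "{a}"] by auto

lemma conn_iso:
  assumes "x \<in> verts \<Gamma>" "y \<in> verts \<Gamma>"
  shows "conn (edges \<Gamma>') (\<phi> x) (\<phi> y) \<longleftrightarrow> conn (edges \<Gamma>) x y"
    and "a \<in> edges \<Gamma> \<Longrightarrow> conn (edges \<Gamma>' - {\<phi> ` a}) (\<phi> x) (\<phi> y) \<longleftrightarrow> conn (edges \<Gamma> - {a}) x y"
proof -
  have *: "conn ((`) \<phi> ` F) (\<phi> x) (\<phi> y) \<longleftrightarrow> conn F x y" if "F \<subseteq> edges \<Gamma>" for F
    using that edge_subset assms by (intro conn_image[OF inj]) auto
  show "conn (edges \<Gamma>') (\<phi> x) (\<phi> y) \<longleftrightarrow> conn (edges \<Gamma>) x y"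
    unfolding edges_iso by (intro *) simp
  show "conn (edges \<Gamma>' - {\<phi> ` a}) (\<phi> x) (\<phi> y) \<longleftrightarrow> conn (edges \<Gamma> - {a}) x y" if "a \<in> edges \<Gamma>"
    unfolding edges_diff_iso[OF that] by (intro *) auto
qed

lemma half_edges_iso:
  assumes "v \<in> verts \<Gamma>"
  shows "half_edges n \<Gamma>' (\<phi> v) = map_half \<phi> ` half_edges n \<Gamma> v"
proof (intro equalityI subsetI)
  fix h assume h: "h \<in> half_edges n \<Gamma>' (\<phi> v)"
  show "h \<in> map_half \<phi> ` half_edges n \<Gamma> v"
  proof (cases h)
    case (Leg i)
    then have "leg \<Gamma> i = v" "i \<in> {1..n}"
      using h assms leg_iso leg_vert inj_onD[OF inj] by auto
    then show ?thesis using Leg by (intro image_eqI[of _ _ "Leg i"]) auto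
  next
    case (Half z w')
    then have z: "{\<phi> v, w'} \<in> edges \<Gamma>'" "z = \<phi> v" using h by auto
    obtain x w where w: "{x, w} \<in> edges \<Gamma>" "\<phi> v = \<phi> x" "w' = \<phi> w"
      using z(1) by (rule edge_iso_obtain)
    moreover have "x = v" using w inj_onD[OF inj] edge_verts assms by metis
    ultimately show ?thesis using Half z by (intro image_eqI[of _ _ "Half v w"]) auto
  qed
next
  fix h assume "h \<in> map_half \<phi> ` half_edges n \<Gamma> v"
  then obtain g where g: "g \<in> half_edges n \<Gamma> v" "h = map_half \<phi> g" by blast
  then show "h \<in> half_edges n \<Gamma>' (\<phi> v)"
    using leg_iso edge_iso_iff edge_verts by (cases g) auto
qed

lemma inj_on_map_half: "inj_on (map_half \<phi>) (half_edges n \<Gamma> v)"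
proof (rule inj_onI)
  fix g h assume "g \<in> half_edges n \<Gamma> v" "h \<in> half_edges n \<Gamma> v" "map_half \<phi> g = map_half \<phi> h"
  then show "g = h"
    using inj_onD[OF inj] edge_verts(2) by (cases g; cases h) auto
qed

lemma stable_iso: "stable_tree n \<Gamma>'"
  unfolding stable_tree_def is_tree_iff_bridges
proof (intro conjI ballI allI impI)
  show "finite (verts \<Gamma>')" "verts \<Gamma>' \<noteq> {}"
    using finite_V V_nonempty by (auto simp: verts_iso)
  show "conn (edges \<Gamma>') x y" if "x \<in> verts \<Gamma>'" "y \<in> verts \<Gamma>'" for x y
    using that conn_iso(1) connected by (auto simp: verts_iso)
  show "leg \<Gamma>' ` {1..n} \<subseteq> verts \<Gamma>'"
    using leg_iso leg_vert by (auto simp: verts_iso)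
  show "3 \<le> card (half_edges n \<Gamma>' v)" if "v \<in> verts \<Gamma>'" for v
    using that half_edges_iso card_half_edges card_image[OF inj_on_map_half] by (auto simp: verts_iso)
next
  fix a assume "a \<in> edges \<Gamma>'"
  then obtain b where b: "b \<in> edges \<Gamma>" "a = \<phi> ` b" by (auto simp: edges_iso)
  then show "a \<subseteq> verts \<Gamma>'" using edge_subset verts_iso by blast
  show "card a = 2"
    using b edge_card edge_subset card_image inj_on_subset[OF inj] by metis
next
  fix x' y' assume "{x', y'} \<in> edges \<Gamma>'"
  then obtain x y where xy: "{x, y} \<in> edges \<Gamma>" "x' = \<phi> x" "y' = \<phi> y"
    by (rule edge_iso_obtain)
  then show "\<not> conn (edges \<Gamma>' - {{x', y'}}) x' y'"
    using conn_iso(2)[of x y "{x, y}"] bridge edge_verts by auto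
qed

lemma far_side_iso:
  assumes "a \<in> edges \<Gamma>" "k \<in> {1..n}"
  shows "far_side n k \<Gamma>' (\<phi> ` a) = far_side n k \<Gamma> a"
  using conn_iso(2)[OF _ _ assms(1)] leg_vert leg_iso assms(2)
  by (auto simp: far_side_def simp flip: conn_def)

lemma far_sides_iso:
  "k \<in> {1..n} \<Longrightarrow> far_side n k \<Gamma>' ` edges \<Gamma>' = far_side n k \<Gamma> ` edges \<Gamma>"
  unfolding edges_iso image_image using far_side_iso by simp

end

lemma stable_tree_iso: "stable_tree n \<Gamma> \<Longrightarrow> tree_iso n \<Gamma> \<Gamma>' \<Longrightarrow> stable_tree n \<Gamma>'"
  by (meson stable.intro stable_iso.intro stable_iso_axioms.intro stable_iso.stable_iso tree_iso_iff)

lemma tree_iso_far_sides: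
  "stable_tree n \<Gamma> \<Longrightarrow> tree_iso n \<Gamma> \<Gamma>' \<Longrightarrow> k \<in> {1..n} \<Longrightarrow>
    far_side n k \<Gamma>' ` edges \<Gamma>' = far_side n k \<Gamma> ` edges \<Gamma>"
  by (meson stable.intro stable_iso.intro stable_iso_axioms.intro stable_iso.far_sides_iso tree_iso_iff)

lemma tree_iso_card_edges:
  "stable_tree n \<Gamma> \<Longrightarrow> tree_iso n \<Gamma> \<Gamma>' \<Longrightarrow> card (edges \<Gamma>') = card (edges \<Gamma>)"
  by (meson stable.intro stable_iso.intro stable_iso_axioms.intro stable_iso.card_edges_iso tree_iso_iff)

lemma tree_iso_symmetric: "stable_tree n \<Gamma> \<Longrightarrow> tree_iso n \<Gamma> \<Gamma>' \<Longrightarrow> tree_iso n \<Gamma>' \<Gamma>"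
  by (meson stable.intro stable.tree_iso_sym)

lemma cone_of_eq_iff:
  assumes "stable_tree n \<Gamma>" "stable_tree n \<Gamma>'"
  shows "cone_of n \<Gamma> = cone_of n \<Gamma>' \<longleftrightarrow> tree_iso n \<Gamma> \<Gamma>'"
proof
  assume "cone_of n \<Gamma> = cone_of n \<Gamma>'"
  then show "tree_iso n \<Gamma> \<Gamma>'"
    using assms tree_iso_refl unfolding cone_of_def by blast
next
  assume "tree_iso n \<Gamma> \<Gamma>'"
  then show "cone_of n \<Gamma> = cone_of n \<Gamma>'"
    using assms tree_iso_trans tree_iso_symmetric unfolding cone_of_def by blast
qed

lemma cone_tree_in: "stable_tree n \<Gamma> \<Longrightarrow> cone_tree (cone_of n \<Gamma>) \<in> cone_of n \<Gamma>"
  unfolding cone_tree_def by (rule someI[of _ \<Gamma>]) (simp add: cone_of_def tree_iso_refl)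

lemma cone_tree_iso:
  assumes "stable_tree n \<Gamma>"
  shows "stable_tree n (cone_tree (cone_of n \<Gamma>))" "tree_iso n \<Gamma> (cone_tree (cone_of n \<Gamma>))"
  using cone_tree_in[OF assms] by (auto simp: cone_of_def)

lemma Mtrop_cone_tree:
  assumes "\<sigma> \<in> Mtrop n"
  shows "stable_tree n (cone_tree \<sigma>)" "\<sigma> = cone_of n (cone_tree \<sigma>)"
proof -
  obtain \<Gamma> where "stable_tree n \<Gamma>" "\<sigma> = cone_of n \<Gamma>" using assms by (auto simp: Mtrop_def)
  then show "stable_tree n (cone_tree \<sigma>)" "\<sigma> = cone_of n (cone_tree \<sigma>)"
    using cone_tree_iso[of n \<Gamma>] cone_of_eq_iff by auto
qed

section \<open>Contraction of edges\<close>

text \<open>The map on vertices of the contraction of the edge \<open>a\<close>.\<close>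

definition collapse :: "nat set \<Rightarrow> nat \<Rightarrow> nat" where
  "collapse a w = (if w \<in> a then Min a else w)"

lemma contract_simps [simp]:
  "verts (contract a \<Gamma>) = collapse a ` verts \<Gamma>"
  "edges (contract a \<Gamma>) = (`) (collapse a) ` (edges \<Gamma> - {a})"
  "leg (contract a \<Gamma>) i = collapse a (leg \<Gamma> i)"
  by (simp_all add: contract_def collapse_def[abs_def] Let_def)

lemma collapse_eq_iff:
  assumes "finite a" "a \<noteq> {}"
  shows "collapse a x = collapse a y \<longleftrightarrow> x = y \<or> x \<in> a \<and> y \<in> a"
  using Min_in[OF assms] by (auto simp: collapse_def)

context tree
begin

lemma collapse_edge_eq:
  "{p, q} \<in> E \<Longrightarrow> collapse {p, q} x = collapse {p, q} y \<longleftrightarrow> x = y \<or> {x, y} = {p, q}"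
  by (auto simp: collapse_eq_iff)

text \<open>Contraction creates no multiple edges, as the tree contains no triangle.\<close>

lemma inj_on_collapse:
  assumes "a \<in> E"
  shows "inj_on ((`) (collapse a)) (E - {a})"
proof (rule inj_onI, rule ccontr)
  fix b b' assume b: "b \<in> E - {a}" "b' \<in> E - {a}" "collapse a ` b = collapse a ` b'" and ne: "b \<noteq> b'"
  have bE: "b \<in> E" "b' \<in> E" using b by auto
  obtain p q where a: "a = {p, q}" using assms by (rule edge_obtain)
  obtain x y where xy: "b = {x, y}" using bE(1) by (rule edge_obtain)
  obtain x1 y1 where xy1: "b' = {x1, y1}" using bE(2) by (rule edge_obtain)
  then have "{collapse a x, collapse a y} = {collapse a x1, collapse a y1}"
    using b(3) xy by simp
  then obtain x' y' where xy': "b' = {x', y'}" "collapse a x = collapse a x'" "collapse a y = collapse a y'"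
    using xy1 unfolding doubleton_eq_iff by (metis insert_commute)
  \<comment> \<open>Both \<open>x, x'\<close> and \<open>y, y'\<close> are equal or joined by \<open>a\<close>.\<close>
  have "conn (E - {b}) x x'" "conn (E - {b}) y y'"
    using xy' collapse_edge_eq[of p q] a assms b conn_edge[of _ _ "E - {b}"]
    by (metis DiffI Diff_iff conn_refl insertCI singletonD)+
  moreover have "conn (E - {b}) x' y'" using b ne xy' by (intro conn_edge) auto
  ultimately have "conn (E - {b}) x y" using conn_sym conn_trans by blast
  then show False using bridge b xy by blast
qed

lemma conn_contract:
  assumes a: "a \<in> E" and b: "b \<in> E" "b \<noteq> a"
  shows "conn ((`) (collapse a) ` (E - {a}) - {collapse a ` b}) (collapse a x) (collapse a y) \<longleftrightarrow>
    conn (E - {b}) x y" (is "conn ?E' _ _ \<longleftrightarrow> _")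
proof
  have eqD: "conn (E - {b}) z z'" if "collapse a z = collapse a z'" for z z'
  proof -
    obtain p q where pq: "a = {p, q}" using a by (rule edge_obtain)
    then have "z = z' \<or> {z, z'} = a" using that collapse_edge_eq a by blast
    then show ?thesis using a b by (auto intro: conn_edge)
  qed
  assume "conn ?E' (collapse a x) (collapse a y)"
  then have "\<forall>z. collapse a z = collapse a y \<longrightarrow> conn (E - {b}) x z"
  proof (induction rule: conn_induct)
    case refl
    then show ?case using eqD by metis
  next
    case (step y z)
    then obtain d where d: "d \<in> E - {a}" "{y, z} = collapse a ` d" "d \<noteq> b" by auto
    then have "d \<in> E" by blast
    then obtain p q where "d = {p, q}" by (rule edge_obtain)
    then obtain p q where pq: "d = {p, q}" "collapse a p = y" "collapse a q = z"
      using d(2) by (auto simp: doubleton_eq_iff)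
    have "conn (E - {b}) p q" using d pq by (auto intro: conn_edge)
    then show ?case using step pq eqD by (metis conn_trans)
  qed
  then show "conn (E - {b}) x y" by simp
next
  assume "conn (E - {b}) x y"
  then show "conn ?E' (collapse a x) (collapse a y)"
  proof (rule conn_map)
    fix y z assume yz: "{y, z} \<in> E - {b}"
    show "conn ?E' (collapse a y) (collapse a z)"
    proof (cases "{y, z} = a")
      case True
      then have "collapse a y = collapse a z" by (auto simp: collapse_def)
      then show ?thesis by simp
    next
      case False
      then have "collapse a ` {y, z} \<in> (`) (collapse a) ` (E - {a})" using yz by blast
      moreover have "collapse a ` {y, z} \<noteq> collapse a ` b"
        using inj_onD[OF inj_on_collapse[OF a], of "{y, z}" b] yz False b by auto
      ultimately show ?thesis by (intro conn_edge) auto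
    qed
  qed
qed

end

lemma (in stable) far_side_contract:
  assumes "a \<in> edges \<Gamma>" "b \<in> edges \<Gamma>" "b \<noteq> a"
  shows "far_side n k (contract a \<Gamma>) (collapse a ` b) = far_side n k \<Gamma> b"
  using conn_contract[OF assms] by (simp add: far_side_def flip: conn_def)

lemma (in rooted_stable) far_sides_contract:
  assumes "a \<in> edges \<Gamma>"
  shows "far_side n k (contract a \<Gamma>) ` edges (contract a \<Gamma>) =
    far_side n k \<Gamma> ` edges \<Gamma> - {far_side n k \<Gamma> a}"
proof -
  have "far_side n k (contract a \<Gamma>) ` edges (contract a \<Gamma>) = far_side n k \<Gamma> ` (edges \<Gamma> - {a})"
    using far_side_contract[OF assms] by (auto simp: image_image)
  then show ?thesis
    using inj_on_image_set_diff[OF inj_on_far_side, of "edges \<Gamma>" "{a}"] assms by auto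
qed

lemma (in stable) card_edges_contract:
  "a \<in> edges \<Gamma> \<Longrightarrow> card (edges \<Gamma>) = Suc (card (edges (contract a \<Gamma>)))"
  using card_image[OF inj_on_collapse, of a] card_Suc_Diff1[OF finite_E, of a] by simp

text \<open>
  Contraction of \<open>a\<close> removes exactly the leg set of \<open>a\<close> from the family of leg sets of the edges,
  and distinct edges have distinct leg sets. So a facet determines the contracted edge.
\<close>

lemma (in rooted_stable) contract_iso_unique:
  assumes "stable_tree n \<Gamma>'" "a \<in> edges \<Gamma>" "b \<in> edges \<Gamma>"
    "tree_iso n \<Gamma>' (contract a \<Gamma>)" "tree_iso n \<Gamma>' (contract b \<Gamma>)"
  shows "a = b"
proof -
  have "far_side n k \<Gamma> ` edges \<Gamma> - {far_side n k \<Gamma> a} = far_side n k \<Gamma> ` edges \<Gamma> - {far_side n k \<Gamma> b}"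
    using far_sides_contract assms tree_iso_far_sides[OF _ _ k] by metis
  then have "far_side n k \<Gamma> a = far_side n k \<Gamma> b" using assms by blast
  then show ?thesis using inj_on_far_side assms by (auto dest: inj_onD)
qed

lemma (in stable_iso) contract_iso:
  assumes a: "a \<in> edges \<Gamma>"
  shows "tree_iso n (contract a \<Gamma>) (contract (\<phi> ` a) \<Gamma>')"
proof -
  let ?\<psi> = "\<lambda>w. collapse (\<phi> ` a) (\<phi> w)"
  have fin: "finite a" "a \<noteq> {}" using edge_card[OF a] card.infinite by fastforce+
  have aV: "a \<subseteq> verts \<Gamma>" using edge_subset a by blast
  have Min: "Min a \<in> a" using fin by simp
  have comm: "?\<psi> (collapse a w) = collapse (\<phi> ` a) (\<phi> w)" if "w \<in> verts \<Gamma>" for w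
    using Min by (auto simp: collapse_def)
  have sub: "collapse a ` verts \<Gamma> \<subseteq> verts \<Gamma>"
    using Min aV by (auto simp: collapse_def)
  have "inj_on ?\<psi> (collapse a ` verts \<Gamma>)"
  proof (rule inj_onI, clarsimp)
    fix w w' assume w: "w \<in> verts \<Gamma>" "w' \<in> verts \<Gamma>" "?\<psi> (collapse a w) = ?\<psi> (collapse a w')"
    then have "\<phi> w = \<phi> w' \<or> \<phi> w \<in> \<phi> ` a \<and> \<phi> w' \<in> \<phi> ` a"
      using comm collapse_eq_iff[of "\<phi> ` a"] fin by auto
    then have "w = w' \<or> w \<in> a \<and> w' \<in> a"
      using inj w aV by (auto simp: inj_on_image_mem_iff dest: inj_onD)
    then show "collapse a w = collapse a w'" by (auto simp: collapse_def)
  qed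
  moreover have "?\<psi> ` collapse a ` verts \<Gamma> = collapse (\<phi> ` a) ` verts \<Gamma>'"
    using comm by (simp add: verts_iso image_image)
  moreover have "(`) (collapse (\<phi> ` a)) ` (edges \<Gamma>' - {\<phi> ` a}) =
      (`) ?\<psi> ` (`) (collapse a) ` (edges \<Gamma> - {a})"
  proof -
    have "collapse (\<phi> ` a) ` \<phi> ` b = ?\<psi> ` collapse a ` b" if "b \<in> edges \<Gamma> - {a}" for b
    proof -
      have "b \<subseteq> verts \<Gamma>" using that edge_subset by blast
      then show ?thesis unfolding image_image using comm by (intro image_cong) auto
    qed
    then show ?thesis unfolding edges_diff_iso[OF a] by (simp add: image_image)
  qed
  ultimately have "iso_by n ?\<psi> (contract a \<Gamma>) (contract (\<phi> ` a) \<Gamma>')"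
    using comm leg_iso leg_vert by (auto simp: iso_by_def bij_betw_def)
  then show ?thesis unfolding tree_iso_iff by blast
qed

section \<open>Splitting a vertex\<close>

text \<open>The neighbours of a vertex at the far ends of the half-edges in \<open>S\<close>.\<close>

definition ends :: "half_edge set \<Rightarrow> nat set" where
  "ends S = {w. \<exists>v. Half v w \<in> S}"

text \<open>
  The half-edges in \<open>S\<close> are moved from \<open>v\<close> to the new vertex \<open>u\<close>, giving the tree \<open>T\<close>; \<open>N\<close> is the
  set of neighbours of \<open>v\<close>. No stability of \<open>T\<close> is required.
\<close>

locale vertex_split = stable +
  fixes v :: nat and S :: "half_edge set"
  assumes v: "v \<in> verts \<Gamma>" and S: "S \<subseteq> half_edges n \<Gamma> v"
begin

definition u :: nat where "u = Suc (Max (verts \<Gamma>))"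

abbreviation "T \<equiv> split_vertex \<Gamma> v S"
abbreviation "N \<equiv> ends (half_edges n \<Gamma> v)"

lemma u_notin: "u \<notin> verts \<Gamma>"
  using Max_ge[OF finite_V, of u] by (auto simp: u_def)

lemma v_less_u: "v < u"
  using Max_ge[OF finite_V v] by (auto simp: u_def)

lemma u_neq: "w \<in> verts \<Gamma> \<Longrightarrow> w \<noteq> u"
  using u_notin by blast

lemma Half_in_S: "Half z w \<in> S \<longleftrightarrow> z = v \<and> w \<in> ends S"
  using S by (auto simp: ends_def)

lemma in_N: "w \<in> N \<longleftrightarrow> {v, w} \<in> edges \<Gamma>"
  by (auto simp: ends_def)

lemma ends_S: "ends S \<subseteq> N"
  using S by (auto simp: ends_def)

lemma N_verts: "w \<in> N \<Longrightarrow> w \<in> verts \<Gamma>" "w \<in> N \<Longrightarrow> w \<noteq> v"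
  using edge_verts(2) edge_distinct unfolding in_N by metis+

lemma notin_ends: "v \<notin> N" "u \<notin> N" "v \<notin> ends S" "u \<notin> ends S"
  using N_verts u_notin ends_S by blast+

lemma leg_neq_u: "i \<in> {1..n} \<Longrightarrow> leg \<Gamma> i \<noteq> u"
  using leg_vert u_notin by metis

lemma verts_T: "verts T = insert u (verts \<Gamma>)"
  by (simp add: split_vertex_def u_def Let_def)

lemma leg_T: "leg T i = (if Leg i \<in> S then u else leg \<Gamma> i)"
  by (simp add: split_vertex_def u_def Let_def)

lemma edges_T:
  "edges T = {{v, u}} \<union> {b \<in> edges \<Gamma>. v \<notin> b} \<union> (\<lambda>w. {v, w}) ` (N - ends S) \<union> (\<lambda>w. {u, w}) ` ends S"
proof -
  have "edges \<Gamma> - {{v, w} | w. Half v w \<in> S} = {b \<in> edges \<Gamma>. v \<notin> b} \<union> (\<lambda>w. {v, w}) ` (N - ends S)"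
  proof (intro equalityI subsetI)
    fix b assume b: "b \<in> edges \<Gamma> - {{v, w} | w. Half v w \<in> S}"
    show "b \<in> {b \<in> edges \<Gamma>. v \<notin> b} \<union> (\<lambda>w. {v, w}) ` (N - ends S)"
    proof (cases "v \<in> b")
      case True
      have "b \<in> edges \<Gamma>" using b by blast
      then obtain p q where pq: "b = {p, q}" by (rule edge_obtain)
      then obtain w where "b = {v, w}" using True by (auto simp: insert_commute)
      then show ?thesis using b by (auto simp: in_N Half_in_S)
    qed (use b in auto)
  next
    fix b assume "b \<in> {b \<in> edges \<Gamma>. v \<notin> b} \<union> (\<lambda>w. {v, w}) ` (N - ends S)"
    then show "b \<in> edges \<Gamma> - {{v, w} | w. Half v w \<in> S}"
      by (auto simp: in_N Half_in_S doubleton_eq_iff)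
  qed
  moreover have "{{u, w} | w. Half v w \<in> S} = (\<lambda>w. {u, w}) ` ends S"
    by (auto simp: Half_in_S)
  moreover have "edges T = insert {v, u} ((edges \<Gamma> - {{v, w} | w. Half v w \<in> S}) \<union> {{u, w} | w. Half v w \<in> S})"
    by (simp add: split_vertex_def u_def Let_def)
  ultimately show ?thesis by auto
qed

lemma edges_eq: "edges \<Gamma> = {b \<in> edges \<Gamma>. v \<notin> b} \<union> (\<lambda>w. {v, w}) ` N"
proof (intro equalityI subsetI)
  fix b assume b: "b \<in> edges \<Gamma>"
  obtain p q where pq: "b = {p, q}" using b by (rule edge_obtain)
  show "b \<in> {b \<in> edges \<Gamma>. v \<notin> b} \<union> (\<lambda>w. {v, w}) ` N"
  proof (cases "v \<in> b")
    case True
    then obtain w where "b = {v, w}" using pq by (auto simp: insert_commute)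
    then show ?thesis using b by (auto simp: in_N)
  qed (use b in simp)
qed (auto simp: in_N)

lemma edge_T_iff:
  "{x, y} \<in> edges T \<longleftrightarrow> {x, y} = {v, u} \<or> {x, y} \<in> edges \<Gamma> \<and> v \<notin> {x, y} \<or>
     x = v \<and> y \<in> N - ends S \<or> y = v \<and> x \<in> N - ends S \<or>
     x = u \<and> y \<in> ends S \<or> y = u \<and> x \<in> ends S"
  unfolding edges_T by (auto simp: doubleton_eq_iff image_iff)

lemma collapse_vu: "collapse {v, u} w = (if w = u then v else w)"
  using v_less_u by (auto simp: collapse_def)

lemma new_edge: "{v, u} \<in> edges T"
  by (simp add: edges_T)

lemma old_edge_notin: "b \<in> edges \<Gamma> \<Longrightarrow> u \<notin> b"
  using edge_subset u_notin by blast

lemma edges_T_diff: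
  "edges T - {{v, u}} = {b \<in> edges \<Gamma>. v \<notin> b} \<union> (\<lambda>w. {v, w}) ` (N - ends S) \<union> (\<lambda>w. {u, w}) ` ends S"
  unfolding edges_T using old_edge_notin notin_ends u_neq[OF v]
  by (auto simp: doubleton_eq_iff)

lemma collapse_edges_T: "(`) (collapse {v, u}) ` (edges T - {{v, u}}) = edges \<Gamma>"
proof -
  let ?c = "collapse {v, u}"
  have 1: "?c ` b = b" if "b \<in> edges \<Gamma>" for b
    using old_edge_notin[OF that] by (auto simp: collapse_vu)
  have 2: "?c ` {v, w} = {v, w}" "?c ` {u, w} = {v, w}" if "w \<in> N" for w
    using N_verts[OF that] u_neq[of w] u_neq[OF v] by (auto simp: collapse_vu)
  have "(`) ?c ` {b \<in> edges \<Gamma>. v \<notin> b} = {b \<in> edges \<Gamma>. v \<notin> b}"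
    using 1 by force
  moreover have "(`) ?c ` (\<lambda>w. {v, w}) ` (N - ends S) = (\<lambda>w. {v, w}) ` (N - ends S)"
    unfolding image_comp comp_def using 2 by (intro image_cong) auto
  moreover have "(`) ?c ` (\<lambda>w. {u, w}) ` ends S = (\<lambda>w. {v, w}) ` ends S"
    unfolding image_comp comp_def using 2 ends_S by (intro image_cong) auto
  ultimately have "(`) ?c ` (edges T - {{v, u}}) =
      {b \<in> edges \<Gamma>. v \<notin> b} \<union> (\<lambda>w. {v, w}) ` (N - ends S) \<union> (\<lambda>w. {v, w}) ` ends S"
    unfolding edges_T_diff image_Un by simp
  also have "\<dots> = {b \<in> edges \<Gamma>. v \<notin> b} \<union> (\<lambda>w. {v, w}) ` N"
    using ends_S by blast
  finally show ?thesis using edges_eq by simp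
qed

lemma inj_on_collapse_T: "inj_on ((`) (collapse {v, u})) (edges T - {{v, u}})"
proof -
  let ?c = "collapse {v, u}"
  \<comment> \<open>\<open>g\<close> is a left inverse: it moves the edges \<open>{v, w}\<close> with \<open>w \<in> ends S\<close> back to \<open>u\<close>.\<close>
  define g where "g = (\<lambda>b. if b \<in> (\<lambda>w. {v, w}) ` ends S then insert u (b - {v}) else b)"
  have "g (?c ` b) = b" if b: "b \<in> edges T - {{v, u}}" for b
  proof -
    consider "b \<in> edges \<Gamma>" "v \<notin> b" | w where "b = {v, w}" "w \<in> N - ends S" | w where "b = {u, w}" "w \<in> ends S"
      using b unfolding edges_T_diff by blast
    then show ?thesis
    proof cases
      case 1
      then have "?c ` b = b" using old_edge_notin[of b] by (auto simp: collapse_vu)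
      then show ?thesis using 1 by (auto simp: g_def)
    next
      case 2
      then have "w \<noteq> u" using notin_ends(2) by blast
      moreover have "v \<noteq> u" using v_less_u by simp
      ultimately have "?c ` b = b" using 2 by (simp add: collapse_vu)
      moreover have "b \<notin> (\<lambda>w. {v, w}) ` ends S"
        using 2(2) unfolding 2(1) by (auto simp: doubleton_eq_iff)
      ultimately show ?thesis by (simp add: g_def)
    next
      case 3
      then have w: "w \<in> N" using ends_S by blast
      then have "w \<noteq> u" using notin_ends(2) by blast
      then have "?c ` b = {v, w}" unfolding 3(1) by (auto simp: collapse_vu)
      moreover have "{v, w} \<in> (\<lambda>w. {v, w}) ` ends S" using 3(2) by (rule imageI)
      moreover have "insert u ({v, w} - {v}) = {u, w}" using N_verts(2)[OF w] by auto
      ultimately show ?thesis unfolding g_def 3(1) by simp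
    qed
  qed
  then show ?thesis by (rule inj_on_inverseI)
qed

lemma contract_T: "tree_iso n \<Gamma> (contract {v, u} T)"
proof -
  have "collapse {v, u} ` verts T = verts \<Gamma>"
    using v u_notin by (auto simp: verts_T collapse_vu)
  moreover have "collapse {v, u} (leg T i) = leg \<Gamma> i" if "i \<in> {1..n}" for i
    using S leg_vert[OF that] u_notin by (auto simp: leg_T collapse_vu)
  ultimately have "iso_by n (\<lambda>x. x) \<Gamma> (contract {v, u} T)"
    using collapse_edges_T by (simp add: iso_by_def bij_betw_def)
  then show ?thesis unfolding tree_iso_iff by blast
qed

text \<open>The vertices on the side of \<open>u\<close> of the new edge are those in the branches moved to \<open>u\<close>.\<close>

lemma branch_new_edge:
  "branch (edges T) v u = insert u (\<Union>w\<in>ends S. branch (edges \<Gamma>) v w)" (is "_ = ?X")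
proof
  have closed: "z \<in> ?X" if yz: "{y, z} \<in> edges T - {{v, u}}" and y: "y \<in> ?X" for y z
  proof (cases "y = u")
    case True
    then have "z \<in> ends S"
      using yz u_notin v N_verts(1) ends_S old_edge_notin by (auto simp: edge_T_iff)
    then show ?thesis by auto
  next
    case False
    then obtain w where w: "w \<in> ends S" "y \<in> branch (edges \<Gamma>) v w" using y by blast
    then have vw: "{v, w} \<in> edges \<Gamma>" using ends_S in_N by blast
    then have "y \<noteq> v" using w not_in_branch by blast
    show ?thesis
    proof (cases "z = u")
      case zu: False
      have e: "{y, z} \<in> edges \<Gamma>"
        using yz False zu \<open>y \<noteq> v\<close> by (auto simp: edge_T_iff in_N insert_commute)
      have "{y, z} \<noteq> {v, w}"
      proof
        assume "{y, z} = {v, w}"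
        then have "y = w" "z = v" using \<open>y \<noteq> v\<close> by (auto simp: doubleton_eq_iff)
        then have "w \<notin> ends S"
          using yz False zu \<open>y \<noteq> v\<close> by (auto simp: edge_T_iff)
        then show False using w by blast
      qed
      then have "z \<in> branch (edges \<Gamma>) v w" by (rule branch_step[OF w(2) e])
      then show ?thesis using w(1) by blast
    qed simp
  qed
  show "branch (edges T) v u \<subseteq> ?X"
  proof
    fix y assume "y \<in> branch (edges T) v u"
    then have "conn (edges T - {{v, u}}) u y" by (simp add: branch_def)
    then show "y \<in> ?X" by (rule conn_closed) (use closed in auto)
  qed
  show "?X \<subseteq> branch (edges T) v u"
  proof (intro subsetI, elim insertE)
    fix y assume "y \<in> (\<Union>w\<in>ends S. branch (edges \<Gamma>) v w)"
    then obtain w where w: "w \<in> ends S" "y \<in> branch (edges \<Gamma>) v w" by blast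
    then have vw: "{v, w} \<in> edges \<Gamma>" using ends_S in_N by blast
    have "conn (edges \<Gamma> - {{v, w}}) w y" using w by (simp add: branch_def)
    then have "y \<in> branch (edges T) v u \<and> y \<in> branch (edges \<Gamma>) v w"
    proof (induction rule: conn_induct)
      case refl
      have "{u, w} \<in> edges T" using w by (simp add: edges_T)
      moreover have "{u, w} \<noteq> {v, u}"
        using edge_distinct[OF vw] v_less_u by (auto simp: doubleton_eq_iff)
      ultimately show ?case using branch_step[of u "edges T" v u w] by simp
    next
      case (step y z)
      then have z: "z \<in> branch (edges \<Gamma>) v w" using branch_step by blast
      then have "v \<notin> {y, z}" using step not_in_branch[OF vw] by blast
      then have "{y, z} \<in> edges T" "{y, z} \<noteq> {v, u}" using step by (auto simp: edges_T)
      then show ?case using branch_step step z by blast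
    qed
    then show "y \<in> branch (edges T) v u" by blast
  qed simp
qed

lemma v_notin_branch_new_edge: "v \<notin> branch (edges T) v u"
proof -
  have "v \<notin> branch (edges \<Gamma>) v w" if "w \<in> ends S" for w
    using that ends_S in_N not_in_branch by blast
  then show ?thesis using v_less_u by (auto simp: branch_new_edge)
qed

lemma is_tree_T: "is_tree (verts T) (edges T)"
  unfolding is_tree_iff_bridges
proof (intro conjI ballI allI impI notI)
  show "finite (verts T)" using finite_V by (simp add: verts_T)
  show "False" if "verts T = {}" using that by (simp add: verts_T)
  show "b \<subseteq> verts T" "card b = 2" if b: "b \<in> edges T" for b
  proof -
    consider "b = {v, u}" | "b \<in> edges \<Gamma>" | w where "b = {v, w}" "w \<in> N" | w where "b = {u, w}" "w \<in> N"
      using b ends_S unfolding edges_T by blast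
    then show "b \<subseteq> verts T" "card b = 2"
      using v v_less_u N_verts edge_subset edge_card u_notin
      by (cases; auto simp: verts_T card_insert_if)+
  qed
  have sub: "conn (edges \<Gamma>) x y \<Longrightarrow> conn (edges T) x y" for x y
  proof (rule conn_map[where g = "\<lambda>x. x"])
    fix y z assume yz: "{y, z} \<in> edges \<Gamma>"
    have uv: "conn (edges T) v u" using new_edge conn_edge by blast
    have vw: "conn (edges T) v w" if "w \<in> N" for w
    proof (cases "w \<in> ends S")
      case True
      then show ?thesis using uv conn_step by (auto simp: edges_T)
    qed (use that in \<open>auto simp: edges_T intro: conn_edge\<close>)
    show "conn (edges T) y z"
    proof (cases "v \<in> {y, z}")
      case True
      then show ?thesis using yz vw[of y] vw[of z] conn_sym by (auto simp: in_N insert_commute)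
    qed (use yz in \<open>auto simp: edges_T intro: conn_edge\<close>)
  qed
  have "conn (edges T) v x" if "x \<in> verts T" for x
  proof (cases "x = u")
    case True
    then show ?thesis using conn_edge[OF new_edge] by simp
  next
    case False
    then show ?thesis using that by (intro sub connected v) (simp add: verts_T)
  qed
  then show "conn (edges T) x y" if "x \<in> verts T" "y \<in> verts T" for x y
    using that by (meson conn_sym conn_trans)
next
  fix x y
  assume xy: "{x, y} \<in> edges T" and c: "conn (edges T - {{x, y}}) x y"
  let ?c = "collapse {v, u}"
  show False
  proof (cases "{x, y} = {v, u}")
    case True
    then have "conn (edges T - {{v, u}}) u v" using c conn_sym by (auto simp: doubleton_eq_iff insert_commute)
    then have "v \<in> branch (edges T) v u" by (simp add: branch_def)
    then show False using v_notin_branch_new_edge by blast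
  next
    case False
    then have E: "{?c x, ?c y} \<in> edges \<Gamma>"
      using xy imageI[of "{x, y}" "edges T - {{v, u}}" "(`) ?c"] unfolding collapse_edges_T by simp
    have "conn (edges \<Gamma> - {{?c x, ?c y}}) (?c x) (?c y)"
    proof (rule conn_map[OF c])
      fix p q assume pq: "{p, q} \<in> edges T - {{x, y}}"
      show "conn (edges \<Gamma> - {{?c x, ?c y}}) (?c p) (?c q)"
      proof (cases "{p, q} = {v, u}")
        case True
        then have "?c p = ?c q" by (auto simp: collapse_vu doubleton_eq_iff)
        then show ?thesis by simp
      next
        case ne: False
        then have "{?c p, ?c q} \<in> edges \<Gamma>"
          using pq imageI[of "{p, q}" "edges T - {{v, u}}" "(`) ?c"] unfolding collapse_edges_T by simp
        moreover have "{?c p, ?c q} \<noteq> {?c x, ?c y}"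
          using inj_onD[OF inj_on_collapse_T, of "{p, q}" "{x, y}"] pq xy False ne by auto
        ultimately show ?thesis by (intro conn_edge) auto
      qed
    qed
    then show False using bridge E by blast
  qed
qed

lemma finite_S: "finite S"
  using S finite_half_edges finite_subset by blast

lemma card_half_edges_u: "card (half_edges n T u) = Suc (card S)"
proof -
  let ?g = "\<lambda>h. case h of Leg i \<Rightarrow> Leg i | Half z w \<Rightarrow> Half u w"
  have "half_edges n T u = insert (Half u v) (?g ` S)"
  proof (intro equalityI subsetI)
    fix h assume h: "h \<in> half_edges n T u"
    show "h \<in> insert (Half u v) (?g ` S)"
    proof (cases h)
      case (Leg i)
      then have "Leg i \<in> S" using h leg_neq_u by (auto simp: leg_T split: if_splits)
      then show ?thesis using Leg by (intro insertI2 image_eqI[of _ _ "Leg i"]) auto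
    next
      case (Half z w)
      then have "z = u" "w = v \<or> w \<in> ends S"
        using h v_less_u u_notin N_verts(1) ends_S old_edge_notin by (auto simp: edge_T_iff doubleton_eq_iff)
      then show ?thesis using Half Half_in_S[of v w] by (auto intro!: image_eqI[of _ _ "Half v w"])
    qed
  next
    fix h assume "h \<in> insert (Half u v) (?g ` S)"
    then show "h \<in> half_edges n T u"
    proof (elim insertE imageE)
      fix g assume g: "h = ?g g" "g \<in> S"
      then show ?thesis
        using S by (cases g) (auto simp: leg_T edge_T_iff Half_in_S)
    qed (simp add: edge_T_iff insert_commute)
  qed
  moreover have "inj_on ?g S"
    by (rule inj_onI) (auto simp: Half_in_S split: half_edge.splits)
  moreover have "Half u v \<notin> ?g ` S"
    using notin_ends by (auto simp: Half_in_S split: half_edge.splits)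
  ultimately show ?thesis using finite_S by (simp add: card_image)
qed

lemma card_half_edges_v: "card (half_edges n T v) = Suc (card (half_edges n \<Gamma> v - S))"
proof -
  have "half_edges n T v = insert (Half v u) (half_edges n \<Gamma> v - S)"
  proof (intro set_eqI)
    fix h
    show "h \<in> half_edges n T v \<longleftrightarrow> h \<in> insert (Half v u) (half_edges n \<Gamma> v - S)"
      using v_less_u N_verts ends_S u_notin
      by (cases h) (auto simp: leg_T edge_T_iff Half_in_S in_N doubleton_eq_iff)
  qed
  moreover have "Half v u \<notin> half_edges n \<Gamma> v" using N_verts(1)[of u] u_notin in_N by auto
  ultimately show ?thesis using finite_half_edges by simp
qed

lemma card_half_edges_other:
  assumes "x \<in> verts \<Gamma>" "x \<noteq> v"
  shows "card (half_edges n T x) = card (half_edges n \<Gamma> x)"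
proof -
  let ?g = "\<lambda>h. if h = Half x v \<and> x \<in> ends S then Half x u else h"
  have xu: "x \<noteq> u" using assms u_notin by blast
  have "half_edges n T x = ?g ` half_edges n \<Gamma> x"
  proof (intro equalityI subsetI)
    fix h assume h: "h \<in> half_edges n T x"
    show "h \<in> ?g ` half_edges n \<Gamma> x"
    proof (cases h)
      case (Leg i)
      then show ?thesis
        using h xu by (intro image_eqI[of _ _ "Leg i"]) (auto simp: leg_T split: if_splits)
    next
      case (Half z w)
      then have "z = x" "{x, w} \<in> edges \<Gamma> \<and> w \<noteq> v \<or> w = v \<and> x \<in> N - ends S \<or> w = u \<and> x \<in> ends S"
        using h xu assms by (auto simp: edge_T_iff doubleton_eq_iff)
      then consider "z = x" "{x, w} \<in> edges \<Gamma>" "w \<noteq> v" | "z = x" "w = v" "x \<in> N" "x \<notin> ends S"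
        | "z = x" "w = u" "x \<in> ends S" by blast
      then show ?thesis
      proof cases
        case 1
        then show ?thesis using Half by (intro image_eqI[of _ _ "Half x w"]) auto
      next
        case 2
        then show ?thesis using Half by (intro image_eqI[of _ _ "Half x v"]) (auto simp: in_N insert_commute)
      next
        case 3
        then show ?thesis using Half ends_S by (intro image_eqI[of _ _ "Half x v"]) (auto simp: in_N insert_commute)
      qed
    qed
  next
    fix h assume "h \<in> ?g ` half_edges n \<Gamma> x"
    then obtain g where g: "g \<in> half_edges n \<Gamma> x" "h = ?g g" by blast
    then show "h \<in> half_edges n T x"
      using assms S by (cases g) (auto simp: leg_T edge_T_iff in_N insert_commute)
  qed
  moreover have "Half x u \<notin> half_edges n \<Gamma> x" using old_edge_notin by auto
  then have "inj_on ?g (half_edges n \<Gamma> x)"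
    by (intro inj_onI) (auto split: if_splits)
  ultimately show ?thesis by (simp only: card_image)
qed

lemma stable_T_iff: "stable_tree n T \<longleftrightarrow> 2 \<le> card S \<and> 2 \<le> card (half_edges n \<Gamma> v - S)"
proof
  assume "stable_tree n T"
  then have "3 \<le> card (half_edges n T u)" "3 \<le> card (half_edges n T v)"
    using v by (auto simp: stable_tree_def verts_T)
  then show "2 \<le> card S \<and> 2 \<le> card (half_edges n \<Gamma> v - S)"
    unfolding card_half_edges_u card_half_edges_v by simp
next
  assume *: "2 \<le> card S \<and> 2 \<le> card (half_edges n \<Gamma> v - S)"
  have "3 \<le> card (half_edges n T x)" if "x \<in> verts T" for x
  proof -
    consider "x = u" | "x = v" | "x \<in> verts \<Gamma>" "x \<noteq> v" using \<open>x \<in> verts T\<close> verts_T by blast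
    then show ?thesis
      using * card_half_edges_u card_half_edges_v card_half_edges_other card_half_edges by cases auto
  qed
  moreover have "leg T ` {1..n} \<subseteq> verts T"
    using leg_vert by (auto simp: leg_T verts_T)
  ultimately show "stable_tree n T" using is_tree_T by (simp add: stable_tree_def)
qed

lemma beyond_new_edge: "beyond n T (Half v u) = \<Union> (beyond n \<Gamma> ` S)"
proof -
  have "leg T i \<in> branch (edges T) v u \<longleftrightarrow> (\<exists>h\<in>S. i \<in> beyond n \<Gamma> h)" if i: "i \<in> {1..n}" for i
  proof -
    have "(\<exists>h\<in>S. i \<in> beyond n \<Gamma> h) \<longleftrightarrow> Leg i \<in> S \<or> (\<exists>w\<in>ends S. leg \<Gamma> i \<in> branch (edges \<Gamma>) v w)"
    proof
      assume "\<exists>h\<in>S. i \<in> beyond n \<Gamma> h"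
      then obtain h where h: "h \<in> S" "i \<in> beyond n \<Gamma> h" by blast
      then show "Leg i \<in> S \<or> (\<exists>w\<in>ends S. leg \<Gamma> i \<in> branch (edges \<Gamma>) v w)"
        by (cases h) (auto simp: Half_in_S)
    next
      assume "Leg i \<in> S \<or> (\<exists>w\<in>ends S. leg \<Gamma> i \<in> branch (edges \<Gamma>) v w)"
      then consider "Leg i \<in> S" | w where "Half v w \<in> S" "leg \<Gamma> i \<in> branch (edges \<Gamma>) v w"
        using Half_in_S by blast
      then show "\<exists>h\<in>S. i \<in> beyond n \<Gamma> h"
        using i by cases (auto intro: bexI[of _ "Leg i"] bexI[of _ "Half v _"])
    qed
    then show ?thesis using leg_vert[OF i] u_notin by (auto simp: branch_new_edge leg_T)
  qed
  moreover have "beyond n \<Gamma> h \<subseteq> {1..n}" if "h \<in> S" for h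
    using that S beyond_subset by blast
  ultimately show ?thesis by fastforce
qed

text \<open>The two vertices of a splitting play symmetric roles.\<close>

lemma split_complement: "tree_iso n T (split_vertex \<Gamma> v (half_edges n \<Gamma> v - S))"
proof -
  let ?S' = "half_edges n \<Gamma> v - S"
  let ?\<phi> = "transpose v u"
  interpret co: vertex_split n \<Gamma> v ?S' by unfold_locales (use v in auto)
  have ends': "ends ?S' = N - ends S"
  proof (intro set_eqI)
    fix w
    have "w \<in> ends ?S' \<longleftrightarrow> {v, w} \<in> edges \<Gamma> \<and> Half v w \<notin> S" by (auto simp: ends_def)
    then show "w \<in> ends ?S' \<longleftrightarrow> w \<in> N - ends S" by (simp add: in_N Half_in_S)
  qed
  have ends: "N - (N - ends S) = ends S" using ends_S by blast
  have fix': "?\<phi> w = w" if "w \<in> N" for w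
    using that N_verts u_notin by (auto simp: transpose_def)
  have "?\<phi> ` b = b" if "b \<in> edges \<Gamma>" "v \<notin> b" for b
    using old_edge_notin[OF that(1)] that(2) by (force simp: transpose_def)
  then have "(`) ?\<phi> ` {b \<in> edges \<Gamma>. v \<notin> b} = {b \<in> edges \<Gamma>. v \<notin> b}" by force
  moreover have "(`) ?\<phi> ` (\<lambda>w. {v, w}) ` (N - ends S) = (\<lambda>w. {u, w}) ` (N - ends S)"
    unfolding image_comp comp_def by (intro image_cong) (auto simp: fix')
  moreover have "(`) ?\<phi> ` (\<lambda>w. {u, w}) ` ends S = (\<lambda>w. {v, w}) ` ends S"
    unfolding image_comp comp_def using ends_S by (intro image_cong) (auto simp: fix')
  moreover have "?\<phi> ` {v, u} = {v, u}" by auto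
  ultimately have "(`) ?\<phi> ` edges T = edges (split_vertex \<Gamma> v ?S')"
    unfolding edges_T co.edges_T ends ends' image_Un by (simp add: Un_commute Un_left_commute)
  moreover have "leg (split_vertex \<Gamma> v ?S') i = ?\<phi> (leg T i)" if "i \<in> {1..n}" for i
    using that S leg_vert[OF that] u_notin by (auto simp: leg_T co.leg_T transpose_def)
  moreover have "bij_betw ?\<phi> (verts T) (verts (split_vertex \<Gamma> v ?S'))"
    unfolding verts_T co.verts_T using v
    by (auto simp: bij_betw_def transpose_def inj_on_def image_iff)
  ultimately have "iso_by n ?\<phi> T (split_vertex \<Gamma> v ?S')" by (simp add: iso_by_def)
  then show ?thesis unfolding tree_iso_iff by blast
qed

end

lemma (in stable) inj_on_split_vertex:
  assumes v: "v \<in> verts \<Gamma>"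
  shows "inj_on (split_vertex \<Gamma> v) (Pow (half_edges n \<Gamma> v))"
proof (rule inj_onI, rule set_eqI)
  fix S S' h
  assume SS: "S \<in> Pow (half_edges n \<Gamma> v)" "S' \<in> Pow (half_edges n \<Gamma> v)"
    and eq: "split_vertex \<Gamma> v S = split_vertex \<Gamma> v S'"
  interpret s: vertex_split n \<Gamma> v S using v SS by unfold_locales auto
  interpret s': vertex_split n \<Gamma> v S' using v SS by unfold_locales auto
  have "Leg i \<in> S \<longleftrightarrow> Leg i \<in> S'" if "i \<in> {1..n}" for i
  proof -
    have "leg \<Gamma> i \<noteq> s.u" using leg_vert[OF that] s.u_notin by metis
    then have "Leg i \<in> S \<longleftrightarrow> leg (split_vertex \<Gamma> v S) i = s.u"
      "Leg i \<in> S' \<longleftrightarrow> leg (split_vertex \<Gamma> v S') i = s.u"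
      by (simp_all add: s.leg_T s'.leg_T)
    then show ?thesis by (simp add: eq)
  qed
  moreover have "w \<in> ends S \<longleftrightarrow> {s.u, w} \<in> edges (split_vertex \<Gamma> v S) \<and> w \<noteq> v" for w
    using s.old_edge_notin s.v_less_u s.N_verts s.ends_S s.u_notin
    by (auto simp: s.edge_T_iff doubleton_eq_iff)
  moreover have "w \<in> ends S' \<longleftrightarrow> {s.u, w} \<in> edges (split_vertex \<Gamma> v S) \<and> w \<noteq> v" for w
    unfolding eq using s'.old_edge_notin s'.v_less_u s'.N_verts s'.ends_S s'.u_notin
    by (auto simp: s'.edge_T_iff doubleton_eq_iff)
  ultimately show "h \<in> S \<longleftrightarrow> h \<in> S'"
    using SS by (cases h) (auto simp: s.Half_in_S s'.Half_in_S)
qed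

text \<open>
  If \<open>\<Gamma>'\<close> is a contraction of \<open>\<Gamma>\<close>, then \<open>\<Gamma>\<close> is a splitting of \<open>\<Gamma>'\<close>: the half-edges at the larger
  endpoint \<open>q\<close> of the contracted edge are those moved to the new vertex.
\<close>

lemma (in stable) contract_is_split:
  assumes \<Gamma>': "stable_tree n \<Gamma>'" and a: "a \<in> edges \<Gamma>" and iso: "tree_iso n (contract a \<Gamma>) \<Gamma>'"
  obtains v S where "v \<in> verts \<Gamma>'" "S \<subseteq> half_edges n \<Gamma>' v" "tree_iso n \<Gamma> (split_vertex \<Gamma>' v S)"
proof -
  obtain \<phi> where \<phi>: "bij_betw \<phi> (collapse a ` verts \<Gamma>) (verts \<Gamma>')"
    "edges \<Gamma>' = (`) \<phi> ` (`) (collapse a) ` (edges \<Gamma> - {a})"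
    "\<And>i. i \<in> {1..n} \<Longrightarrow> leg \<Gamma>' i = \<phi> (collapse a (leg \<Gamma> i))"
    using iso by (auto simp: tree_iso_iff iso_by_def)
  obtain p q where pq: "a = {p, q}" "p < q"
  proof -
    obtain x y where "a = {x, y}" using a by (rule edge_obtain)
    then show ?thesis using that[of x y] that[of y x] edge_distinct[of x y] a
      by (cases x y rule: linorder_cases) (auto simp: insert_commute)
  qed
  have pqV: "p \<in> verts \<Gamma>" "q \<in> verts \<Gamma>" and e: "{p, q} \<in> edges \<Gamma>" "{q, p} \<in> edges \<Gamma>"
    using a pq edge_verts by (auto simp: insert_commute)
  have c: "collapse a w = (if w = q then p else w)" for w
    using pq by (auto simp: collapse_def)
  have V: "collapse a ` verts \<Gamma> = verts \<Gamma> - {q}"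
    using pqV pq(2) by (auto simp: c)
  have inj: "inj_on \<phi> (verts \<Gamma> - {q})" and im: "\<phi> ` (verts \<Gamma> - {q}) = verts \<Gamma>'"
    using \<phi>(1) V by (auto simp: bij_betw_def)
  define Np where "Np = {w. {p, w} \<in> edges \<Gamma> \<and> w \<noteq> q}"
  define Nq where "Nq = {w. {q, w} \<in> edges \<Gamma> \<and> w \<noteq> p}"
  define R where "R = {b \<in> edges \<Gamma>. p \<notin> b \<and> q \<notin> b}"
  have Np: "Np \<subseteq> verts \<Gamma> - {p, q}" and Nq: "Nq \<subseteq> verts \<Gamma> - {p, q}"
    using edge_verts edge_distinct[of p p] edge_distinct[of q q] by (auto simp: Np_def Nq_def)
  have disj: "Np \<inter> Nq = {}"
  proof (rule ccontr)
    assume "Np \<inter> Nq \<noteq> {}"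
    then obtain w where w: "{p, w} \<in> edges \<Gamma>" "{q, w} \<in> edges \<Gamma>" "w \<noteq> p" "w \<noteq> q"
      by (auto simp: Np_def Nq_def)
    then have "{p, w} \<in> edges \<Gamma> - {{p, q}}" "{w, q} \<in> edges \<Gamma> - {{p, q}}"
      by (auto simp: doubleton_eq_iff insert_commute)
    then have "conn (edges \<Gamma> - {{p, q}}) p q" by (meson conn_edge conn_trans)
    then show False using bridge[OF e(1)] by blast
  qed
  have E: "edges \<Gamma> - {a} = R \<union> (\<lambda>w. {p, w}) ` Np \<union> (\<lambda>w. {q, w}) ` Nq"
  proof (intro equalityI subsetI)
    fix b assume b: "b \<in> edges \<Gamma> - {a}"
    then have "b \<in> edges \<Gamma>" by blast
    then obtain x y where xy: "b = {x, y}" by (rule edge_obtain)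
    show "b \<in> R \<union> (\<lambda>w. {p, w}) ` Np \<union> (\<lambda>w. {q, w}) ` Nq"
    proof (cases "p \<in> b \<or> q \<in> b")
      case True
      then obtain w where "b = {p, w} \<or> b = {q, w}" using xy by auto
      then show ?thesis using b pq(1) by (auto simp: Np_def Nq_def insert_commute)
    qed (use b in \<open>auto simp: R_def\<close>)
  qed (auto simp: R_def Np_def Nq_def pq(1) doubleton_eq_iff)
  have RV: "b \<subseteq> verts \<Gamma> - {p, q}" if "b \<in> R" for b
    using that edge_subset by (auto simp: R_def)
  define v where "v = \<phi> p"
  have v: "v \<in> verts \<Gamma>'" using im pqV pq(2) unfolding v_def by blast
  define S where "S = {Leg i | i. i \<in> {1..n} \<and> leg \<Gamma> i = q} \<union> Half v ` \<phi> ` Nq"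
  have E': "edges \<Gamma>' = (`) \<phi> ` R \<union> (\<lambda>w. {v, \<phi> w}) ` (Np \<union> Nq)"
  proof -
    have "collapse a ` b = b" if "b \<in> R" for b
      using RV[OF that] by (auto simp: c)
    then have "(`) (collapse a) ` R = R" by force
    moreover have "(`) (collapse a) ` (\<lambda>w. {p, w}) ` Np = (\<lambda>w. {p, w}) ` Np"
      unfolding image_comp comp_def using Np pq(2) by (intro image_cong) (auto simp: c)
    moreover have "(`) (collapse a) ` (\<lambda>w. {q, w}) ` Nq = (\<lambda>w. {p, w}) ` Nq"
      unfolding image_comp comp_def using Nq pq(2) by (intro image_cong) (auto simp: c)
    ultimately show ?thesis
      unfolding \<phi>(2) E image_Un by (simp add: image_image v_def Un_assoc)
  qed
  interpret t: stable n \<Gamma>' using \<Gamma>' by unfold_locales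
  have S: "S \<subseteq> half_edges n \<Gamma>' v"
    using \<phi>(3) by (auto simp: S_def c v_def E')
  interpret s: vertex_split n \<Gamma>' v S using v S by unfold_locales
  have ends: "ends S = \<phi> ` Nq" by (auto simp: ends_def S_def)
  have v_notin: "v \<notin> \<phi> ` b" if "b \<subseteq> verts \<Gamma> - {p, q}" for b
    using inj_onD[OF inj, of p] that pqV pq(2) unfolding v_def by blast
  have "{v, w} \<in> edges \<Gamma>' \<longleftrightarrow> w \<in> \<phi> ` (Np \<union> Nq)" for w
  proof -
    have "{v, w} \<notin> (`) \<phi> ` R" using v_notin RV by (metis (no_types, lifting) imageE insertI1)
    then show ?thesis
      unfolding E' using v_notin[OF Np] v_notin[OF Nq] by (auto simp: doubleton_eq_iff)
  qed
  then have N: "ends (half_edges n \<Gamma>' v) = \<phi> ` (Np \<union> Nq)" using s.in_N by blast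
  have "\<phi> ` (Np \<union> Nq) - \<phi> ` Nq = \<phi> ` (Np \<union> Nq - Nq)"
    using Np Nq by (intro inj_on_image_set_diff[OF inj, symmetric]) auto
  also have "Np \<union> Nq - Nq = Np" using disj by blast
  finally have N_diff: "ends (half_edges n \<Gamma>' v) - ends S = \<phi> ` Np" by (simp add: N ends)
  have avoid: "{b \<in> edges \<Gamma>'. v \<notin> b} = (`) \<phi> ` R"
  proof -
    have "v \<notin> b" if "b \<in> (`) \<phi> ` R" for b
      using that v_notin[OF RV] by blast
    then show ?thesis unfolding E' by blast
  qed
  define \<psi> where "\<psi> = (\<lambda>w. if w = q then s.u else \<phi> w)"
  have \<psi>: "\<psi> w = \<phi> w" if "w \<noteq> q" for w using that by (simp add: \<psi>_def)
  have "bij_betw \<psi> (verts \<Gamma>) (verts (split_vertex \<Gamma>' v S))"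
  proof -
    have "bij_betw \<psi> (verts \<Gamma> - {q}) (verts \<Gamma>')"
      using \<psi> inj im by (subst bij_betw_cong[of _ _ \<phi>]) (auto simp: bij_betw_def)
    then have "bij_betw \<psi> (insert q (verts \<Gamma> - {q})) (insert (\<psi> q) (verts \<Gamma>'))"
      using s.u_notin notIn_Un_bij_betw[of q "verts \<Gamma> - {q}" \<psi> "verts \<Gamma>'"] by (simp add: \<psi>_def)
    then show ?thesis using pqV by (simp add: s.verts_T insert_absorb \<psi>_def)
  qed
  moreover have "(`) \<psi> ` edges \<Gamma> = edges (split_vertex \<Gamma>' v S)"
  proof -
    have "(`) \<psi> ` R = (`) \<phi> ` R"
    proof (rule image_cong)
      fix b assume "b \<in> R"
      then show "\<psi> ` b = \<phi> ` b" using RV \<psi> by (intro image_cong) auto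
    qed simp
    moreover have "(`) \<psi> ` (\<lambda>w. {p, w}) ` Np = (\<lambda>w. {v, w}) ` \<phi> ` Np"
      unfolding image_comp comp_def using Np pq(2) by (intro image_cong) (auto simp: \<psi>_def v_def)
    moreover have "(`) \<psi> ` (\<lambda>w. {q, w}) ` Nq = (\<lambda>w. {s.u, w}) ` \<phi> ` Nq"
      unfolding image_comp comp_def using Nq pq(2) by (intro image_cong) (auto simp: \<psi>_def)
    moreover have "\<psi> ` a = {v, s.u}" using pq by (auto simp: \<psi>_def v_def)
    moreover have "(`) \<psi> ` edges \<Gamma> = insert (\<psi> ` a) ((`) \<psi> ` (edges \<Gamma> - {a}))"
      using a by blast
    ultimately show ?thesis
      unfolding s.edges_T avoid N_diff unfolding ends E image_Un by simp
  qed
  moreover have "leg (split_vertex \<Gamma>' v S) i = \<psi> (leg \<Gamma> i)" if "i \<in> {1..n}" for i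
  proof -
    have "Leg i \<in> S \<longleftrightarrow> leg \<Gamma> i = q" using that by (auto simp: S_def)
    then show ?thesis using \<phi>(3)[OF that] by (simp add: s.leg_T \<psi>_def c)
  qed
  ultimately have "iso_by n \<psi> \<Gamma> (split_vertex \<Gamma>' v S)" by (simp add: iso_by_def)
  then show ?thesis using that v S unfolding tree_iso_iff by blast
qed

section \<open>Invariance of the weights\<close>

lemma (in based_quadratic_space) etaI_symmetric:
  assumes "\<alpha> \<in> A" "\<beta> \<in> A"
  shows "etaI \<alpha> \<beta> = etaI \<beta> \<alpha>"
proof -
  let ?g = "\<lambda>\<gamma> \<delta>. eta (e \<gamma>) (e \<delta>)"
  have "(\<Sum>\<gamma>\<in>A. \<Sum>\<delta>\<in>A. etaI \<beta> \<delta> * ?g \<delta> \<gamma> * etaI \<alpha> \<gamma>) = (\<Sum>\<gamma>\<in>A. (if \<beta> = \<gamma> then 1 else 0) * etaI \<alpha> \<gamma>)"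
    using assms by (intro sum.cong refl) (simp add: etaI_left flip: sum_distrib_right)
  also have "\<dots> = (\<Sum>\<gamma>\<in>A. if \<beta> = \<gamma> then etaI \<alpha> \<gamma> else 0)" by (intro sum.cong) auto
  also have "\<dots> = etaI \<alpha> \<beta>" using assms finite_A by simp
  finally have 1: "(\<Sum>\<gamma>\<in>A. \<Sum>\<delta>\<in>A. etaI \<beta> \<delta> * ?g \<delta> \<gamma> * etaI \<alpha> \<gamma>) = etaI \<alpha> \<beta>" .
  have "(\<Sum>\<gamma>\<in>A. \<Sum>\<delta>\<in>A. etaI \<beta> \<delta> * ?g \<delta> \<gamma> * etaI \<alpha> \<gamma>) = (\<Sum>\<delta>\<in>A. \<Sum>\<gamma>\<in>A. etaI \<beta> \<delta> * ?g \<delta> \<gamma> * etaI \<alpha> \<gamma>)"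
    by (rule sum.swap)
  also have "\<dots> = (\<Sum>\<delta>\<in>A. etaI \<beta> \<delta> * (\<Sum>\<gamma>\<in>A. etaI \<alpha> \<gamma> * ?g \<gamma> \<delta>))"
    using eta_sym by (simp add: sum_distrib_left mult_ac)
  also have "\<dots> = (\<Sum>\<delta>\<in>A. etaI \<beta> \<delta> * (if \<alpha> = \<delta> then 1 else 0))"
    using assms by (intro sum.cong refl) (simp add: etaI_left)
  also have "\<dots> = (\<Sum>\<delta>\<in>A. if \<alpha> = \<delta> then etaI \<beta> \<delta> else 0)" by (intro sum.cong) auto
  also have "\<dots> = etaI \<beta> \<alpha>" using assms finite_A by simp
  finally show ?thesis using 1 by simp
qed

lemma (in stable) mset_half_edge_list:
  "mset (half_edge_list n \<Gamma> v) = mset_set (half_edges n \<Gamma> v)"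
proof -
  have "finite {w. {v, w} \<in> edges \<Gamma>}"
    using finite_V edge_verts by (auto intro: finite_subset[of _ "verts \<Gamma>"])
  then have "set (half_edge_list n \<Gamma> v) = half_edges n \<Gamma> v" "distinct (half_edge_list n \<Gamma> v)"
    by (auto simp: half_edge_list_def half_edges_def distinct_map inj_on_def)
  then show ?thesis using mset_set_set by metis
qed

text \<open>The half-edges that belong to edges, in the indexing of the assignments summed over in a weight.\<close>

definition half_pairs :: "stree \<Rightarrow> (nat \<times> nat) set" where
  "half_pairs \<Gamma> = {(v, w). {v, w} \<in> edges \<Gamma>}"

text \<open>
  The weight does not depend on the numbering of the vertices: the order of the two halves of an
  edge and of the half-edges at a vertex is immaterial by the symmetry of \<open>etaI\<close> and \<open>x\<close>.
\<close>

lemma (in stable_iso) weight_iso: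
  fixes etaI :: "'a \<Rightarrow> 'a \<Rightarrow> 'k::comm_semiring_1"
  assumes \<alpha>: "\<alpha> \<in> lists A" "length \<alpha> = n"
    and sym: "\<And>a b. a \<in> A \<Longrightarrow> b \<in> A \<Longrightarrow> etaI a b = etaI b a"
    and x: "\<And>\<beta> \<gamma>. \<beta> \<in> lists A \<Longrightarrow> \<gamma> \<in> lists A \<Longrightarrow> 3 \<le> length \<beta> \<Longrightarrow> mset \<beta> = mset \<gamma> \<Longrightarrow> x \<beta> = x \<gamma>"
  shows "weight A etaI x \<alpha> \<Gamma>' = weight A etaI x \<alpha> \<Gamma>"
proof -
  interpret t: stable n \<Gamma>' using stable_iso by unfold_locales
  let ?F = "half_pairs \<Gamma>" and ?F' = "half_pairs \<Gamma>'"
  let ?m = "map_prod \<phi> \<phi>"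
  let ?term = "\<lambda>\<Gamma> \<beta>. (\<Prod>a\<in>edges \<Gamma>. etaI (\<beta> (Min a, Max a)) (\<beta> (Max a, Min a))) *
        (\<Prod>v\<in>verts \<Gamma>. x (map (colour \<alpha> \<beta>) (half_edge_list n \<Gamma> v)))"
  have inj_m: "inj_on ?m ?F"
    using inj edge_verts by (auto simp: half_pairs_def inj_on_def)
  have im_m: "?m ` ?F = ?F'"
  proof (intro equalityI subsetI)
    fix z assume "z \<in> ?m ` ?F"
    then show "z \<in> ?F'" using edge_iso_iff edge_verts by (auto simp: half_pairs_def)
  next
    fix z assume "z \<in> ?F'"
    then obtain a b where z: "z = (a, b)" "{a, b} \<in> edges \<Gamma>'" by (auto simp: half_pairs_def)
    obtain p q where "{p, q} \<in> edges \<Gamma>" "a = \<phi> p" "b = \<phi> q" using z(2) by (rule edge_iso_obtain)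
    then show "z \<in> ?m ` ?F"
      using z(1) by (intro image_eqI[of _ _ "(p, q)"]) (auto simp: half_pairs_def)
  qed
  let ?g = "inv_into ?F ?m"
  have gm: "?g (?m z) = z" if "z \<in> ?F" for z using inj_m that by simp
  have mg: "?m (?g z) = z" "?g z \<in> ?F" if "z \<in> ?F'" for z
    using that im_m f_inv_into_f inv_into_into by metis+
  have mF: "?m z \<in> ?F'" if "z \<in> ?F" for z using that im_m by blast
  have edge_factor: "etaI (\<beta> (Min a, Max a)) (\<beta> (Max a, Min a)) = etaI (\<beta> (p, q)) (\<beta> (q, p))"
    if "a = {p, q}" "\<beta> (p, q) \<in> A" "\<beta> (q, p) \<in> A" for a p q \<beta>
    using that sym by (cases p q rule: le_cases) (auto simp: min_def max_def)
  have term_eq: "?term \<Gamma> (restrict (\<beta> \<circ> ?m) ?F) = ?term \<Gamma>' \<beta>" if \<beta>: "\<beta> \<in> ?F' \<rightarrow>\<^sub>E A" for \<beta>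
  proof -
    let ?\<beta> = "restrict (\<beta> \<circ> ?m) ?F"
    have \<beta>A: "\<beta> (v, w) \<in> A" if "{v, w} \<in> edges \<Gamma>'" for v w
      using that \<beta> by (auto simp: half_pairs_def)
    have \<beta>': "?\<beta> (v, w) = \<beta> (\<phi> v, \<phi> w)" "?\<beta> (w, v) = \<beta> (\<phi> w, \<phi> v)" "?\<beta> (v, w) \<in> A" "?\<beta> (w, v) \<in> A"
      if "{v, w} \<in> edges \<Gamma>" for v w
    proof -
      have "{w, v} \<in> edges \<Gamma>" using that by (simp add: insert_commute)
      then show "?\<beta> (v, w) = \<beta> (\<phi> v, \<phi> w)" "?\<beta> (w, v) = \<beta> (\<phi> w, \<phi> v)" "?\<beta> (v, w) \<in> A" "?\<beta> (w, v) \<in> A"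
        using that \<beta>A[of "\<phi> v" "\<phi> w"] \<beta>A[of "\<phi> w" "\<phi> v"] edge_iso_iff edge_verts
        by (simp_all add: half_pairs_def)
    qed
    have "(\<Prod>a\<in>edges \<Gamma>'. etaI (\<beta> (Min a, Max a)) (\<beta> (Max a, Min a))) =
        (\<Prod>a\<in>edges \<Gamma>. etaI (\<beta> (Min (\<phi> ` a), Max (\<phi> ` a))) (\<beta> (Max (\<phi> ` a), Min (\<phi> ` a))))"
      unfolding edges_iso by (subst prod.reindex[OF inj_edges]) (simp add: comp_def)
    also have "\<dots> = (\<Prod>a\<in>edges \<Gamma>. etaI (?\<beta> (Min a, Max a)) (?\<beta> (Max a, Min a)))"
    proof (rule prod.cong)
      fix a assume a: "a \<in> edges \<Gamma>"
      then obtain p q where pq: "a = {p, q}" by (rule edge_obtain)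
      have pqE: "{p, q} \<in> edges \<Gamma>" using a pq by simp
      have "etaI (?\<beta> (Min a, Max a)) (?\<beta> (Max a, Min a)) = etaI (?\<beta> (p, q)) (?\<beta> (q, p))"
        using \<beta>'(3,4)[OF pqE] pq by (intro edge_factor)
      moreover have "etaI (\<beta> (Min (\<phi> ` a), Max (\<phi> ` a))) (\<beta> (Max (\<phi> ` a), Min (\<phi> ` a))) =
          etaI (\<beta> (\<phi> p, \<phi> q)) (\<beta> (\<phi> q, \<phi> p))"
        using \<beta>'[OF pqE] pq by (intro edge_factor) auto
      ultimately show "etaI (\<beta> (Min (\<phi> ` a), Max (\<phi> ` a))) (\<beta> (Max (\<phi> ` a), Min (\<phi> ` a))) =
          etaI (?\<beta> (Min a, Max a)) (?\<beta> (Max a, Min a))"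
        using \<beta>'(1,2)[OF pqE] by metis
    qed simp
    finally have edges: "(\<Prod>a\<in>edges \<Gamma>'. etaI (\<beta> (Min a, Max a)) (\<beta> (Max a, Min a))) = \<dots>" .
    have "(\<Prod>v\<in>verts \<Gamma>'. x (map (colour \<alpha> \<beta>) (half_edge_list n \<Gamma>' v))) =
        (\<Prod>v\<in>verts \<Gamma>. x (map (colour \<alpha> \<beta>) (half_edge_list n \<Gamma>' (\<phi> v))))"
      unfolding verts_iso by (subst prod.reindex[OF inj]) (simp add: comp_def)
    also have "\<dots> = (\<Prod>v\<in>verts \<Gamma>. x (map (colour \<alpha> ?\<beta>) (half_edge_list n \<Gamma> v)))"
    proof (rule prod.cong)
      fix v assume v: "v \<in> verts \<Gamma>"
      have col: "colour \<alpha> \<beta> (map_half \<phi> h) = colour \<alpha> ?\<beta> h" "colour \<alpha> ?\<beta> h \<in> A"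
        if "h \<in> half_edges n \<Gamma> v" for h
        using that \<beta>' \<alpha> by (cases h; auto simp: in_lists_conv_set)+
      have "mset (map (colour \<alpha> \<beta>) (half_edge_list n \<Gamma>' (\<phi> v))) =
          image_mset (colour \<alpha> \<beta>) (image_mset (map_half \<phi>) (mset_set (half_edges n \<Gamma> v)))"
        using half_edges_iso[OF v] image_mset_mset_set[OF inj_on_map_half]
        by (simp add: t.mset_half_edge_list)
      also have "\<dots> = image_mset (colour \<alpha> ?\<beta>) (mset_set (half_edges n \<Gamma> v))"
        using col(1) finite_half_edges by (auto simp: multiset.map_comp intro: image_mset_cong)
      finally have m: "mset (map (colour \<alpha> \<beta>) (half_edge_list n \<Gamma>' (\<phi> v))) =
          mset (map (colour \<alpha> ?\<beta>) (half_edge_list n \<Gamma> v))"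
        by (simp add: mset_half_edge_list)
      have "set (half_edge_list n \<Gamma> v) = half_edges n \<Gamma> v"
        by (metis finite_half_edges finite_set_mset_mset_set mset_half_edge_list set_mset_mset)
      then have "set (map (colour \<alpha> ?\<beta>) (half_edge_list n \<Gamma> v)) \<subseteq> A"
        using col(2) by auto
      moreover have "set (map (colour \<alpha> \<beta>) (half_edge_list n \<Gamma>' (\<phi> v))) =
          set (map (colour \<alpha> ?\<beta>) (half_edge_list n \<Gamma> v))"
        using m by (rule mset_eq_setD)
      moreover have "length (half_edge_list n \<Gamma>' (\<phi> v)) = card (half_edges n \<Gamma>' (\<phi> v))"
        by (metis size_mset size_mset_set t.mset_half_edge_list)
      moreover have "3 \<le> card (half_edges n \<Gamma>' (\<phi> v))"
        using v by (intro t.card_half_edges) (simp add: verts_iso)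
      ultimately show "x (map (colour \<alpha> \<beta>) (half_edge_list n \<Gamma>' (\<phi> v))) =
          x (map (colour \<alpha> ?\<beta>) (half_edge_list n \<Gamma> v))"
        using m by (intro x) (auto simp: lists_eq_set)
    qed simp
    finally show ?thesis using edges by simp
  qed
  have "weight A etaI x \<alpha> \<Gamma>' = (\<Sum>\<beta> \<in> ?F' \<rightarrow>\<^sub>E A. ?term \<Gamma>' \<beta>)"
    by (simp add: weight_def half_pairs_def \<alpha>(2))
  also have "\<dots> = (\<Sum>\<beta> \<in> ?F \<rightarrow>\<^sub>E A. ?term \<Gamma> \<beta>)"
  proof (rule sum.reindex_bij_witness[where i = "\<lambda>\<beta>. restrict (\<beta> \<circ> ?g) ?F'" and
        j = "\<lambda>\<beta>. restrict (\<beta> \<circ> ?m) ?F"])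
    fix \<beta> assume \<beta>: "\<beta> \<in> ?F' \<rightarrow>\<^sub>E A"
    show "restrict (\<beta> \<circ> ?m) ?F \<in> ?F \<rightarrow>\<^sub>E A"
      unfolding restrict_PiE_iff comp_apply by (intro ballI PiE_mem[OF \<beta>] mF)
    have "restrict (restrict (\<beta> \<circ> ?m) ?F \<circ> ?g) ?F' z = \<beta> z" for z
      using mg[of z] PiE_arb[OF \<beta>, of z] by (cases "z \<in> ?F'") (simp_all del: map_prod_simp)
    then show "restrict (restrict (\<beta> \<circ> ?m) ?F \<circ> ?g) ?F' = \<beta>" by blast
    show "?term \<Gamma> (restrict (\<beta> \<circ> ?m) ?F) = ?term \<Gamma>' \<beta>" by (rule term_eq[OF \<beta>])
  next
    fix \<beta> assume \<beta>: "\<beta> \<in> ?F \<rightarrow>\<^sub>E A"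
    show "restrict (\<beta> \<circ> ?g) ?F' \<in> ?F' \<rightarrow>\<^sub>E A"
      unfolding restrict_PiE_iff comp_apply by (intro ballI PiE_mem[OF \<beta>] mg(2))
    have "restrict (restrict (\<beta> \<circ> ?g) ?F' \<circ> ?m) ?F z = \<beta> z" for z
      using gm[of z] mF[of z] PiE_arb[OF \<beta>, of z] by (cases "z \<in> ?F") (simp_all del: map_prod_simp)
    then show "restrict (restrict (\<beta> \<circ> ?g) ?F' \<circ> ?m) ?F = \<beta>" by blast
  qed
  also have "\<dots> = weight A etaI x \<alpha> \<Gamma>"
    by (simp add: weight_def half_pairs_def \<alpha>(2))
  finally show ?thesis .
qed

section \<open>Relations at one vertex\<close>

text \<open>
  Here \<open>H\<close> plays the role of the half-edges at a vertex, \<open>r\<close> that of the one leading to the root, and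
  \<open>W S\<close> is the weight of the splitting with \<open>S\<close> on one side. Both sums in the WDVV relation are
  expressed through the sums \<open>F a b\<close> over the sets containing \<open>a\<close> and \<open>b\<close> but not \<open>r\<close>, up to a
  correction that is symmetric in \<open>a, b, c, f\<close>.
\<close>

lemma wdvv_iff_constant_pairs:
  fixes W :: "'h set \<Rightarrow> 'k::comm_ring_1"
  assumes H: "finite H" "r \<in> H" and W: "\<And>S. S \<subseteq> H \<Longrightarrow> W (H - S) = W S"
  defines "F \<equiv> \<lambda>a b. \<Sum>S | S \<subseteq> H - {r} \<and> a \<in> S \<and> b \<in> S. W S"
    and "N \<equiv> \<lambda>a b c f. \<Sum>S | S \<subseteq> H \<and> a \<in> S \<and> b \<in> S \<and> c \<notin> S \<and> f \<notin> S. W S"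
  shows "(\<exists>c. \<forall>a\<in>H - {r}. \<forall>b\<in>H - {r}. a \<noteq> b \<longrightarrow> F a b = c) \<longleftrightarrow>
    (\<forall>a b c f. {a, b, c, f} \<subseteq> H \<longrightarrow> distinct [a, b, c, f] \<longrightarrow> N a b c f = N a f b c)"
proof -
  let ?P = "Pow (H - {r})"
  have fin: "finite ?P" using H by simp
  have F: "F a b = (\<Sum>S\<in>?P. W S * of_bool (a \<in> S \<and> b \<in> S))" for a b
    unfolding F_def using fin by (intro sum.mono_neutral_cong_left) auto
  have N: "N a b c f = (\<Sum>S\<in>?P. W S * (of_bool (a \<in> S \<and> b \<in> S \<and> c \<notin> S \<and> f \<notin> S) +
      of_bool (c \<in> S \<and> f \<in> S \<and> a \<notin> S \<and> b \<notin> S)))" if "{a, b, c, f} \<subseteq> H" for a b c f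
  proof -
    let ?w = "\<lambda>S. W S * of_bool (a \<in> S \<and> b \<in> S \<and> c \<notin> S \<and> f \<notin> S)"
    have "N a b c f = (\<Sum>S\<in>Pow H. ?w S)"
      unfolding N_def using H by (intro sum.mono_neutral_cong_left) auto
    \<comment> \<open>The sets containing \<open>r\<close> are replaced by their complements.\<close>
    also have "Pow H = ?P \<union> (\<lambda>S. H - S) ` ?P"
    proof (intro equalityI subsetI)
      fix S assume S: "S \<in> Pow H"
      then show "S \<in> ?P \<union> (\<lambda>S. H - S) ` ?P"
        by (cases "r \<in> S") (auto intro!: image_eqI[of _ _ "H - S"])
    qed (use H in auto)
    also have "(\<Sum>S\<in>?P \<union> (\<lambda>S. H - S) ` ?P. ?w S) = (\<Sum>S\<in>?P. ?w S) + (\<Sum>S\<in>(\<lambda>S. H - S) ` ?P. ?w S)"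
      using fin H by (intro sum.union_disjoint) auto
    also have "(\<Sum>S\<in>(\<lambda>S. H - S) ` ?P. ?w S) = (\<Sum>S\<in>?P. ?w (H - S))"
      by (subst sum.reindex) (auto simp: inj_on_def)
    also have "\<dots> = (\<Sum>S\<in>?P. W S * of_bool (c \<in> S \<and> f \<in> S \<and> a \<notin> S \<and> b \<notin> S))"
    proof (rule sum.cong)
      fix S assume "S \<in> ?P"
      then have "W (H - S) = W S" by (intro W) auto
      then show "?w (H - S) = W S * of_bool (c \<in> S \<and> f \<in> S \<and> a \<notin> S \<and> b \<notin> S)"
        using that by auto
    qed simp
    finally show ?thesis by (simp add: sum.distrib distrib_left)
  qed
  have NF: "N a b c f - N a f b c = (F a b + F c f) - (F a f + F b c)" if "{a, b, c, f} \<subseteq> H" for a b c f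
  proof -
    have "{a, f, b, c} \<subseteq> H" using that by auto
    note N' = N[OF this]
    show ?thesis
      unfolding N[OF that] N' F sum.distrib[symmetric] sum_subtractf[symmetric]
      by (intro sum.cong) auto
  qed
  have F0: "F a b = 0" if "a = r \<or> b = r" for a b
    unfolding F using that by (intro sum.neutral) auto
  have comm: "F a b = F b a" for a b unfolding F_def by (simp add: conj_commute)
  show ?thesis
  proof (intro iffI allI impI)
    fix a b c f
    assume "\<exists>c. \<forall>a\<in>H - {r}. \<forall>b\<in>H - {r}. a \<noteq> b \<longrightarrow> F a b = c"
    then obtain C where C: "\<And>a b. a \<in> H - {r} \<Longrightarrow> b \<in> H - {r} \<Longrightarrow> a \<noteq> b \<Longrightarrow> F a b = C" by blast
    assume abcf: "{a, b, c, f} \<subseteq> H" "distinct [a, b, c, f]"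
    have "F a b + F c f = F a f + F b c"
      using C[of a b] C[of c f] C[of a f] C[of b c] F0 abcf
      by (cases "r \<in> {a, b, c, f}") auto
    then show "N a b c f = N a f b c" using NF[OF abcf(1)] by simp
  next
    assume *: "\<forall>a b c f. {a, b, c, f} \<subseteq> H \<longrightarrow> distinct [a, b, c, f] \<longrightarrow> N a b c f = N a f b c"
    have step: "F h g = F h l" if "h \<in> H - {r}" "g \<in> H - {r}" "l \<in> H - {r}" "h \<noteq> g" "h \<noteq> l" for h g l
    proof (cases "g = l")
      case False
      then have "N h g r l = N h l g r" using * that H by auto
      then show ?thesis using NF[of h g r l] F0 that H by simp
    qed simp
    show "\<exists>c. \<forall>a\<in>H - {r}. \<forall>b\<in>H - {r}. a \<noteq> b \<longrightarrow> F a b = c"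
    proof (cases "\<exists>a\<in>H - {r}. \<exists>b\<in>H - {r}. a \<noteq> b")
      case True
      then obtain a b where ab: "a \<in> H - {r}" "b \<in> H - {r}" "a \<noteq> b" by blast
      have "F p q = F a b" if "p \<in> H - {r}" "q \<in> H - {r}" "p \<noteq> q" for p q
      proof (cases "p = a")
        case True
        then show ?thesis using step[of a q b] ab that by simp
      next
        case False
        then have "F p q = F p a" using step[of p q a] ab that by simp
        also have "\<dots> = F a p" by (rule comm)
        also have "\<dots> = F a b" using step[of a p b] ab that False by simp
        finally show ?thesis .
      qed
      then show ?thesis by blast
    qed blast
  qed
qed

section \<open>The linear span of a cone\<close>

lemma sum_fun_apply: "(\<Sum>i\<in>I. f i) q = (\<Sum>i\<in>I. f i q)"
  for f :: "'i \<Rightarrow> 'b \<Rightarrow> 'c::comm_monoid_add"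
  by (induction I rule: infinite_finite_induct) auto

lemma v_vec_apply:
  assumes "finite I"
  shows "v_vec I q = of_bool (q \<subseteq> I \<and> card q = 2)"
proof -
  have "finite {p. p \<subseteq> I \<and> card p = 2}" using assms by simp
  then show ?thesis
    unfolding v_vec_def sum_fun_apply r_vec_def by simp
qed

lemma v_vec_singleton: "v_vec {i} = 0"
proof
  fix q :: "nat set"
  have "card q \<le> 1" if "q \<subseteq> {i}" using card_mono[OF _ that] by simp
  then show "v_vec {i} q = 0 q" by (auto simp: v_vec_apply)
qed

interpretation Q: vector_space scaleQ
  by (rule vector_space_scaleQ)

context rooted_stable
begin

text \<open>
  For a set \<open>S\<close> of half-edges at one vertex that lead away from the root, the vector \<open>\<rho> S\<close> is the
  sum of all \<open>r_vec {i, j}\<close> where \<open>i\<close> and \<open>j\<close> lie beyond different half-edges in \<open>S\<close>.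
\<close>

definition \<rho> :: "half_edge set \<Rightarrow> nat set \<Rightarrow> 'k::field" where
  "\<rho> S = v_vec (\<Union> (L ` S)) - (\<Sum>h\<in>S. v_vec (L h))"

abbreviation cone_span :: "(nat set \<Rightarrow> 'k::field) set" where
  "cone_span \<equiv> Q.span (v_vec ` D ` verts \<Gamma>)"

lemma finite_beyond: "h \<in> C v \<Longrightarrow> finite (L h)"
  by (rule finite_subset[OF beyond_subset[OF children_half_edge]]) auto

lemma beyond_in_span: "h \<in> C v \<Longrightarrow> v_vec (L h) \<in> cone_span"
  using beyond_child[of h v] by (auto simp: is_singleton_def v_vec_singleton Q.span_zero intro: Q.span_base)

lemma rho_median:
  assumes m: "is_median v h h' i j" and S: "S \<subseteq> C w"
  shows "\<rho> S {i, j} = of_bool (w = v \<and> h \<in> S \<and> h' \<in> S)"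
proof -
  have finS: "finite S" using S finite_children finite_subset by blast
  have finL: "finite (L g)" if "g \<in> S" for g using that S finite_beyond by blast
  have "i \<noteq> j"
    using m beyond_unique[of h v h' i] by (auto simp: is_median_def children_def)
  then have card: "card {i, j} = 2" by simp
  have val: "\<rho> S {i, j} = of_bool ({i, j} \<subseteq> \<Union> (L ` S)) - (\<Sum>g\<in>S. of_bool ({i, j} \<subseteq> L g))"
    unfolding \<rho>_def fun_diff_def sum_fun_apply
    using finS finL card by (simp add: v_vec_apply)
  have uniq: "g = g'" if "g \<in> S" "g' \<in> S" "z \<in> L g" "z \<in> L g'" for g g' z
    using that S beyond_unique[of g w g' z] children_half_edge by blast
  show ?thesis
  proof (cases "\<exists>g\<in>S. {i, j} \<subseteq> L g")
    case True
    then obtain g where g: "g \<in> S" "i \<in> L g" "j \<in> L g" by auto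
    have "(\<Sum>g'\<in>S. of_bool ({i, j} \<subseteq> L g')) = (\<Sum>g'\<in>S. if g' = g then 1 else 0 :: 'a)"
      using uniq g by (intro sum.cong) auto
    then have "\<rho> S {i, j} = (0 :: 'a)"
      using g finS unfolding val by auto
    moreover have "\<not> (w = v \<and> h \<in> S \<and> h' \<in> S)"
      using uniq[of h g i] uniq[of h' g j] g m by (auto simp: is_median_def)
    ultimately show ?thesis by simp
  next
    case False
    then have "(\<Sum>g\<in>S. of_bool ({i, j} \<subseteq> L g)) = (0 :: 'a)" by (intro sum.neutral) auto
    moreover have "{i, j} \<subseteq> \<Union> (L ` S) \<longleftrightarrow> w = v \<and> h \<in> S \<and> h' \<in> S"
    proof
      assume "{i, j} \<subseteq> \<Union> (L ` S)"
      then obtain g g' where g: "g \<in> S" "i \<in> L g" "g' \<in> S" "j \<in> L g'" by auto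
      then have "g \<noteq> g'" using False by auto
      moreover have "w \<in> verts \<Gamma>"
        using g S children_half_edge[of g w] leg_vert edge_verts by (cases g) auto
      ultimately have "is_median w g g' i j" using g S by (auto simp: is_median_def)
      then show "w = v \<and> h \<in> S \<and> h' \<in> S" using median_unique[OF m] g by blast
    qed (use m in \<open>auto simp: is_median_def\<close>)
    ultimately show ?thesis unfolding val by simp
  qed
qed

lemma rho_not_pair:
  assumes S: "S \<subseteq> C w" and q: "\<not> (q \<subseteq> {1..n} - {k} \<and> card q = 2)"
  shows "\<rho> S q = 0"
proof -
  have finS: "finite S" using S finite_children finite_subset by blast
  have sub: "L g \<subseteq> {1..n} - {k}" "finite (L g)" if "g \<in> S" for g
    using that S beyond_subset children_half_edge[of g w] finite_beyond by (auto simp: children_def)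
  have zero: "v_vec X q = (0 :: 'a)" if "X \<subseteq> {1..n} - {k}" for X
    using that q finite_subset[OF that] by (auto simp: v_vec_apply)
  have "\<Union> (L ` S) \<subseteq> {1..n} - {k}" using sub(1) by blast
  then show ?thesis
    unfolding \<rho>_def fun_diff_def sum_fun_apply using zero sub(1) by simp
qed

text \<open>By \<open>median_least\<close>, each generator takes equal values at all pairs with the same median.\<close>

lemma span_constant:
  assumes "f \<in> (cone_span :: (nat set \<Rightarrow> 'k::field) set)"
    and "is_median v h h' i j" "is_median v g g' i' j'"
  shows "f {i, j} = f {i', j'}"
proof -
  let ?U = "{f :: nat set \<Rightarrow> 'k. f {i, j} = f {i', j'}}"
  have "Q.subspace ?U" by (auto simp: Q.subspace_def scaleQ_def)
  moreover have "v_vec ` D ` verts \<Gamma> \<subseteq> ?U"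
  proof clarify
    fix v' assume v': "v' \<in> verts \<Gamma>"
    have "v \<in> verts \<Gamma>" using assms(2) by (simp add: is_median_def)
    have "{i, j} \<subseteq> D v' \<longleftrightarrow> D v \<subseteq> D v'"
      using median_least[OF assms(2) v'] median_in_desc[OF assms(2)] by blast
    moreover have "{i', j'} \<subseteq> D v' \<longleftrightarrow> D v \<subseteq> D v'"
      using median_least[OF assms(3) v'] median_in_desc[OF assms(3)] by blast
    moreover have "i \<noteq> j" "i' \<noteq> j'"
      using assms(2,3) beyond_unique[of h v h' i] beyond_unique[of g v g' i']
      by (auto simp: is_median_def children_def)
    moreover have "finite (D v')" using desc_subset[OF v'] finite_subset by blast
    ultimately show "v_vec (D v') {i, j} = (v_vec (D v') {i', j'} :: 'k)" by (simp add: v_vec_apply)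
  qed
  ultimately have "cone_span \<subseteq> ?U" by (intro Q.span_minimal)
  then show ?thesis using assms(1) by blast
qed

text \<open>
  A combination of the vectors attached to sets of half-edges lies in the span of the cone iff, at
  each vertex, the sum of the coefficients of the sets that contain two given half-edges is the
  same for all pairs of half-edges. Modulo the span, this sum is the coordinate at the pairs of legs
  beyond the two half-edges.
\<close>

lemma combination_in_span_iff:
  fixes W :: "nat \<Rightarrow> half_edge set \<Rightarrow> 'k::field"
  shows "(\<Sum>v\<in>verts \<Gamma>. \<Sum>S\<in>Pow (C v). scaleQ (W v S) (v_vec (\<Union> (L ` S)))) \<in> cone_span \<longleftrightarrow>
    (\<forall>v\<in>verts \<Gamma>. \<exists>c. \<forall>a\<in>C v. \<forall>b\<in>C v. a \<noteq> b \<longrightarrow> (\<Sum>S | S \<subseteq> C v \<and> a \<in> S \<and> b \<in> S. W v S) = c)"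
    (is "?w \<in> _ \<longleftrightarrow> (\<forall>v\<in>_. \<exists>c. \<forall>a\<in>_. \<forall>b\<in>_. _ \<longrightarrow> ?F v a b = c)")
proof -
  \<comment> \<open>Each \<open>v_vec (L h)\<close> is a generator or zero, so the vectors may be replaced by the \<open>\<rho> S\<close>,
    whose values at pairs with different medians do not interfere.\<close>
  define g where "g = (\<Sum>v\<in>verts \<Gamma>. \<Sum>S\<in>Pow (C v). scaleQ (W v S) (\<rho> S))"
  have vI: "v_vec (\<Union> (L ` S)) = \<rho> S + (\<Sum>h\<in>S. v_vec (L h) :: nat set \<Rightarrow> 'k)" for S
    by (simp add: \<rho>_def)
  have beyond_sum: "(\<Sum>h\<in>S. v_vec (L h)) \<in> (cone_span :: (nat set \<Rightarrow> 'k) set)" if "S \<subseteq> C v" for S v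
    using that by (intro Q.span_sum beyond_in_span) auto
  have "?w - g = (\<Sum>v\<in>verts \<Gamma>. \<Sum>S\<in>Pow (C v). scaleQ (W v S) (\<Sum>h\<in>S. v_vec (L h)))"
    unfolding g_def vI by (simp add: Q.scale_right_distrib sum.distrib)
  then have "?w - g \<in> cone_span"
    by (auto intro!: Q.span_sum Q.span_scale beyond_sum)
  then have w_g: "?w \<in> cone_span \<longleftrightarrow> g \<in> cone_span"
    using Q.span_add[of g _ "?w - g"] Q.span_diff[of ?w _ "?w - g"] by fastforce
  have g_median: "g {i, j} = ?F v h h'" if m: "is_median v h h' i j" for v h h' i j
  proof -
    have v: "v \<in> verts \<Gamma>" using m by (simp add: is_median_def)
    have "g {i, j} = (\<Sum>w\<in>verts \<Gamma>. \<Sum>S\<in>Pow (C w). W w S * of_bool (w = v \<and> h \<in> S \<and> h' \<in> S))"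
      unfolding g_def sum_fun_apply scaleQ_def
      by (intro sum.cong refl) (simp add: rho_median[OF m])
    also have "\<dots> = (\<Sum>w\<in>verts \<Gamma>. if w = v then ?F v h h' else 0)"
    proof (intro sum.cong refl)
      fix w
      have "(\<Sum>S\<in>Pow (C v). W v S * of_bool (h \<in> S \<and> h' \<in> S)) = ?F v h h'"
        using finite_children by (intro sum.mono_neutral_cong_right) auto
      then show "(\<Sum>S\<in>Pow (C w). W w S * of_bool (w = v \<and> h \<in> S \<and> h' \<in> S)) =
          (if w = v then ?F v h h' else 0)" by simp
    qed
    also have "\<dots> = ?F v h h'" using v finite_V by simp
    finally show ?thesis .
  qed
  show ?thesis
  proof
    assume "?w \<in> cone_span"
    then have g: "g \<in> cone_span" using w_g by simp
    show "\<forall>v\<in>verts \<Gamma>. \<exists>c. \<forall>a\<in>C v. \<forall>b\<in>C v. a \<noteq> b \<longrightarrow> ?F v a b = c"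
    proof
      fix v assume v: "v \<in> verts \<Gamma>"
      have med: "\<exists>i j. is_median v a b i j" if "a \<in> C v" "b \<in> C v" "a \<noteq> b" for a b
        using that v beyond_nonempty[of a v] beyond_nonempty[of b v]
        by (auto simp: is_median_def dest: children_half_edge)
      have "?F v a b = ?F v a' b'"
        if ab: "a \<in> C v" "b \<in> C v" "a \<noteq> b" "a' \<in> C v" "b' \<in> C v" "a' \<noteq> b'" for a b a' b'
      proof -
        obtain i j where ij: "is_median v a b i j" using med[OF ab(1-3)] by blast
        obtain i' j' where ij': "is_median v a' b' i' j'" using med[OF ab(4-6)] by blast
        show ?thesis
          using span_constant[OF g ij ij'] unfolding g_median[OF ij] g_median[OF ij'] .
      qed
      then show "\<exists>c. \<forall>a\<in>C v. \<forall>b\<in>C v. a \<noteq> b \<longrightarrow> ?F v a b = c" by blast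
    qed
  next
    assume "\<forall>v\<in>verts \<Gamma>. \<exists>c. \<forall>a\<in>C v. \<forall>b\<in>C v. a \<noteq> b \<longrightarrow> ?F v a b = c"
    then obtain c where c: "\<And>v a b. v \<in> verts \<Gamma> \<Longrightarrow> a \<in> C v \<Longrightarrow> b \<in> C v \<Longrightarrow> a \<noteq> b \<Longrightarrow> ?F v a b = c v"
      by metis
    have "g = (\<Sum>v\<in>verts \<Gamma>. scaleQ (c v) (\<rho> (C v)))"
    proof
      fix q
      show "g q = (\<Sum>v\<in>verts \<Gamma>. scaleQ (c v) (\<rho> (C v))) q"
      proof (cases "q \<subseteq> {1..n} - {k} \<and> card q = 2")
        case True
        then obtain i j where ij: "q = {i, j}" "i \<noteq> j" by (auto simp: card_2_iff)
        then obtain v h h' where m: "is_median v h h' i j"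
          using True median_ex[of i j] by auto
        have "(\<Sum>v\<in>verts \<Gamma>. scaleQ (c v) (\<rho> (C v))) q =
            (\<Sum>w\<in>verts \<Gamma>. c w * of_bool (w = v \<and> h \<in> C w \<and> h' \<in> C w))"
          unfolding sum_fun_apply scaleQ_def ij(1)
          by (intro sum.cong refl) (simp add: rho_median[OF m order_refl])
        also have "\<dots> = (\<Sum>w\<in>verts \<Gamma>. if w = v then c v else 0)"
          using m by (intro sum.cong) (auto simp: is_median_def)
        also have "\<dots> = c v" using m finite_V by (simp add: is_median_def)
        finally show ?thesis
          using g_median[OF m] c[of v h h'] m ij(1) by (simp add: is_median_def)
      next
        case False
        have "g q = 0"
          unfolding g_def sum_fun_apply scaleQ_def
          by (intro sum.neutral ballI) (simp add: rho_not_pair[OF _ False])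
        moreover have "(\<Sum>v\<in>verts \<Gamma>. scaleQ (c v) (\<rho> (C v))) q = 0"
          unfolding sum_fun_apply scaleQ_def
          by (intro sum.neutral ballI) (simp add: rho_not_pair[OF order_refl False])
        ultimately show ?thesis by simp
      qed
    qed
    moreover have "\<rho> (C v) \<in> (cone_span :: (nat set \<Rightarrow> 'k) set)" if "v \<in> verts \<Gamma>" for v
      unfolding \<rho>_def desc_def[symmetric] using that beyond_sum[of "C v" v]
      by (intro Q.span_diff) (auto intro: Q.span_base)
    ultimately have "g \<in> cone_span"
      by (auto intro!: Q.span_sum Q.span_scale)
    then show "?w \<in> cone_span" using w_g by simp
  qed
qed

end

section \<open>The star of a cone\<close>

context rooted_stable
begin

text \<open>
  The stable splittings of the tree: a vertex, and the half-edges at it that are moved to the new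
  vertex, all of them leading away from the root.
\<close>

definition splittings :: "(nat \<times> half_edge set) set" where
  "splittings = {(v, S). v \<in> verts \<Gamma> \<and> S \<subseteq> C v \<and> 2 \<le> card S \<and> 2 \<le> card (H v - S)}"

lemma splitting_stable:
  assumes "(v, S) \<in> splittings"
  shows "stable_tree n (split_vertex \<Gamma> v S)"
proof -
  interpret s: vertex_split n \<Gamma> v S
    using assms by unfold_locales (auto simp: splittings_def children_def)
  show ?thesis using assms s.stable_T_iff by (simp add: splittings_def)
qed

lemma far_sides_splitting:
  assumes vS: "(v, S) \<in> splittings"
  defines "T \<equiv> split_vertex \<Gamma> v S" and "a \<equiv> {v, Suc (Max (verts \<Gamma>))}"
  shows "far_side n k T a = \<Union> (L ` S)" "a \<in> edges T" "tree_iso n \<Gamma> (contract a T)"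
    "far_side n k \<Gamma> ` edges \<Gamma> = far_side n k T ` edges T - {\<Union> (L ` S)}"
proof -
  interpret s: vertex_split n \<Gamma> v S
    using assms by unfold_locales (auto simp: splittings_def children_def)
  interpret t: rooted_stable n T k
    using splitting_stable[OF vS] k by unfold_locales (simp_all add: T_def)
  have a: "a = {v, s.u}" by (simp add: a_def s.u_def)
  have "k \<notin> \<Union> (L ` S)" using vS by (auto simp: splittings_def children_def)
  then show far: "far_side n k T a = \<Union> (L ` S)"
    unfolding a T_def s.beyond_new_edge[symmetric]
    by (intro t.far_side_eq[unfolded T_def] s.new_edge)
  show aE: "a \<in> edges T" unfolding a T_def by (rule s.new_edge)
  show iso: "tree_iso n \<Gamma> (contract a T)" unfolding a T_def by (rule s.contract_T)
  show "far_side n k \<Gamma> ` edges \<Gamma> = far_side n k T ` edges T - {\<Union> (L ` S)}"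
    using tree_iso_far_sides[OF stable iso k] t.far_sides_contract[OF aE] far by simp
qed

text \<open>
  The legs beyond \<open>S\<close> determine the splitting: \<open>v\<close> is the lowest vertex that has all of them below
  it, because \<open>S\<close> has at least two elements.
\<close>

lemma splitting_determined:
  assumes vS: "(v, S) \<in> splittings" "(v', S') \<in> splittings" and eq: "\<Union> (L ` S) = \<Union> (L ` S')"
  shows "v = v'" "S = S'"
proof -
  have le: "D v \<subseteq> D v'"
    if "(v, S) \<in> splittings" "(v', S') \<in> splittings" "\<Union> (L ` S) = \<Union> (L ` S')" for v v' S S'
  proof -
    have v: "v \<in> verts \<Gamma>" "v' \<in> verts \<Gamma>" "S \<subseteq> C v" "S' \<subseteq> C v'" "2 \<le> card S"
      using that by (auto simp: splittings_def)
    then obtain h where h: "h \<in> S" by fastforce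
    have "\<not> S \<subseteq> {h}" using card_mono[of "{h}" S] v by auto
    then obtain h' where h': "h' \<in> S" "h' \<noteq> h" by blast
    obtain i where i: "i \<in> L h" using beyond_nonempty[of h v] h v children_half_edge by blast
    obtain j where j: "j \<in> L h'" using beyond_nonempty[of h' v] h' v children_half_edge by blast
    have "is_median v h h' i j" using v h h' i j by (auto simp: is_median_def)
    moreover have "i \<in> \<Union> (L ` S')" "j \<in> \<Union> (L ` S')"
      using that(3) h h' i j by blast+
    then have "i \<in> D v'" "j \<in> D v'" using v(4) unfolding desc_def by blast+
    ultimately show ?thesis using median_least v by blast
  qed
  have "D v = D v'" using le[OF vS eq] le[OF vS(2,1) eq[symmetric]] by simp
  then show vv: "v = v'" using inj_on_desc vS by (auto simp: splittings_def dest: inj_onD)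
  have "S \<subseteq> S'" if SS: "S \<subseteq> C v" "S' \<subseteq> C v" "\<Union> (L ` S) = \<Union> (L ` S')" for S S'
  proof
    fix h assume h: "h \<in> S"
    then have hv: "h \<in> H v" using SS children_half_edge by blast
    then obtain i where i: "i \<in> L h" using beyond_nonempty by blast
    then obtain h' where h': "h' \<in> S'" "i \<in> L h'" using SS(3) h by blast
    then have "h' \<in> H v" using SS children_half_edge by blast
    then show "h \<in> S'" using beyond_unique[OF hv _ i h'(2)] h' by simp
  qed
  moreover have "S \<subseteq> C v" "S' \<subseteq> C v" using vS vv by (auto simp: splittings_def)
  ultimately show "S = S'" using eq by (metis subset_antisym)
qed

text \<open>
  The cones having the cone of the tree as a facet are the cones of the splittings. Exchanging the
  two sides of a splitting if necessary, the root may be assumed to stay at the old vertex.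
\<close>

lemma star_eq:
  "{\<sigma> \<in> Mtrop n. cone_dim \<sigma> = Suc (card (edges \<Gamma>)) \<and> facet_of (cone_of n \<Gamma>) \<sigma>} =
    (\<lambda>(v, S). cone_of n (split_vertex \<Gamma> v S)) ` splittings"
proof (intro equalityI subsetI)
  fix \<sigma> assume "\<sigma> \<in> {\<sigma> \<in> Mtrop n. cone_dim \<sigma> = Suc (card (edges \<Gamma>)) \<and> facet_of (cone_of n \<Gamma>) \<sigma>}"
  then have \<sigma>: "\<sigma> \<in> Mtrop n" and "facet_of (cone_of n \<Gamma>) \<sigma>" by auto
  then obtain a where a: "a \<in> edges (cone_tree \<sigma>)" "tree_iso n \<Gamma> (contract a (cone_tree \<sigma>))"
    by (auto simp: facet_of_def cone_of_def)
  interpret t: stable n "cone_tree \<sigma>"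
    using Mtrop_cone_tree(1)[OF \<sigma>] by unfold_locales
  obtain v S where vS: "v \<in> verts \<Gamma>" "S \<subseteq> H v" "tree_iso n (cone_tree \<sigma>) (split_vertex \<Gamma> v S)"
    using t.contract_is_split[OF stable a(1) tree_iso_sym[OF a(2)]] by blast
  have *: "\<sigma> \<in> (\<lambda>(v, S). cone_of n (split_vertex \<Gamma> v S)) ` splittings"
    if S: "S \<subseteq> C v" "tree_iso n (cone_tree \<sigma>) (split_vertex \<Gamma> v S)" for S
  proof -
    have "S \<subseteq> H v" using S(1) children_half_edge by blast
    then interpret s: vertex_split n \<Gamma> v S using vS by unfold_locales
    have st: "stable_tree n (split_vertex \<Gamma> v S)" using stable_tree_iso t.stable S(2) by blast
    then have "(v, S) \<in> splittings" using s.stable_T_iff vS(1) S(1) by (simp add: splittings_def)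
    moreover have "\<sigma> = cone_of n (split_vertex \<Gamma> v S)"
      using Mtrop_cone_tree(2)[OF \<sigma>] cone_of_eq_iff[OF t.stable st] S(2) by simp
    ultimately show ?thesis by (intro image_eqI[of _ _ "(v, S)"]) auto
  qed
  interpret s: vertex_split n \<Gamma> v S using vS by unfold_locales
  show "\<sigma> \<in> (\<lambda>(v, S). cone_of n (split_vertex \<Gamma> v S)) ` splittings"
  proof (cases "S \<subseteq> C v")
    case True
    then show ?thesis using * vS by blast
  next
    case False
    then obtain r where r: "r \<in> S" "r \<in> H v" "k \<in> L r" using vS by (auto simp: children_def)
    then have "H v - S \<subseteq> C v" using children_root[OF r(2,3)] by blast
    then show ?thesis using * tree_iso_trans[OF vS(3) s.split_complement] by blast
  qed
next
  fix \<sigma> assume "\<sigma> \<in> (\<lambda>(v, S). cone_of n (split_vertex \<Gamma> v S)) ` splittings"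
  then obtain v S where vS: "(v, S) \<in> splittings" and \<sigma>: "\<sigma> = cone_of n (split_vertex \<Gamma> v S)" by auto
  let ?T = "split_vertex \<Gamma> v S" and ?a = "{v, Suc (Max (verts \<Gamma>))}"
  note T = splitting_stable[OF vS] and far = far_sides_splitting[OF vS]
  obtain \<phi> where \<phi>: "iso_by n \<phi> ?T (cone_tree \<sigma>)"
    using cone_tree_iso(2)[OF T] unfolding \<sigma> tree_iso_iff by blast
  interpret t: stable_iso n ?T \<phi> "cone_tree \<sigma>"
    using T \<phi> by unfold_locales
  have "tree_iso n \<Gamma> (contract (\<phi> ` ?a) (cone_tree \<sigma>))"
    using tree_iso_trans[OF far(3) t.contract_iso[OF far(2)]] .
  moreover have "\<phi> ` ?a \<in> edges (cone_tree \<sigma>)" using far(2) unfolding t.edges_iso by blast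
  ultimately have "facet_of (cone_of n \<Gamma>) \<sigma>"
    using stable_tree_iso[OF stable] unfolding facet_of_def cone_of_def by blast
  moreover have "cone_dim \<sigma> = Suc (card (edges \<Gamma>))"
    unfolding cone_dim_def t.card_edges_iso t.card_edges_contract[OF far(2)]
    using tree_iso_card_edges[OF stable far(3)] by simp
  moreover have "\<sigma> \<in> Mtrop n" using T \<sigma> by (auto simp: Mtrop_def)
  ultimately show "\<sigma> \<in> {\<sigma> \<in> Mtrop n. cone_dim \<sigma> = Suc (card (edges \<Gamma>)) \<and> facet_of (cone_of n \<Gamma>) \<sigma>}"
    by simp
qed

lemma inj_on_splitting_cone:
  "inj_on (\<lambda>(v, S). cone_of n (split_vertex \<Gamma> v S)) splittings"
proof (rule inj_onI, clarify)
  fix v S v' S'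
  assume vS: "(v, S) \<in> splittings" "(v', S') \<in> splittings"
    and eq: "cone_of n (split_vertex \<Gamma> v S) = cone_of n (split_vertex \<Gamma> v' S')"
  note T = splitting_stable[OF vS(1)] splitting_stable[OF vS(2)]
  have iso: "tree_iso n (split_vertex \<Gamma> v S) (split_vertex \<Gamma> v' S')"
    using eq cone_of_eq_iff[OF T] by simp
  let ?X = "far_side n k (split_vertex \<Gamma> v S) ` edges (split_vertex \<Gamma> v S)"
  have "?X - {\<Union> (L ` S)} = ?X - {\<Union> (L ` S')}"
    using far_sides_splitting(4)[OF vS(1)] far_sides_splitting(4)[OF vS(2)]
      tree_iso_far_sides[OF T(1) iso k] by simp
  moreover have "\<Union> (L ` S) \<in> ?X"
    using imageI[OF far_sides_splitting(2)[OF vS(1)]] unfolding far_sides_splitting(1)[OF vS(1), symmetric] .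
  moreover have "\<Union> (L ` S') \<in> ?X"
    using imageI[OF far_sides_splitting(2)[OF vS(2)]]
    unfolding far_sides_splitting(1)[OF vS(2), symmetric] tree_iso_far_sides[OF T(1) iso k, symmetric] .
  moreover have "a = b" if "X - {a} = X - {b}" "a \<in> X" "b \<in> X" for X :: "nat set set" and a b
    using that by blast
  ultimately have "\<Union> (L ` S) = \<Union> (L ` S')" by metis
  then show "v = v' \<and> S = S'" using splitting_determined[OF vS] by blast
qed

lemma normal_vec_splitting:
  assumes vS: "(v, S) \<in> splittings"
  shows "normal_vec n k (cone_of n \<Gamma>) (cone_of n (split_vertex \<Gamma> v S)) = v_vec (\<Union> (L ` S))"
proof -
  let ?T = "split_vertex \<Gamma> v S" and ?a = "{v, Suc (Max (verts \<Gamma>))}"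
  note T = splitting_stable[OF vS] and far = far_sides_splitting[OF vS]
  let ?\<sigma> = "cone_of n ?T"
  obtain \<phi> where \<phi>: "iso_by n \<phi> ?T (cone_tree ?\<sigma>)"
    using cone_tree_iso(2)[OF T] unfolding tree_iso_iff by blast
  interpret t: stable_iso n ?T \<phi> "cone_tree ?\<sigma>"
    using T \<phi> by unfold_locales
  interpret c: rooted_stable n "cone_tree ?\<sigma>" k
    using t.stable_iso k by unfold_locales
  have iso: "tree_iso n \<Gamma> (contract (\<phi> ` ?a) (cone_tree ?\<sigma>))"
    using tree_iso_trans[OF far(3) t.contract_iso[OF far(2)]] .
  have a: "\<phi> ` ?a \<in> edges (cone_tree ?\<sigma>)" using far(2) unfolding t.edges_iso by blast
  have "facet_edge (cone_of n \<Gamma>) ?\<sigma> = \<phi> ` ?a"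
    unfolding facet_edge_def
  proof (rule the_equality)
    show "\<phi> ` ?a \<in> edges (cone_tree ?\<sigma>) \<and> contract (\<phi> ` ?a) (cone_tree ?\<sigma>) \<in> cone_of n \<Gamma>"
      using a iso stable_tree_iso[OF stable] by (simp add: cone_of_def)
    show "b = \<phi> ` ?a" if "b \<in> edges (cone_tree ?\<sigma>) \<and> contract b (cone_tree ?\<sigma>) \<in> cone_of n \<Gamma>" for b
      using c.contract_iso_unique[OF stable _ a _ iso, of b] that by (simp add: cone_of_def)
  qed
  then show ?thesis
    using t.far_side_iso[OF far(2) k] far(1) by (simp add: normal_vec_def)
qed

lemma zero_mod_cone_iff:
  "zero_mod_cone n k (cone_of n \<Gamma>) w \<longleftrightarrow> w \<in> (cone_span :: (nat set \<Rightarrow> 'k::field) set)"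
proof -
  have "(\<lambda>a. v_vec (far_side n k (cone_tree (cone_of n \<Gamma>)) a)) ` edges (cone_tree (cone_of n \<Gamma>)) =
      (v_vec ` far_side n k \<Gamma> ` edges \<Gamma> :: (nat set \<Rightarrow> 'k) set)"
    using tree_iso_far_sides[OF stable cone_tree_iso(2)[OF stable] k] by (metis image_image)
  then show ?thesis unfolding zero_mod_cone_def desc_family by simp
qed

end

section \<open>Balancing and WDVV at one tree\<close>

text \<open>
  A rooted stable tree whose legs are coloured by \<open>\<alpha>\<close>, together with a symmetric pairing and a
  symmetric array \<open>x\<close> of unknowns.
\<close>

locale weighted_tree = rooted_stable +
  fixes A :: "'a set" and etaI :: "'a \<Rightarrow> 'a \<Rightarrow> 'k::field" and x :: "'a list \<Rightarrow> 'k" and \<alpha> :: "'a list"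
  assumes \<alpha>: "\<alpha> \<in> lists A" "length \<alpha> = n"
    and etaI: "\<And>a b. a \<in> A \<Longrightarrow> b \<in> A \<Longrightarrow> etaI a b = etaI b a"
    and x: "\<And>\<beta> \<gamma>. \<beta> \<in> lists A \<Longrightarrow> \<gamma> \<in> lists A \<Longrightarrow> 3 \<le> length \<beta> \<Longrightarrow> mset \<beta> = mset \<gamma> \<Longrightarrow> x \<beta> = x \<gamma>"
begin

lemma weight_tree_iso:
  assumes "stable_tree n T" "tree_iso n T T'"
  shows "weight A etaI x \<alpha> T' = weight A etaI x \<alpha> T"
proof -
  obtain \<phi> where "iso_by n \<phi> T T'" using assms(2) unfolding tree_iso_iff by blast
  then interpret t: stable_iso n T \<phi> T' using assms(1) by unfold_locales
  show ?thesis by (rule t.weight_iso[OF \<alpha>]; (rule etaI | rule x); assumption)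
qed

text \<open>The weight of a splitting, extended by zero to the sets that do not give stable trees.\<close>

definition split_weight :: "nat \<Rightarrow> half_edge set \<Rightarrow> 'k" where
  "split_weight v S =
     (if 2 \<le> card S \<and> 2 \<le> card (H v - S) then weight A etaI x \<alpha> (split_vertex \<Gamma> v S) else 0)"

lemma split_weight_complement:
  assumes "v \<in> verts \<Gamma>" "S \<subseteq> H v"
  shows "split_weight v (H v - S) = split_weight v S"
proof -
  interpret s: vertex_split n \<Gamma> v S using assms by unfold_locales
  have "H v - (H v - S) = S" using assms by blast
  then show ?thesis
    using weight_tree_iso[OF _ s.split_complement] s.stable_T_iff by (auto simp: split_weight_def)
qed

text \<open>
  The sum over the cones around the cone of the tree becomes a sum over the vertices \<open>v\<close> and all
  sets of half-edges at \<open>v\<close> leading away from the root.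
\<close>

lemma balanced_iff_span:
  assumes "d = int (Suc (card (edges \<Gamma>)))"
  shows "balanced_at A etaI k x \<alpha> d (cone_of n \<Gamma>) \<longleftrightarrow>
    (\<Sum>v\<in>verts \<Gamma>. \<Sum>S\<in>Pow (C v). scaleQ (split_weight v S) (v_vec (\<Union> (L ` S)))) \<in> cone_span"
proof -
  let ?\<sigma> = "\<lambda>v S. cone_of n (split_vertex \<Gamma> v S)"
  let ?f = "\<lambda>v S. scaleQ (split_weight v S) (v_vec (\<Union> (L ` S)))"
  have "(\<Sum>\<sigma> \<in> {\<sigma> \<in> Mtrop n. int (cone_dim \<sigma>) = d \<and> facet_of (cone_of n \<Gamma>) \<sigma>}.
      scaleQ (weight A etaI x \<alpha> (cone_tree \<sigma>)) (normal_vec n k (cone_of n \<Gamma>) \<sigma>)) =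
    (\<Sum>(v, S)\<in>splittings. scaleQ (weight A etaI x \<alpha> (cone_tree (?\<sigma> v S)))
      (normal_vec n k (cone_of n \<Gamma>) (?\<sigma> v S)))"
    unfolding assms of_nat_eq_iff star_eq
    by (subst sum.reindex[OF inj_on_splitting_cone]) (simp add: case_prod_unfold comp_def)
  also have "\<dots> = (\<Sum>(v, S)\<in>splittings. ?f v S)"
  proof (intro sum.cong refl, clarify)
    fix v S assume vS: "(v, S) \<in> splittings"
    note T = splitting_stable[OF vS]
    show "scaleQ (weight A etaI x \<alpha> (cone_tree (?\<sigma> v S))) (normal_vec n k (cone_of n \<Gamma>) (?\<sigma> v S)) = ?f v S"
      using weight_tree_iso[OF T cone_tree_iso(2)[OF T]] vS
      by (simp add: normal_vec_splitting[OF vS] split_weight_def splittings_def)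
  qed
  also have "\<dots> = (\<Sum>(v, S)\<in>Sigma (verts \<Gamma>) (\<lambda>v. Pow (C v)). ?f v S)"
  proof (rule sum.mono_neutral_left)
    show "finite (Sigma (verts \<Gamma>) (\<lambda>v. Pow (C v)))"
      using finite_V finite_children by (intro finite_SigmaI) auto
  qed (auto simp: splittings_def split_weight_def)
  also have "\<dots> = (\<Sum>v\<in>verts \<Gamma>. \<Sum>S\<in>Pow (C v). ?f v S)"
    using finite_V finite_children by (intro sum.Sigma[symmetric]) auto
  finally show ?thesis
    unfolding balanced_at_def Let_def \<alpha>(2) zero_mod_cone_iff by simp
qed

lemma sum_Spl:
  assumes v: "v \<in> verts \<Gamma>" and abcf: "{a, b, c, f} \<subseteq> H v" "distinct [a, b, c, f]"
  shows "(\<Sum>\<Gamma>' \<in> Spl n \<Gamma> v a b c f. weight A etaI x \<alpha> \<Gamma>') =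
    (\<Sum>S | S \<subseteq> H v \<and> a \<in> S \<and> b \<in> S \<and> c \<notin> S \<and> f \<notin> S. split_weight v S)"
proof -
  let ?X = "{S. S \<subseteq> H v \<and> a \<in> S \<and> b \<in> S \<and> c \<notin> S \<and> f \<notin> S}"
  have "inj_on (split_vertex \<Gamma> v) ?X"
    using inj_on_split_vertex[OF v] by (rule inj_on_subset) auto
  then have "(\<Sum>\<Gamma>' \<in> Spl n \<Gamma> v a b c f. weight A etaI x \<alpha> \<Gamma>') =
      (\<Sum>S\<in>?X. weight A etaI x \<alpha> (split_vertex \<Gamma> v S))"
    unfolding Spl_def by (subst sum.reindex) (simp_all add: comp_def)
  also have "\<dots> = (\<Sum>S\<in>?X. split_weight v S)"
  proof (rule sum.cong)
    fix S assume S: "S \<in> ?X"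
    then have "{a, b} \<subseteq> S" "{c, f} \<subseteq> H v - S" using abcf by auto
    then have "card {a, b} \<le> card S" "card {c, f} \<le> card (H v - S)"
      using S finite_half_edges[of v] finite_subset[of S "H v"] by (auto intro!: card_mono)
    then show "weight A etaI x \<alpha> (split_vertex \<Gamma> v S) = split_weight v S"
      using abcf(2) by (simp add: split_weight_def)
  qed simp
  finally show ?thesis .
qed

lemma balanced_iff_WDVV:
  assumes "d = int (Suc (card (edges \<Gamma>)))"
  shows "balanced_at A etaI k x \<alpha> d (cone_of n \<Gamma>) \<longleftrightarrow>
    (\<forall>v\<in>verts \<Gamma>. \<forall>a b c f. {a, b, c, f} \<subseteq> H v \<longrightarrow> distinct [a, b, c, f] \<longrightarrow> WDVV A etaI x \<alpha> \<Gamma> v a b c f)"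
proof -
  have vertex: "(\<exists>c. \<forall>a\<in>C v. \<forall>b\<in>C v. a \<noteq> b \<longrightarrow> (\<Sum>S | S \<subseteq> C v \<and> a \<in> S \<and> b \<in> S. split_weight v S) = c) \<longleftrightarrow>
      (\<forall>a b c f. {a, b, c, f} \<subseteq> H v \<longrightarrow> distinct [a, b, c, f] \<longrightarrow> WDVV A etaI x \<alpha> \<Gamma> v a b c f)"
    if v: "v \<in> verts \<Gamma>" for v
  proof -
    obtain r where r: "r \<in> H v" "k \<in> L r" using beyond_ex[OF v k] .
    have "WDVV A etaI x \<alpha> \<Gamma> v a b c f \<longleftrightarrow>
        (\<Sum>S | S \<subseteq> H v \<and> a \<in> S \<and> b \<in> S \<and> c \<notin> S \<and> f \<notin> S. split_weight v S) =
        (\<Sum>S | S \<subseteq> H v \<and> a \<in> S \<and> f \<in> S \<and> b \<notin> S \<and> c \<notin> S. split_weight v S)"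
      if abcf: "{a, b, c, f} \<subseteq> H v" "distinct [a, b, c, f]" for a b c f
    proof -
      have "{a, f, b, c} \<subseteq> H v" "distinct [a, f, b, c]" using abcf by auto
      then show ?thesis
        using sum_Spl[OF v abcf] sum_Spl[OF v, of a f b c] by (simp add: WDVV_def \<alpha>(2))
    qed
    then show ?thesis
      unfolding children_root[OF r]
      using wdvv_iff_constant_pairs[where W = "split_weight v", OF finite_half_edges r(1) split_weight_complement[OF v]] by simp
  qed
  show ?thesis
    unfolding balanced_iff_span[OF assms] combination_in_span_iff by (intro ball_cong refl vertex)
qed

end

theorem theorem3p11:
  fixes scaleV :: "'k::field_char_0 \<Rightarrow> 'v::ab_group_add \<Rightarrow> 'v"
    and eta :: "'v \<Rightarrow> 'v \<Rightarrow> 'k"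
    and A :: "'a set"
    and e :: "'a \<Rightarrow> 'v"
    and etaI :: "'a \<Rightarrow> 'a \<Rightarrow> 'k"
    and scaleC :: "'k \<Rightarrow> 'c::ab_group_add \<Rightarrow> 'c"
    and Ch :: "mspace \<Rightarrow> nat \<Rightarrow> 'c set"
    and pull :: "mmap \<Rightarrow> 'c \<Rightarrow> 'c"
    and box :: "nat \<Rightarrow> nat \<Rightarrow> nat \<Rightarrow> nat \<Rightarrow> 'c \<Rightarrow> 'c \<Rightarrow> 'c"
    and \<Omega> :: "nat \<Rightarrow> 'v list \<Rightarrow> 'c"
    and d :: "'a list \<Rightarrow> int"
    and k :: "nat \<Rightarrow> nat"
    and x :: "'a list \<Rightarrow> 'k"
  assumes "cohft scaleV eta A e etaI scaleC Ch pull box \<Omega>"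
    and "\<forall>\<alpha>\<in>lists A. 3 \<le> length \<alpha> \<longrightarrow> \<Omega> 0 (map e \<alpha>) \<in> chow_of_dim Ch (length \<alpha>) (d \<alpha>)"
    and "\<forall>n\<ge>3. k n \<in> {1..n}"
    and "admissible_array A d x"
  shows "(\<forall>\<alpha>\<in>lists A. 3 \<le> length \<alpha> \<longrightarrow> d \<alpha> \<ge> 1 \<longrightarrow>
            (\<forall>\<tau>\<in>Mtrop (length \<alpha>). int (cone_dim \<tau>) = d \<alpha> - 1 \<longrightarrow>
               balanced_at A etaI (k (length \<alpha>)) x \<alpha> (d \<alpha>) \<tau>))
     \<longleftrightarrow>
         (\<forall>\<alpha>\<in>lists A. 3 \<le> length \<alpha> \<longrightarrow> d \<alpha> \<ge> 1 \<longrightarrow>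
            (\<forall>\<Gamma>. stable_tree (length \<alpha>) \<Gamma> \<longrightarrow> int (card (edges \<Gamma>)) = d \<alpha> - 1 \<longrightarrow>
               (\<forall>v\<in>verts \<Gamma>. \<forall>a b c f. {a, b, c, f} \<subseteq> half_edges (length \<alpha>) \<Gamma> v \<longrightarrow>
                  distinct [a, b, c, f] \<longrightarrow> WDVV A etaI x \<alpha> \<Gamma> v a b c f)))"
proof -
  interpret cohft scaleV eta A e etaI scaleC Ch pull box \<Omega> by (rule assms(1))
  let ?wdvv = "\<lambda>\<alpha> \<Gamma>. \<forall>v\<in>verts \<Gamma>. \<forall>a b c f. {a, b, c, f} \<subseteq> half_edges (length \<alpha>) \<Gamma> v \<longrightarrow>
                  distinct [a, b, c, f] \<longrightarrow> WDVV A etaI x \<alpha> \<Gamma> v a b c f"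
  have main: "balanced_at A etaI (k (length \<alpha>)) x \<alpha> (d \<alpha>) (cone_of (length \<alpha>) \<Gamma>) \<longleftrightarrow> ?wdvv \<alpha> \<Gamma>"
    if "\<alpha> \<in> lists A" "3 \<le> length \<alpha>" "stable_tree (length \<alpha>) \<Gamma>" "int (card (edges \<Gamma>)) = d \<alpha> - 1" for \<alpha> \<Gamma>
  proof -
    interpret weighted_tree "length \<alpha>" \<Gamma> "k (length \<alpha>)" A etaI x \<alpha>
    proof unfold_locales
      show "k (length \<alpha>) \<in> {1..length \<alpha>}" using assms(3) that(2) by blast
      show "etaI a b = etaI b a" if "a \<in> A" "b \<in> A" for a b
        using V.etaI_symmetric that .
      show "x \<beta> = x \<gamma>" if "\<beta> \<in> lists A" "\<gamma> \<in> lists A" "3 \<le> length \<beta>" "mset \<beta> = mset \<gamma>" for \<beta> \<gamma>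
        using assms(4) that unfolding admissible_array_def by blast
    qed (use that in auto)
    show ?thesis using that(4) by (intro balanced_iff_WDVV) simp
  qed
  have "(\<forall>\<tau>\<in>Mtrop (length \<alpha>). int (cone_dim \<tau>) = d \<alpha> - 1 \<longrightarrow>
          balanced_at A etaI (k (length \<alpha>)) x \<alpha> (d \<alpha>) \<tau>) \<longleftrightarrow>
        (\<forall>\<Gamma>. stable_tree (length \<alpha>) \<Gamma> \<longrightarrow> int (card (edges \<Gamma>)) = d \<alpha> - 1 \<longrightarrow> ?wdvv \<alpha> \<Gamma>)"
    if \<alpha>: "\<alpha> \<in> lists A" "3 \<le> length \<alpha>" for \<alpha>
  proof -
    have dim: "cone_dim (cone_of (length \<alpha>) \<Gamma>) = card (edges \<Gamma>)" if "stable_tree (length \<alpha>) \<Gamma>" for \<Gamma>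
      unfolding cone_dim_def by (intro tree_iso_card_edges[OF that] cone_tree_iso that)
    have "(\<forall>\<tau>\<in>Mtrop (length \<alpha>). int (cone_dim \<tau>) = d \<alpha> - 1 \<longrightarrow>
          balanced_at A etaI (k (length \<alpha>)) x \<alpha> (d \<alpha>) \<tau>) \<longleftrightarrow>
        (\<forall>\<Gamma>. stable_tree (length \<alpha>) \<Gamma> \<longrightarrow> int (card (edges \<Gamma>)) = d \<alpha> - 1 \<longrightarrow>
          balanced_at A etaI (k (length \<alpha>)) x \<alpha> (d \<alpha>) (cone_of (length \<alpha>) \<Gamma>))"
      unfolding Mtrop_def by (simp add: dim)
    also have "\<dots> \<longleftrightarrow> (\<forall>\<Gamma>. stable_tree (length \<alpha>) \<Gamma> \<longrightarrow> int (card (edges \<Gamma>)) = d \<alpha> - 1 \<longrightarrow> ?wdvv \<alpha> \<Gamma>)"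
      by (intro all_cong1 imp_cong refl main[OF \<alpha>])
    finally show ?thesis .
  qed
  then show ?thesis by (intro ball_cong imp_cong refl)
qed

end
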